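(* Let $n\in\mathbb N$, $k\in\{1,\ldots,n\}$, and let $\beta>\frac{n-1}{2}$ be an integer or half-integer. If $2\beta-n$ is even and $k$ is even, then there is a rational number $q$ such that $\tilde{\mathbf J}_{n,k}(\beta)=q\pi^{-(n-k)}$ if $n-k$ is even, and $\tilde{\mathbf J}_{n,k}(\beta)=q\pi^{-(n-k-1)}$ if $n-k$ is odd.
   Context: For $d\in\mathbb N$ and $\beta>d/2$ the $d$-dimensional beta' distribution has density $\tilde f_{d,\beta}(x)=\tilde c_{d,\beta}(1+\|x\|^2)^{-\beta}$ with $\tilde c_{d,\beta}=\Gamma(\beta)/(\pi^{d/2}\Gamma(\beta-\frac d2))$. The internal angle $\beta(F,T)$ of a simplex $T\subset\mathbb R^d$ at a face $F$ is $\lim_{r\downarrow0}\mathrm{Vol}_d(B_r(z)\cap T)/\mathrm{Vol}_d(B_r(z))$, $z$ in the relative interior of $F$ (full angle $=1$). For $n\ge2$, $\beta>\frac{n-1}{2}$ and $\tilde X_1,\ldots,\tilde X_n$ i.i.d. in $\mathbb R^{n-1}$ with density $\tilde f_{n-1,\beta}$, $\tilde{\mathbf J}_{n,k}(\beta)=\binom nk\,\mathbb E\,\beta([\tilde X_1,\ldots,\tilde X_k],[\tilde X_1,\ldots,\tilde X_n])$; by convention $\tilde{\mathbf J}_{n,n}(\beta)=1$. *)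

theory Defs
  imports "HOL-Probability.Probability"
begin

definition betap_const :: "nat \<Rightarrow> real \<Rightarrow> real" where
  "betap_const d \<beta> = Gamma \<beta> / (pi powr (real d / 2) * Gamma (\<beta> - real d / 2))"

definition betap_density :: "real \<Rightarrow> 'a::euclidean_space \<Rightarrow> real" where
  "betap_density \<beta> x = betap_const DIM('a) \<beta> * (1 + (norm x)\<^sup>2) powr (- \<beta>)"

definition betap_measure :: "real \<Rightarrow> 'a::euclidean_space measure" where
  "betap_measure \<beta> = density lborel (\<lambda>x. ennreal (betap_density \<beta> x))"

text \<open>Internal angle of the polytope T at its face F, measured at a point z of the
  relative interior of F (the limit does not depend on the choice of z).\<close>
definition internal_angle :: "'a::euclidean_space set \<Rightarrow> 'a set \<Rightarrow> real" where
  "internal_angle F T =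
     (let z = (SOME z. z \<in> rel_interior F) in
      Lim (at_right 0) (\<lambda>r. measure lborel (ball z r \<inter> T) / measure lborel (ball z r)))"

text \<open>The quantity tilde J_{n,k}(beta), with n = DIM('a) + 1, i.e. the points
  X 0, ..., X (n-1) live in a space of dimension n - 1.\<close>
definition Jtilde :: "'a::euclidean_space itself \<Rightarrow> nat \<Rightarrow> real \<Rightarrow> real" where
  "Jtilde (t :: 'a itself) k \<beta> =
     (if k = DIM('a) + 1 then 1
      else real ((DIM('a) + 1) choose k) *
        (\<integral>X. internal_angle (convex hull (X ` {..<k})) (convex hull (X ` {..<DIM('a) + 1}))
           \<partial>(PiM {..<DIM('a) + 1} (\<lambda>_. (betap_measure \<beta> :: 'a measure)))))"

end

theory Submission
  imports Defs "HOL-Real_Asymp.Real_Asymp"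
begin

text \<open>
  Write \<open>d = n - 1\<close>. For a simplex with vertices \<open>X\<^sub>0, \<dots>, X\<^sub>d\<close> in general position, the
  internal angle at \<open>[X\<^sub>0, \<dots>, X\<^sub>k\<^sub>-\<^sub>1]\<close> is the Gaussian measure of the cone of all
  \<open>\<Sum> \<lambda>\<^sub>i X\<^sub>i\<close> with \<open>\<Sum> \<lambda>\<^sub>i = 0\<close> and \<open>\<lambda>\<^sub>i \<ge> 0\<close> for \<open>i \<ge> k\<close>. A beta' vector is a
  centred Gaussian vector with random inverse variance \<open>m\<close>, a Gamma variable. For fixed
  \<open>m\<^sub>0, \<dots>, m\<^sub>d\<close> the expected angle is invariant under the orthogonal group of the form
  \<open>\<Sum> \<lambda>\<^sub>i\<^sup>2 / m\<^sub>i\<close>, hence it equals the measure of \<open>{\<lambda>. \<lambda>\<^sub>i \<ge> 0 for i \<ge> k}\<close> under the centred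
  Gaussian law with this form. Averaging over \<open>m\<close> shows that the expected angle is
  \<open>H\<^sub>k / H\<close>, where \<open>H\<^sub>k\<close> is the integral of \<open>\<Prod> K(\<lambda>\<^sub>i)\<close> over that cone, \<open>H\<close> the one over the
  whole space, and \<open>K\<close> a Bessel function whose \<open>k\<close>-fold convolution power is again of
  this type. For even \<open>k\<close> it is \<open>\<pi>\<^sup>k\<close> times a rational polynomial times
  an exponential function, and the remaining integrals over \<open>\<lambda>\<^sub>i > 0\<close> are rational Beta
  integrals. So \<open>H\<^sub>k\<close> is a rational multiple of \<open>\<pi>\<^sup>k\<close>, and \<open>H\<close> one of \<open>\<pi>\<^sup>n\<close> or, by symmetry in one
  coordinate, of \<open>\<pi>\<^sup>n\<^sup>-\<^sup>1\<close>, according to the parity of \<open>n\<close>.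
\<close>

section \<open>Lebesgue measure on finite powers of a Euclidean space\<close>

text \<open>Parity enters through the index \<open>s\<close> = \<beta> - d/2 of the kernel. Indices
  add under convolution, and a kernel of integer index (half-integer Bessel order) is elementary. If
  2\<beta> - n is even, then \<open>s\<close> = p + 1/2, so the k free weights together produce the
  index k s, an integer for even k. Each constrained weight keeps a kernel of index p + 1/2, which
  is not elementary; the factor exp (-2x) left by the free weights is what makes its moments
  rational. The obstacle in the averaging is the normalization: for fixed m the Gaussian mass of the
  whole weight space contains sqrt (sum m), which does not factor over the vertices and so spoils
  the product of kernels. Homogeneity in m trades it for a constant that does not depend on the
  cone, and all such constants cancel in \<open>H\<^sub>k\<close> / \<open>H\<close>. For this
  reason a cone is always compared with the whole space, in extended nonnegative reals and through
  equations between products: Jacobians stay implicit, and exchanging integrals requires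
  measurability only.\<close>

interpretation lborel_prod: product_sigma_finite "\<lambda>_. lborel"
  by standard

abbreviation lborelP :: "'i set \<Rightarrow> ('i \<Rightarrow> 'a::euclidean_space) measure" where
  "lborelP I \<equiv> PiM I (\<lambda>_. lborel)"

lemma nn_integral_swap:
  assumes "sigma_finite_measure M" "sigma_finite_measure N"
    and "case_prod f \<in> borel_measurable (M \<Otimes>\<^sub>M N)"
  shows "(\<integral>\<^sup>+x. \<integral>\<^sup>+y. f x y \<partial>N \<partial>M) = (\<integral>\<^sup>+y. \<integral>\<^sup>+x. f x y \<partial>M \<partial>N)"
proof -
  interpret M: sigma_finite_measure M by fact
  interpret N: sigma_finite_measure N by fact
  interpret pair_sigma_finite M N ..
  show ?thesis using Fubini'[OF assms(3)] by simp
qed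

lemma sigma_finite_lborelP [simp]: "finite I \<Longrightarrow> sigma_finite_measure (lborelP I)"
  by (rule lborel_prod.sigma_finite)

lemma sigma_finite_lborel' [simp]: "sigma_finite_measure lborel"
  by (rule lborel.sigma_finite_measure_axioms)

lemma nn_integral_lborel_affine:
  fixes t :: "'a::euclidean_space"
  assumes [measurable]: "F \<in> borel_measurable borel" and "s \<noteq> 0"
  shows "(\<integral>\<^sup>+x. F x \<partial>lborel) = ennreal (\<bar>s\<bar> ^ DIM('a)) * (\<integral>\<^sup>+x. F (t + s *\<^sub>R x) \<partial>lborel)"
  by (subst lborel_affine[OF assms(2), of t])
     (simp add: nn_integral_density nn_integral_distr nn_integral_cmult)

text \<open>Induction on the index set, one coordinate at a time. The factor \<open>s\<close> may be
  negative; \<open>s\<close> = -1 gives the point reflections used below.\<close>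

lemma nn_integral_lborelP_affine:
  fixes F :: "('i \<Rightarrow> 'a::euclidean_space) \<Rightarrow> ennreal"
  assumes "finite I" "F \<in> borel_measurable (lborelP I)" "s \<noteq> 0"
  shows "(\<integral>\<^sup>+x. F x \<partial>lborelP I) =
    ennreal (\<bar>s\<bar> ^ (DIM('a) * card I)) * (\<integral>\<^sup>+x. F (\<lambda>i\<in>I. y i + s *\<^sub>R x i) \<partial>lborelP I)"
  using assms(1,2)
proof (induction I arbitrary: F rule: finite_induct)
  case empty
  show ?case by (simp add: PiM_empty nn_integral_count_space_finite restrict_def)
next
  case (insert i I)
  note [measurable] = insert.prems
  have *: "(\<lambda>j\<in>insert i I. y j + s *\<^sub>R (x(i := z)) j) = (\<lambda>j\<in>I. y j + s *\<^sub>R x j)(i := y i + s *\<^sub>R z)"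
    if "x \<in> space (lborelP I)" for x z
    using insert.hyps by (auto simp: fun_eq_iff)
  have [measurable]: "(\<lambda>x. F (\<lambda>j\<in>insert i I. y j + s *\<^sub>R x j)) \<in> borel_measurable (lborelP (insert i I))"
    by (rule measurable_compose[OF _ insert.prems]) measurable
  have "(\<integral>\<^sup>+x. F x \<partial>lborelP (insert i I)) = (\<integral>\<^sup>+x. \<integral>\<^sup>+z. F (x(i := z)) \<partial>lborel \<partial>lborelP I)"
    using insert by (intro lborel_prod.product_nn_integral_insert)
  also have "\<dots> = ennreal (\<bar>s\<bar> ^ (DIM('a) * card I)) *
      (\<integral>\<^sup>+x. \<integral>\<^sup>+z. F ((\<lambda>j\<in>I. y j + s *\<^sub>R x j)(i := z)) \<partial>lborel \<partial>lborelP I)"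
    by (subst insert.IH) simp_all
  also have "\<dots> = ennreal (\<bar>s\<bar> ^ (DIM('a) * card I)) *
      (\<integral>\<^sup>+x. ennreal (\<bar>s\<bar> ^ DIM('a)) * \<integral>\<^sup>+z. F ((\<lambda>j\<in>I. y j + s *\<^sub>R x j)(i := y i + s *\<^sub>R z)) \<partial>lborel \<partial>lborelP I)"
  proof (intro arg_cong2[where f="(*)"] refl nn_integral_cong)
    fix x :: "'i \<Rightarrow> 'a" assume x: "x \<in> space (lborelP I)"
    have "(\<lambda>j\<in>I. y j + s *\<^sub>R x j) \<in> space (lborelP I)" by (auto simp: space_PiM)
    then have "(\<lambda>z. F ((\<lambda>j\<in>I. y j + s *\<^sub>R x j)(i := z))) \<in> borel_measurable borel"
      by measurable
    then show "(\<integral>\<^sup>+z. F ((\<lambda>j\<in>I. y j + s *\<^sub>R x j)(i := z)) \<partial>lborel) = ennreal (\<bar>s\<bar> ^ DIM('a)) *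
        (\<integral>\<^sup>+z. F ((\<lambda>j\<in>I. y j + s *\<^sub>R x j)(i := y i + s *\<^sub>R z)) \<partial>lborel)"
      using assms(3) by (rule nn_integral_lborel_affine)
  qed
  also have "\<dots> = ennreal (\<bar>s\<bar> ^ (DIM('a) * card I)) * ennreal (\<bar>s\<bar> ^ DIM('a)) *
      (\<integral>\<^sup>+x. \<integral>\<^sup>+z. F (\<lambda>j\<in>insert i I. y j + s *\<^sub>R (x(i := z)) j) \<partial>lborel \<partial>lborelP I)"
  proof -
    have e: "(\<integral>\<^sup>+x. \<integral>\<^sup>+z. F (\<lambda>j\<in>insert i I. y j + s *\<^sub>R (x(i := z)) j) \<partial>lborel \<partial>lborelP I) =
        (\<integral>\<^sup>+x. \<integral>\<^sup>+z. F ((\<lambda>j\<in>I. y j + s *\<^sub>R x j)(i := y i + s *\<^sub>R z)) \<partial>lborel \<partial>lborelP I)"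
      by (intro nn_integral_cong arg_cong[where f=F] *)
    show ?thesis unfolding e by (subst nn_integral_cmult) (measurable, simp add: mult.assoc)
  qed
  also have "ennreal (\<bar>s\<bar> ^ (DIM('a) * card I)) * ennreal (\<bar>s\<bar> ^ DIM('a)) = ennreal (\<bar>s\<bar> ^ (DIM('a) * card (insert i I)))"
    using insert by (simp add: ennreal_mult' power_add mult.commute)
  also have "(\<integral>\<^sup>+x. \<integral>\<^sup>+z. F (\<lambda>j\<in>insert i I. y j + s *\<^sub>R (x(i := z)) j) \<partial>lborel \<partial>lborelP I) =
      (\<integral>\<^sup>+x. F (\<lambda>j\<in>insert i I. y j + s *\<^sub>R x j) \<partial>lborelP (insert i I))"
    using insert by (intro lborel_prod.product_nn_integral_insert[symmetric]) auto
  finally show ?case .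
qed

text \<open>Uniqueness of Haar measure: insert \<open>F0\<close> at \<open>L x - y\<close> and exchange the integrals.\<close>

lemma haar_PiM:
  fixes L :: "('i \<Rightarrow> 'b::euclidean_space) \<Rightarrow> ('j \<Rightarrow> 'a::euclidean_space)"
  assumes fin: "finite I" "finite J"
    and L [measurable]: "L \<in> lborelP I \<rightarrow>\<^sub>M lborelP J"
    and trans: "\<And>y. y \<in> space (lborelP J) \<Longrightarrow>
      \<exists>\<mu>. \<forall>x\<in>space (lborelP I). L (\<lambda>i\<in>I. \<mu> i + x i) = (\<lambda>j\<in>J. y j + L x j)"
    and [measurable]: "F \<in> borel_measurable (lborelP J)" "F0 \<in> borel_measurable (lborelP J)"
  shows "(\<integral>\<^sup>+x. F (L x) \<partial>lborelP I) * (\<integral>\<^sup>+y. F0 y \<partial>lborelP J) =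
    (\<integral>\<^sup>+x. F0 (L x) \<partial>lborelP I) * (\<integral>\<^sup>+y. F y \<partial>lborelP J)"
proof -
  have L1 [measurable]: "(\<lambda>x. L x j) \<in> borel_measurable (lborelP I)" if "j \<in> J" for j
    using measurable_compose[OF L measurable_component_singleton[OF that]] by simp
  have L2: "(\<lambda>x. L (fst x) j) \<in> borel_measurable (lborelP I \<Otimes>\<^sub>M lborelP J)" if "j \<in> J" for j
    using measurable_compose[OF measurable_fst L1[OF that]] .
  have S2: "(\<lambda>x. snd x j) \<in> borel_measurable (lborelP I \<Otimes>\<^sub>M lborelP J)" if "j \<in> J" for j
    using measurable_compose[OF measurable_snd measurable_component_singleton[OF that, of "\<lambda>_. lborel"]] by simp
  have m1: "(\<lambda>x. F0 (\<lambda>j\<in>J. L (fst x) j - (snd x) j)) \<in> borel_measurable (lborelP I \<Otimes>\<^sub>M lborelP J)"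
  proof (rule measurable_compose[of _ _ "lborelP J" F0], rule measurable_restrict)
    fix j assume j: "j \<in> J"
    show "(\<lambda>x. L (fst x) j - snd x j) \<in> lborelP I \<Otimes>\<^sub>M lborelP J \<rightarrow>\<^sub>M lborel"
      unfolding measurable_lborel1 by (rule borel_measurable_diff[OF L2[OF j] S2[OF j]])
  qed fact
  have m2: "(\<lambda>x. F (\<lambda>j\<in>J. (snd x) j + L (fst x) j)) \<in> borel_measurable (lborelP I \<Otimes>\<^sub>M lborelP J)"
  proof (rule measurable_compose[of _ _ "lborelP J" F], rule measurable_restrict)
    fix j assume j: "j \<in> J"
    show "(\<lambda>x. snd x j + L (fst x) j) \<in> lborelP I \<Otimes>\<^sub>M lborelP J \<rightarrow>\<^sub>M lborel"
      unfolding measurable_lborel1 by (rule borel_measurable_add[OF S2[OF j] L2[OF j]])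
  qed fact
  have Lsp: "L x \<in> space (lborelP J)" if "x \<in> space (lborelP I)" for x
    using that measurable_space[OF L] by blast
  have aff: "(\<integral>\<^sup>+y. F0 (\<lambda>j\<in>J. L x j - y j) \<partial>lborelP J) = (\<integral>\<^sup>+y. F0 y \<partial>lborelP J)" for x
    using nn_integral_lborelP_affine[OF fin(2), of F0 "-1" "L x"] by simp
  have aff2: "(\<integral>\<^sup>+y. F (\<lambda>j\<in>J. y j + L x j) \<partial>lborelP J) = (\<integral>\<^sup>+y. F y \<partial>lborelP J)" for x
    using nn_integral_lborelP_affine[OF fin(2), of F 1 "L x"] by (simp add: add.commute)
  have "(\<integral>\<^sup>+x. F (L x) \<partial>lborelP I) * (\<integral>\<^sup>+y. F0 y \<partial>lborelP J) =
      (\<integral>\<^sup>+x. F (L x) * (\<integral>\<^sup>+y. F0 (\<lambda>j\<in>J. L x j - y j) \<partial>lborelP J) \<partial>lborelP I)"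
    unfolding aff by (rule nn_integral_multc[symmetric]) measurable
  also have "\<dots> = (\<integral>\<^sup>+x. \<integral>\<^sup>+y. F (L x) * F0 (\<lambda>j\<in>J. L x j - y j) \<partial>lborelP J \<partial>lborelP I)"
  proof (intro nn_integral_cong)
    fix x :: "'i \<Rightarrow> 'b" assume x: "x \<in> space (lborelP I)"
    have "(\<lambda>y. F0 (\<lambda>j\<in>J. L x j - y j)) \<in> borel_measurable (lborelP J)"
      using measurable_compose[OF measurable_Pair1'[OF x] m1] by (simp only: fst_conv snd_conv)
    then show "F (L x) * (\<integral>\<^sup>+y. F0 (\<lambda>j\<in>J. L x j - y j) \<partial>lborelP J) =
        (\<integral>\<^sup>+y. F (L x) * F0 (\<lambda>j\<in>J. L x j - y j) \<partial>lborelP J)"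
      by (rule nn_integral_cmult[symmetric])
  qed
  also have "\<dots> = (\<integral>\<^sup>+y. \<integral>\<^sup>+x. F (L x) * F0 (\<lambda>j\<in>J. L x j - y j) \<partial>lborelP I \<partial>lborelP J)"
    using fin m1 by (intro nn_integral_swap sigma_finite_lborelP borel_measurable_times_ennreal)
     (simp_all add: split_beta' measurable_compose[OF measurable_fst])
  \<comment> \<open>The inner integral is translated by a \<open>\<mu>\<close> that changes
    \<open>L x\<close> into \<open>y + L x\<close>; this moves \<open>y\<close> from the argument of
    \<open>F0\<close> to that of \<open>F\<close>.\<close>
  also have "\<dots> = (\<integral>\<^sup>+y. \<integral>\<^sup>+x. F (\<lambda>j\<in>J. y j + L x j) * F0 (L x) \<partial>lborelP I \<partial>lborelP J)"
  proof (rule nn_integral_cong)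
    fix y :: "'j \<Rightarrow> 'a" assume y: "y \<in> space (lborelP J)"
    obtain \<mu> where \<mu>: "\<And>x. x \<in> space (lborelP I) \<Longrightarrow> L (\<lambda>i\<in>I. \<mu> i + x i) = (\<lambda>j\<in>J. y j + L x j)"
      using trans[OF y] by blast
    have "(\<lambda>x. F0 (\<lambda>j\<in>J. L x j - y j)) \<in> borel_measurable (lborelP I)"
      using measurable_compose[OF measurable_Pair2'[OF y] m1] by (simp only: fst_conv snd_conv)
    then have "(\<integral>\<^sup>+x. F (L x) * F0 (\<lambda>j\<in>J. L x j - y j) \<partial>lborelP I) =
      (\<integral>\<^sup>+x. F (L (\<lambda>i\<in>I. \<mu> i + x i)) * F0 (\<lambda>j\<in>J. L (\<lambda>i\<in>I. \<mu> i + x i) j - y j) \<partial>lborelP I)"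
      using nn_integral_lborelP_affine[OF fin(1), of "\<lambda>x. F (L x) * F0 (\<lambda>j\<in>J. L x j - y j)" 1 \<mu>] by simp
    also have "\<dots> = (\<integral>\<^sup>+x. F (\<lambda>j\<in>J. y j + L x j) * F0 (L x) \<partial>lborelP I)"
    proof (intro nn_integral_cong)
      fix x :: "'i \<Rightarrow> 'b" assume x: "x \<in> space (lborelP I)"
      have "(\<lambda>j\<in>J. (\<lambda>j\<in>J. y j + L x j) j - y j) = L x"
        using Lsp[OF x] by (auto simp: space_PiM fun_eq_iff PiE_def extensional_def)
      then show "F (L (\<lambda>i\<in>I. \<mu> i + x i)) * F0 (\<lambda>j\<in>J. L (\<lambda>i\<in>I. \<mu> i + x i) j - y j) =
          F (\<lambda>j\<in>J. y j + L x j) * F0 (L x)"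
        by (simp only: \<mu>[OF x])
    qed
    finally show "(\<integral>\<^sup>+x. F (L x) * F0 (\<lambda>j\<in>J. L x j - y j) \<partial>lborelP I) =
        (\<integral>\<^sup>+x. F (\<lambda>j\<in>J. y j + L x j) * F0 (L x) \<partial>lborelP I)" .
  qed
  also have "\<dots> = (\<integral>\<^sup>+x. \<integral>\<^sup>+y. F (\<lambda>j\<in>J. y j + L x j) * F0 (L x) \<partial>lborelP J \<partial>lborelP I)"
    using fin m2 by (intro nn_integral_swap[symmetric]) (auto simp: split_beta')
  also have "\<dots> = (\<integral>\<^sup>+x. (\<integral>\<^sup>+y. F (\<lambda>j\<in>J. y j + L x j) \<partial>lborelP J) * F0 (L x) \<partial>lborelP I)"
  proof (intro nn_integral_cong)
    fix x :: "'i \<Rightarrow> 'b" assume x: "x \<in> space (lborelP I)"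
    have "(\<lambda>y. F (\<lambda>j\<in>J. y j + L x j)) \<in> borel_measurable (lborelP J)"
      using measurable_compose[OF measurable_Pair1'[OF x] m2] by (simp only: fst_conv snd_conv)
    then show "(\<integral>\<^sup>+y. F (\<lambda>j\<in>J. y j + L x j) * F0 (L x) \<partial>lborelP J) =
        (\<integral>\<^sup>+y. F (\<lambda>j\<in>J. y j + L x j) \<partial>lborelP J) * F0 (L x)"
      by (rule nn_integral_multc)
  qed
  also have "\<dots> = (\<integral>\<^sup>+x. F0 (L x) \<partial>lborelP I) * (\<integral>\<^sup>+y. F y \<partial>lborelP J)"
    unfolding aff2 by (subst nn_integral_cmult) (auto simp: mult.commute)
  finally show ?thesis .
qed

lemma nn_integral_lborelP_unit_cube:
  assumes "finite I"
  shows "(\<integral>\<^sup>+x. (\<Prod>i\<in>I. indicator (cbox 0 One) (x i)) \<partial>(lborelP I :: ('i \<Rightarrow> 'a::euclidean_space) measure)) = 1"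
  using assms by (subst lborel_prod.product_nn_integral_prod) (auto simp: emeasure_lborel_cbox_eq)

text \<open>The map is linear and, because \<open>a\<close> and \<open>b\<close> pair to 2, an
  involution. Uniqueness of Haar measure gives a factor c, and applying the map twice gives c * c =
  1. This replaces the computation of a determinant.\<close>

lemma nn_integral_lborelP_reflection:
  fixes F :: "('i \<Rightarrow> 'a::euclidean_space) \<Rightarrow> ennreal"
  assumes fin: "finite I" and F: "F \<in> borel_measurable (lborelP I)"
    and ab: "(\<Sum>i\<in>I. a i * b i) = 2"
  shows "(\<integral>\<^sup>+x. F (\<lambda>i\<in>I. x i - a i *\<^sub>R (\<Sum>j\<in>I. b j *\<^sub>R x j)) \<partial>lborelP I) = (\<integral>\<^sup>+x. F x \<partial>lborelP I)"
proof -
  define T where "T = (\<lambda>x :: 'i \<Rightarrow> 'a. \<lambda>i\<in>I. x i - a i *\<^sub>R (\<Sum>j\<in>I. b j *\<^sub>R x j))"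
  define F0 :: "('i \<Rightarrow> 'a) \<Rightarrow> ennreal" where "F0 = (\<lambda>x. \<Prod>i\<in>I. indicator (cbox 0 One) (x i))"
  have F0: "(\<integral>\<^sup>+x. F0 x \<partial>lborelP I) = 1"
    unfolding F0_def by (rule nn_integral_lborelP_unit_cube[OF fin])
  have [measurable]: "F0 \<in> borel_measurable (lborelP I)" unfolding F0_def by measurable
  have T [measurable]: "T \<in> lborelP I \<rightarrow>\<^sub>M lborelP I" unfolding T_def by measurable
  have Tadd: "T (\<lambda>i\<in>I. y i + x i) = (\<lambda>i\<in>I. T y i + T x i)" for x y
    unfolding T_def by (auto simp: fun_eq_iff sum.distrib scaleR_add_right algebra_simps)
  have TT: "T (T x) = x" if "x \<in> space (lborelP I)" for x
  proof -
    have "(\<Sum>j\<in>I. b j *\<^sub>R T x j) = (\<Sum>j\<in>I. b j *\<^sub>R x j) - (\<Sum>j\<in>I. a j * b j) *\<^sub>R (\<Sum>j\<in>I. b j *\<^sub>R x j)"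
      unfolding T_def by (simp add: scaleR_diff_right sum_subtractf scaleR_sum_left mult.commute)
    also have "\<dots> = - (\<Sum>j\<in>I. b j *\<^sub>R x j)" unfolding ab by (simp add: scaleR_2)
    finally have *: "(\<Sum>j\<in>I. b j *\<^sub>R T x j) = - (\<Sum>j\<in>I. b j *\<^sub>R x j)" .
    have "T (T x) = (\<lambda>i\<in>I. T x i - a i *\<^sub>R (\<Sum>j\<in>I. b j *\<^sub>R T x j))" by (subst T_def) simp
    also have "\<dots> = (\<lambda>i\<in>I. x i)" unfolding * by (auto simp: fun_eq_iff T_def)
    finally show ?thesis using that by (auto simp: space_PiM fun_eq_iff PiE_def extensional_def)
  qed
  have trans: "\<exists>\<mu>. \<forall>x\<in>space (lborelP I). T (\<lambda>i\<in>I. \<mu> i + x i) = (\<lambda>j\<in>I. y j + T x j)"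
    if "y \<in> space (lborelP I)" for y
    using that by (intro exI[of _ "T y"]) (simp add: Tadd TT)
  have haar: "(\<integral>\<^sup>+x. G (T x) \<partial>lborelP I) = (\<integral>\<^sup>+x. F0 (T x) \<partial>lborelP I) * (\<integral>\<^sup>+y. G y \<partial>lborelP I)"
    if "G \<in> borel_measurable (lborelP I)" for G
    using haar_PiM[OF fin fin T trans that, of F0] F0 by simp
  define c where "c = (\<integral>\<^sup>+x. F0 (T x) \<partial>lborelP I)"
  have "(\<integral>\<^sup>+x. F0 (T (T x)) \<partial>lborelP I) = c * c"
    using haar[of "\<lambda>x. F0 (T x)"] unfolding c_def by simp
  moreover have "(\<integral>\<^sup>+x. F0 (T (T x)) \<partial>lborelP I) = 1"
    unfolding F0[symmetric] by (intro nn_integral_cong) (simp add: TT)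
  ultimately have cc: "c * c = 1" by simp
  have "c \<noteq> top" using cc by (auto simp: ennreal_mult_top)
  then obtain r where r: "c = ennreal r" "r \<ge> 0" by (cases c) auto
  then have "ennreal (r * r) = 1" using cc by (simp add: ennreal_mult)
  then have "r * r = 1" by (simp add: ennreal_eq_1)
  then have "r = 1" using r(2) by (metis abs_of_nonneg abs_mult_self_eq abs_one power2_eq_1_iff power2_eq_square abs_eq_iff)
  then have "c = 1" using r by simp
  then show ?thesis using haar[OF F] by (simp add: c_def T_def)
qed

section \<open>Bessel-type integrals\<close>

lemma nn_integral_lborel_scale:
  fixes F :: "real \<Rightarrow> ennreal"
  assumes "F \<in> borel_measurable borel" "s > 0"
  shows "(\<integral>\<^sup>+x. F x \<partial>lborel) = ennreal s * (\<integral>\<^sup>+x. F (s * x) \<partial>lborel)"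
  using nn_integral_lborel_affine[OF assms(1), of s 0] assms(2) by simp

lemma nn_integral_lborel_shift:
  fixes F :: "real \<Rightarrow> ennreal"
  assumes "F \<in> borel_measurable borel"
  shows "(\<integral>\<^sup>+x. F x \<partial>lborel) = (\<integral>\<^sup>+x. F (t + x) \<partial>lborel)"
  using nn_integral_lborel_affine[OF assms, of 1 t] by simp

lemma nn_integral_Gamma:
  assumes "s > 0" "c > 0"
  shows "(\<integral>\<^sup>+t. ennreal (t powr (s - 1) * exp (- c * t)) * indicator {0<..} t \<partial>lborel) = ennreal (Gamma s * c powr (- s))"
proof -
  define I where "I = (\<integral>\<^sup>+t. ennreal (t powr (s - 1) * exp (- c * t)) * indicator {0<..} t \<partial>lborel)"
  have "ennreal (Gamma s) = (\<integral>\<^sup>+t. ennreal (t powr (s - 1) * exp (- t)) * indicator {0<..} t \<partial>lborel)"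
    unfolding Gamma_conv_nn_integral_real[OF assms(1)]
    by (intro nn_integral_cong) (auto simp: indicator_def exp_minus field_simps)
  also have "\<dots> = ennreal c * (\<integral>\<^sup>+t. ennreal ((c * t) powr (s - 1) * exp (- (c * t))) * indicator {0<..} (c * t) \<partial>lborel)"
    using assms by (intro nn_integral_lborel_scale) auto
  also have "(\<integral>\<^sup>+t. ennreal ((c * t) powr (s - 1) * exp (- (c * t))) * indicator {0<..} (c * t) \<partial>lborel) =
      (\<integral>\<^sup>+t. ennreal (c powr (s - 1)) * (ennreal (t powr (s - 1) * exp (- c * t)) * indicator {0<..} t) \<partial>lborel)"
    using assms by (intro nn_integral_cong)
      (auto simp: indicator_def powr_mult ennreal_mult'[symmetric] mult.assoc zero_less_mult_iff)
  also have "\<dots> = ennreal (c powr (s - 1)) * I"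
    unfolding I_def by (rule nn_integral_cmult) auto
  finally have "ennreal (Gamma s) = ennreal (c powr s) * I"
    using assms by (simp add: mult.assoc[symmetric] ennreal_mult'[symmetric] powr_diff)
  then have "ennreal (c powr (-s)) * ennreal (Gamma s) = ennreal (c powr (-s) * c powr s) * I"
    using assms by (simp add: mult.assoc[symmetric] ennreal_mult'[symmetric])
  then show ?thesis using assms by (simp add: I_def ennreal_mult'[symmetric] powr_add[symmetric] mult.commute)
qed

lemma nn_integral_power_exp:
  assumes "c > 0"
  shows "(\<integral>\<^sup>+t. ennreal (t ^ n * exp (- c * t)) * indicator {0<..} t \<partial>lborel) = ennreal (fact n / c ^ Suc n)"
proof -
  have "(\<integral>\<^sup>+t. ennreal (t ^ n * exp (- c * t)) * indicator {0<..} t \<partial>lborel) =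
    (\<integral>\<^sup>+t. ennreal (t powr (real (Suc n) - 1) * exp (- c * t)) * indicator {0<..} t \<partial>lborel)"
    by (intro nn_integral_cong) (auto simp: indicator_def powr_realpow)
  also have "\<dots> = ennreal (fact n / c ^ Suc n)"
  proof -
    have "Gamma (real (Suc n)) = fact n" using Gamma_fact[of n, where 'a=real] by (simp add: add.commute)
    moreover have "c powr (- real (Suc n)) = 1 / c ^ Suc n"
      using assms by (simp add: powr_minus powr_realpow divide_inverse del: of_nat_Suc power_Suc)
    ultimately show ?thesis using assms by (subst nn_integral_Gamma) simp_all
  qed
  finally show ?thesis .
qed

lemma nn_integral_gaussian:
  fixes c t :: real
  assumes "c > 0"
  shows "(\<integral>\<^sup>+y. ennreal (exp (- c * (t + y)\<^sup>2)) \<partial>lborel) = ennreal (sqrt (pi / c))"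
proof -
  have pr: "prob_space (density lborel (normal_density (-t) (1 / sqrt (2 * c))))"
    using assms by (intro prob_space_normal_density) auto
  have "1 = emeasure (density lborel (normal_density (-t) (1 / sqrt (2 * c)))) UNIV"
    using prob_space.emeasure_space_1[OF pr] by simp
  also have "\<dots> = (\<integral>\<^sup>+y. ennreal (normal_density (-t) (1 / sqrt (2 * c)) y) \<partial>lborel)"
    by (subst emeasure_density) auto
  also have "\<dots> = (\<integral>\<^sup>+y. ennreal (1 / sqrt (pi / c)) * ennreal (exp (- c * (t + y)\<^sup>2)) \<partial>lborel)"
    using assms by (intro nn_integral_cong)
      (simp add: normal_density_def ennreal_mult'[symmetric] power_divide add.commute field_simps)
  also have "\<dots> = ennreal (1 / sqrt (pi / c)) * (\<integral>\<^sup>+y. ennreal (exp (- c * (t + y)\<^sup>2)) \<partial>lborel)"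
    by (rule nn_integral_cmult) auto
  finally have "ennreal (sqrt (pi/c)) * 1 = ennreal (sqrt (pi/c)) * (ennreal (1 / sqrt (pi / c)) * (\<integral>\<^sup>+y. ennreal (exp (- c * (t + y)\<^sup>2)) \<partial>lborel))"
    by simp
  then show ?thesis using assms by (simp add: mult.assoc[symmetric] ennreal_mult'[symmetric])
qed

lemma nn_integral_gaussian_convolution:
  fixes a b x :: real
  assumes "a > 0" "b > 0"
  shows "(\<integral>\<^sup>+y. ennreal (exp (- (x + y)\<^sup>2 / a - y\<^sup>2 / b)) \<partial>lborel) =
    ennreal (sqrt pi * sqrt (a * b / (a + b)) * exp (- x\<^sup>2 / (a + b)))"
proof -
  \<comment> \<open>Completing the square in \<open>y\<close>.\<close>
  have *: "- (x + y)\<^sup>2 / a - y\<^sup>2 / b = - x\<^sup>2 / (a + b) + - ((a + b) / (a * b)) * (x * b / (a + b) + y)\<^sup>2" for y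
  proof -
    have "a + b \<noteq> 0" using assms by linarith
    then show ?thesis using assms
      by (simp add: divide_simps power2_eq_square) (simp add: algebra_simps)
  qed
  have "(\<integral>\<^sup>+y. ennreal (exp (- (x + y)\<^sup>2 / a - y\<^sup>2 / b)) \<partial>lborel) =
    (\<integral>\<^sup>+y. ennreal (exp (- x\<^sup>2 / (a + b))) * ennreal (exp (- ((a + b) / (a * b)) * (x * b / (a + b) + y)\<^sup>2)) \<partial>lborel)"
    unfolding * exp_add by (simp add: ennreal_mult')
  also have "\<dots> = ennreal (exp (- x\<^sup>2 / (a + b))) * ennreal (sqrt (pi / ((a + b) / (a * b))))"
    unfolding nn_integral_gaussian[OF divide_pos_pos[OF add_pos_pos[OF assms] mult_pos_pos[OF assms]], of "x * b / (a + b)", symmetric]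
    by (rule nn_integral_cmult) simp
  also have "\<dots> = ennreal (sqrt pi * sqrt (a * b / (a + b)) * exp (- x\<^sup>2 / (a + b)))"
    by (simp add: ennreal_mult'[symmetric] real_sqrt_mult real_sqrt_divide mult_ac)
  finally show ?thesis .
qed

lemma nn_integral_FTC_einterval:
  fixes f F :: "real \<Rightarrow> real" and a b :: ereal
  assumes "a < b"
    and "\<And>x. a < ereal x \<Longrightarrow> ereal x < b \<Longrightarrow> (F has_real_derivative f x) (at x)"
    and "\<And>x. a < ereal x \<Longrightarrow> ereal x < b \<Longrightarrow> isCont f x"
    and nonneg: "\<And>x. a < ereal x \<Longrightarrow> ereal x < b \<Longrightarrow> 0 \<le> f x"
    and "((F \<circ> real_of_ereal) \<longlongrightarrow> A) (at_right a)" "((F \<circ> real_of_ereal) \<longlongrightarrow> B) (at_left b)"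
  shows "(\<integral>\<^sup>+x. ennreal (f x) * indicator (einterval a b) x \<partial>lborel) = ennreal (B - A)"
proof -
  have AE: "AE x in lborel. a < ereal x \<longrightarrow> ereal x < b \<longrightarrow> 0 \<le> f x" using nonneg by simp
  note FTC = interval_integral_FTC_nonneg[OF assms(1,2,3) AE assms(5,6)]
  have int: "integrable lborel (\<lambda>x. indicator (einterval a b) x *\<^sub>R f x)"
    using FTC(1) by (simp add: set_integrable_def)
  have "(\<integral>\<^sup>+x. ennreal (f x) * indicator (einterval a b) x \<partial>lborel) =
      (\<integral>\<^sup>+x. ennreal (indicator (einterval a b) x *\<^sub>R f x) \<partial>lborel)"
    by (intro nn_integral_cong) (auto simp: indicator_def)
  also have "\<dots> = ennreal (\<integral>x. indicator (einterval a b) x *\<^sub>R f x \<partial>lborel)"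
    using int nonneg by (intro nn_integral_eq_integral) (auto simp: indicator_def einterval_def)
  also have "(\<integral>x. indicator (einterval a b) x *\<^sub>R f x \<partial>lborel) = B - A"
    using FTC(2) \<open>a < b\<close> by (simp add: interval_lebesgue_integral_def set_lebesgue_integral_def less_imp_le)
  finally show ?thesis .
qed

lemma nn_integral_FTC_Ioi:
  fixes f F :: "real \<Rightarrow> real"
  assumes "\<And>x. 0 < x \<Longrightarrow> (F has_real_derivative f x) (at x)"
    and "\<And>x. 0 < x \<Longrightarrow> isCont f x" "\<And>x. 0 < x \<Longrightarrow> 0 \<le> f x"
    and "(F \<longlongrightarrow> A) (at_right 0)" "(F \<longlongrightarrow> B) at_top"
  shows "(\<integral>\<^sup>+x. ennreal (f x) * indicator {0<..} x \<partial>lborel) = ennreal (B - A)"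
proof -
  have "einterval 0 \<infinity> = {0<..}" by (auto simp: einterval_def)
  then show ?thesis
    using nn_integral_FTC_einterval[of 0 \<infinity> F f A B] assms
    by (simp add: ereal_tendsto_simps zero_ereal_def)
qed

lemma nn_integral_FTC_Ioo:
  fixes f F :: "real \<Rightarrow> real"
  assumes "0 < b" "\<And>x. 0 < x \<Longrightarrow> (F has_real_derivative f x) (at x)"
    and "\<And>x. 0 < x \<Longrightarrow> isCont f x" "\<And>x. 0 < x \<Longrightarrow> 0 \<le> f x"
    and "(F \<longlongrightarrow> A) (at_right 0)"
  shows "(\<integral>\<^sup>+x. ennreal (f x) * indicator {0<..<b} x \<partial>lborel) = ennreal (F b - A)"
proof -
  have "einterval 0 (ereal b) = {0<..<b}" by (auto simp: einterval_def)
  moreover have "(F \<longlongrightarrow> F b) (at_left b)"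
    using DERIV_isCont[OF assms(2)[OF assms(1)]] by (auto simp: isCont_def filterlim_at_split)
  ultimately show ?thesis
    using nn_integral_FTC_einterval[of 0 "ereal b" F f A "F b"] assms
    by (simp add: ereal_tendsto_simps zero_ereal_def)
qed

text \<open>The antiderivatives of the Bessel integrands of orders \<open>\<plusminus>1/2\<close> are combinations of
  \<open>E(\<surd>m - x/\<surd>m)\<close> and \<open>E(\<surd>m + x/\<surd>m)\<close>.\<close>

lemma gaussian_antiderivative:
  obtains E :: "real \<Rightarrow> real" where "\<And>y. (E has_real_derivative exp (- y\<^sup>2)) (at y)"
    "(E \<longlongrightarrow> 0) at_bot" "(E \<longlongrightarrow> sqrt pi) at_top"
proof -
  define M where "M = density lborel (normal_density 0 (1 / sqrt 2))"
  have "real_distribution M"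
    unfolding M_def real_distribution_def real_distribution_axioms_def by (auto intro!: prob_space_normal_density)
  then interpret M: real_distribution M .
  have nd: "normal_density 0 (1 / sqrt 2) x = exp (- x\<^sup>2) / sqrt pi" for x
    by (simp add: normal_density_def power_divide)
  \<comment> \<open>The distribution function supplies the limits at both ends, the antiderivative
    \<open>F\<close> obtained next supplies the derivative; \<open>diff\<close> shows that the two
    differ by a constant.\<close>
  define E where "E = (\<lambda>y. sqrt pi * cdf M y)"
  obtain F where F: "(F has_real_derivative exp (- y\<^sup>2)) (at y)" for y :: real
    using einterval_antiderivative[of "-\<infinity>" "\<infinity>" "\<lambda>y. exp (- y\<^sup>2)"]
    by (auto simp: has_real_derivative_iff_has_vector_derivative intro!: continuous_intros)
  have diff: "E b - E a = F b - F a" if "a \<le> b" for a b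
  proof -
    have "cdf M b - cdf M a = measure M {a<..b}"
      using that M.cdf_diff_eq[of a b] by (cases "a = b") auto
    also have "\<dots> = (F b - F a) / sqrt pi"
    proof -
      have "emeasure M {a<..b} = (\<integral>\<^sup>+x. ennreal (exp (- x\<^sup>2) / sqrt pi) * indicator {a..b} x \<partial>lborel)"
        unfolding M_def nd
        by (subst emeasure_density, simp, simp, intro nn_integral_cong_AE eventually_mono[OF AE_lborel_singleton[of a]])
           (auto simp: indicator_def nd)
      also have "\<dots> = ennreal (F b / sqrt pi - F a / sqrt pi)"
        by (intro nn_integral_FTC_Icc DERIV_cdivide[OF F]) (auto simp: that)
      finally show ?thesis
        using DERIV_nonneg_imp_nondecreasing[OF that, of F] F
        by (force simp: measure_def diff_divide_distrib divide_right_mono)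
    qed
    finally show ?thesis unfolding E_def by (simp add: field_simps)
  qed
  have "E y = F y + (E 0 - F 0)" for y
    using diff[of 0 y] diff[of y 0] by (cases "y \<ge> 0") auto
  then have E: "E = (\<lambda>y. F y + (E 0 - F 0))" by blast
  have "(E has_real_derivative exp (- y\<^sup>2)) (at y)" for y
    by (subst E) (auto intro!: derivative_eq_intros F)
  moreover have "(E \<longlongrightarrow> 0) at_bot"
    unfolding E_def using tendsto_mult_left[OF M.cdf_lim_at_bot, of "sqrt pi"] by simp
  moreover have "(E \<longlongrightarrow> sqrt pi) at_top"
    unfolding E_def using tendsto_mult_left[OF M.cdf_lim_at_top_prob, of "sqrt pi"] by simp
  ultimately show thesis using that by blast
qed

text \<open>In terms of the modified Bessel function this is \<open>2 \<bar>x\<bar>\<^sup>\<nu> K\<^sub>\<nu>(2 \<bar>x\<bar>)\<close> with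
  \<open>\<nu> = s - 1/2\<close>.\<close>

definition bessel :: "real \<Rightarrow> real \<Rightarrow> ennreal" where
  "bessel s x = (\<integral>\<^sup>+m. ennreal (m powr (s - 3/2) * exp (- m - x\<^sup>2 / m)) * indicator {0<..} m \<partial>lborel)"

lemma bessel_minus [simp]: "bessel s (- x) = bessel s x"
  by (simp add: bessel_def)

lemma bessel_at_0: "s > 1/2 \<Longrightarrow> bessel s 0 = ennreal (Gamma (s - 1/2))"
  using nn_integral_Gamma[of "s - 1/2" 1] by (simp add: bessel_def)

text \<open>The orders are 1/2 and -1/2, and K is even in its order, so both right-hand sides agree.
  The second equation carries the factor \<open>x\<close> because \<open>bessel 0\<close> is
  infinite at 0; the recurrence only ever uses it multiplied by x^2.\<close>

lemma bessel_0_1: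
  assumes "x > 0"
  shows "bessel 1 x = ennreal (sqrt pi * exp (- 2 * x))" "ennreal x * bessel 0 x = ennreal (sqrt pi * exp (- 2 * x))"
proof -
  obtain E :: "real \<Rightarrow> real" where E: "\<And>y. (E has_real_derivative exp (- y\<^sup>2)) (at y)"
    and E0: "(E \<longlongrightarrow> 0) at_bot" and E1: "(E \<longlongrightarrow> sqrt pi) at_top"
    using gaussian_antiderivative by metis
  define D where "D = (\<lambda>m. exp (- m - x\<^sup>2 / m))"
  \<comment> \<open>The squares of sqrt m -/+ x / sqrt m are m + x^2/m -/+ 2x, so both derivatives
    are multiples of \<open>D m\<close>. With weights exp (-2x) and exp (2x) the exponential
    constants disappear; the sum of the two keeps the term in 1 / sqrt m, the difference the one in
    1 / (m sqrt m).\<close>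
  have d1: "((\<lambda>m. E (sqrt m - x / sqrt m)) has_real_derivative exp (2 * x) * D m * (1 / (2 * sqrt m) + x / (2 * m * sqrt m))) (at m)"
    and d2: "((\<lambda>m. E (sqrt m + x / sqrt m)) has_real_derivative exp (- 2 * x) * D m * (1 / (2 * sqrt m) - x / (2 * m * sqrt m))) (at m)"
    if m: "m > 0" for m
  proof -
    have s: "sqrt m * sqrt m = m" "sqrt m \<noteq> 0" "m \<noteq> 0" using m by auto
    have e1: "exp (- (sqrt m - x / sqrt m)\<^sup>2) = exp (2 * x) * D m"
      unfolding D_def exp_add[symmetric] using m by (simp add: power2_diff power_divide)
    have e2: "exp (- (sqrt m + x / sqrt m)\<^sup>2) = exp (- 2 * x) * D m"
      unfolding D_def exp_add[symmetric] using m by (simp add: power2_sum power_divide)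
    show "((\<lambda>m. E (sqrt m - x / sqrt m)) has_real_derivative exp (2 * x) * D m * (1 / (2 * sqrt m) + x / (2 * m * sqrt m))) (at m)"
      unfolding e1[symmetric] using m s
      by (intro DERIV_chain2[OF E]) (auto intro!: derivative_eq_intros simp: field_simps)
    show "((\<lambda>m. E (sqrt m + x / sqrt m)) has_real_derivative exp (- 2 * x) * D m * (1 / (2 * sqrt m) - x / (2 * m * sqrt m))) (at m)"
      unfolding e2[symmetric] using m s
      by (intro DERIV_chain2[OF E]) (auto intro!: derivative_eq_intros simp: field_simps)
  qed
  have l1: "((\<lambda>m. E (sqrt m - x / sqrt m)) \<longlongrightarrow> sqrt pi) at_top"
    by (rule filterlim_compose[OF E1]) (use assms in real_asymp)
  have l2: "((\<lambda>m. E (sqrt m + x / sqrt m)) \<longlongrightarrow> sqrt pi) at_top"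
    by (rule filterlim_compose[OF E1]) (use assms in real_asymp)
  have l3: "((\<lambda>m. E (sqrt m - x / sqrt m)) \<longlongrightarrow> 0) (at_right 0)"
    by (rule filterlim_compose[OF E0]) (use assms in real_asymp)
  have l4: "((\<lambda>m. E (sqrt m + x / sqrt m)) \<longlongrightarrow> sqrt pi) (at_right 0)"
    by (rule filterlim_compose[OF E1]) (use assms in real_asymp)
  have p1: "m powr (- (1/2)) = 1 / sqrt m" if "m > 0" for m :: real
    using powr_minus_divide[of m "1/2"] powr_half_sqrt[of m] that by simp
  have p3: "m powr (- (3/2)) = 1 / (m * sqrt m)" if "m > 0" for m :: real
    using powr_add[of m "-1" "- (1/2)"] powr_minus_divide[of m 1] p1[OF that] that by simp
  have ee: "exp (- (2 * x)) * exp (2 * x) = 1" by (simp flip: exp_add)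
  have "bessel 1 x = (\<integral>\<^sup>+m. ennreal (1 / sqrt m * D m) * indicator {0<..} m \<partial>lborel)"
    unfolding bessel_def by (intro nn_integral_cong) (auto simp: indicator_def D_def p1)
  also have "\<dots> = ennreal ((exp (- 2 * x) * sqrt pi + exp (2 * x) * sqrt pi) - (exp (- 2 * x) * 0 + exp (2 * x) * sqrt pi))"
  proof (rule nn_integral_FTC_Ioi)
    show "((\<lambda>m. exp (- 2 * x) * E (sqrt m - x / sqrt m) + exp (2 * x) * E (sqrt m + x / sqrt m)) has_real_derivative
        1 / sqrt m * D m) (at m)" if "m > 0" for m
      using DERIV_add[OF DERIV_cmult[OF d1[OF that], of "exp (-2 * x)"] DERIV_cmult[OF d2[OF that], of "exp (2 * x)"]]
      by (rule DERIV_cong) (use ee in \<open>simp add: algebra_simps\<close>)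
    show "isCont (\<lambda>m. 1 / sqrt m * D m) m" if "m > 0" for m
      unfolding D_def using that by (auto intro!: continuous_intros)
  qed (intro tendsto_intros l1 l2 l3 l4 | simp add: D_def)+
  also have "\<dots> = ennreal (sqrt pi * exp (- 2 * x))" by (simp add: mult.commute)
  finally show "bessel 1 x = ennreal (sqrt pi * exp (- 2 * x))" .
  have "ennreal x * bessel 0 x = (\<integral>\<^sup>+m. ennreal (x / (m * sqrt m) * D m) * indicator {0<..} m \<partial>lborel)"
  proof -
    have "ennreal x * bessel 0 x = (\<integral>\<^sup>+m. ennreal x * (ennreal (m powr (0 - 3/2) * exp (- m - x\<^sup>2 / m)) * indicator {0<..} m) \<partial>lborel)"
      unfolding bessel_def by (rule nn_integral_cmult[symmetric]) simp
    also have "\<dots> = (\<integral>\<^sup>+m. ennreal (x / (m * sqrt m) * D m) * indicator {0<..} m \<partial>lborel)"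
    proof (rule nn_integral_cong)
      fix m :: real
      show "ennreal x * (ennreal (m powr (0 - 3/2) * exp (- m - x\<^sup>2 / m)) * indicator {0<..} m) =
          ennreal (x / (m * sqrt m) * D m) * indicator {0<..} m"
        using assms p3[of m] by (cases "m > 0") (simp_all add: D_def ennreal_mult'[symmetric])
    qed
    finally show ?thesis .
  qed
  also have "\<dots> = ennreal ((exp (- 2 * x) * sqrt pi - exp (2 * x) * sqrt pi) - (exp (- 2 * x) * 0 - exp (2 * x) * sqrt pi))"
  proof (rule nn_integral_FTC_Ioi)
    show "((\<lambda>m. exp (- 2 * x) * E (sqrt m - x / sqrt m) - exp (2 * x) * E (sqrt m + x / sqrt m)) has_real_derivative
        x / (m * sqrt m) * D m) (at m)" if "m > 0" for m
      using DERIV_diff[OF DERIV_cmult[OF d1[OF that], of "exp (-2 * x)"] DERIV_cmult[OF d2[OF that], of "exp (2 * x)"]]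
      by (rule DERIV_cong) (use ee in \<open>simp add: algebra_simps\<close>)
    show "isCont (\<lambda>m. x / (m * sqrt m) * D m) m" if "m > 0" for m
      unfolding D_def using that by (auto intro!: continuous_intros)
  qed (intro tendsto_intros l1 l2 l3 l4 | use assms in \<open>simp add: D_def\<close>)+
  also have "\<dots> = ennreal (sqrt pi * exp (- 2 * x))" by (simp add: mult.commute)
  finally show "ennreal x * bessel 0 x = ennreal (sqrt pi * exp (- 2 * x))" .
qed

text \<open>Integration by parts, carried out with nonnegative integrals: \<open>F\<close> is
  written as the integral of its derivative \<open>f\<close> from 0, and exchanging the integrals
  moves the integration onto exp (-m), whose tail integral is again exponential. The bound on
  \<open>j\<close> makes \<open>f\<close> nonnegative.\<close>

lemma bessel_recurrence:
  assumes "j \<ge> 1" "x \<ge> 0"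
  shows "bessel (j + 1) x = ennreal (j - 1/2) * bessel j x + ennreal (x\<^sup>2) * bessel (j - 1) x"
proof (cases "x = 0")
  case True
  then show ?thesis using assms Gamma_plus1[of "j - 1/2"]
    by (auto simp: bessel_at_0 ennreal_mult'[symmetric] algebra_simps nonpos_Ints_def)
next
  case False
  then have x: "x > 0" using assms by simp
  define f where "f = (\<lambda>t. ((j - 1/2) * t powr (j - 3/2) + x\<^sup>2 * t powr (j - 5/2)) * exp (- x\<^sup>2 / t))"
  define F where "F = (\<lambda>t. t powr (j - 1/2) * exp (- x\<^sup>2 / t))"
  have ee: "exp (- m - x\<^sup>2 / m) = exp (- m) * exp (- x\<^sup>2 / m)" for m
    by (simp flip: exp_add)
  have f0: "f t \<ge> 0" if "t > 0" for t unfolding f_def using assms by (auto intro!: mult_nonneg_nonneg add_nonneg_nonneg)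
  have [measurable]: "f \<in> borel_measurable borel" unfolding f_def by measurable
  have Fd: "(F has_real_derivative f t) (at t)" if "t > 0" for t
  proof -
    have e: "j - 1/2 = (j - 5/2) + 2" "j - 3/2 = (j - 5/2) + 1" "j - 1/2 - 1 = j - 3/2" by simp_all
    have p: "t powr (j - 1/2) = t powr (j - 5/2) * t\<^sup>2"
      using powr_realpow[OF that, of 2] unfolding e(1) powr_add by simp
    have "((\<lambda>t. exp (- x\<^sup>2 / t)) has_real_derivative exp (- x\<^sup>2 / t) * (x\<^sup>2 / t\<^sup>2)) (at t)"
      using that by (auto intro!: derivative_eq_intros simp: power2_eq_square)
    from DERIV_mult[OF has_real_derivative_powr[OF that, of "j - 1/2"] this] show ?thesis
      unfolding F_def
    proof (rule DERIV_cong)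
      have "x\<^sup>2 / t\<^sup>2 * t powr (j - 1/2) = x\<^sup>2 * t powr (j - 5/2)" unfolding p using that by simp
      then show "(j - 1/2) * t powr (j - 1/2 - 1) * exp (- x\<^sup>2 / t) + exp (- x\<^sup>2 / t) * (x\<^sup>2 / t\<^sup>2) * t powr (j - 1/2) = f t"
        unfolding f_def e(3) by (simp only: mult.assoc) (simp only: distrib_right distrib_left mult_ac)
    qed
  qed
  have Fl: "(F \<longlongrightarrow> 0) (at_right 0)"
  proof (rule tendsto_sandwich[of "\<lambda>_. 0" _ _ "\<lambda>t. t powr (j - 1/2)"])
    define a where "a = j - 1/2"
    have "a > 0" using assms by (simp add: a_def)
    then show "((\<lambda>t. t powr (j - 1/2)) \<longlongrightarrow> 0) (at_right 0)"
      unfolding a_def[symmetric] by real_asymp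
    show "\<forall>\<^sub>F t in at_right 0. F t \<le> t powr (j - 1/2)"
      unfolding F_def eventually_at_filter by (intro always_eventually) (auto intro!: mult_left_le)
  qed (auto simp: F_def)
  have fc: "isCont f t" if "t > 0" for t
    unfolding f_def using that by (auto intro!: continuous_intros)
  have inner: "(\<integral>\<^sup>+t. ennreal (f t) * indicator {0<..<m} t \<partial>lborel) = ennreal (F m)" if "m > 0" for m
    using nn_integral_FTC_Ioo[OF that Fd fc f0 Fl] by simp
  have tail: "(\<integral>\<^sup>+m. ennreal (exp (-m)) * indicator {t..} m \<partial>lborel) = ennreal (exp (-t))" for t :: real
  proof -
    have "((\<lambda>m::real. - exp (-m)) \<longlongrightarrow> 0) at_top" by real_asymp
    moreover have "((\<lambda>m. - exp (- m)) has_real_derivative exp (- m)) (at m)" for m :: real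
      by (auto intro!: derivative_eq_intros)
    ultimately show ?thesis
      using nn_integral_FTC_atLeast[of "\<lambda>m. exp (- m)" t "\<lambda>m. - exp (- m)" 0] by simp
  qed
  have "bessel (j + 1) x = (\<integral>\<^sup>+m. ennreal (exp (- m)) * (ennreal (F m) * indicator {0<..} m) \<partial>lborel)"
    unfolding bessel_def
  proof (rule nn_integral_cong)
    fix m :: real
    have "j + 1 - 3/2 = j - 1/2" by simp
    then have "m powr (j + 1 - 3/2) * exp (- m - x\<^sup>2 / m) = exp (- m) * F m"
      unfolding F_def ee by (simp only: mult_ac)
    then show "ennreal (m powr (j + 1 - 3/2) * exp (- m - x\<^sup>2 / m)) * indicator {0<..} m =
        ennreal (exp (- m)) * (ennreal (F m) * indicator {0<..} m)"
      by (simp only: ennreal_mult' exp_ge_zero mult.assoc)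
  qed
  also have "\<dots> = (\<integral>\<^sup>+m. \<integral>\<^sup>+t. ennreal (exp (- m)) * (ennreal (f t) * indicator {0<..<m} t) \<partial>lborel \<partial>lborel)"
  proof (rule nn_integral_cong)
    fix m :: real
    have "(\<integral>\<^sup>+t. ennreal (exp (- m)) * (ennreal (f t) * indicator {0<..<m} t) \<partial>lborel) =
        ennreal (exp (- m)) * (\<integral>\<^sup>+t. ennreal (f t) * indicator {0<..<m} t \<partial>lborel)"
      by (rule nn_integral_cmult) simp
    then show "ennreal (exp (- m)) * (ennreal (F m) * indicator {0<..} m) =
        (\<integral>\<^sup>+t. ennreal (exp (- m)) * (ennreal (f t) * indicator {0<..<m} t) \<partial>lborel)"
      by (cases "m > 0") (simp_all add: inner)
  qed
  also have "\<dots> = (\<integral>\<^sup>+t. \<integral>\<^sup>+m. ennreal (exp (- m)) * (ennreal (f t) * indicator {0<..<m} t) \<partial>lborel \<partial>lborel)"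
    by (rule nn_integral_swap) (auto simp: indicator_def case_prod_unfold cong: measurable_cong_sets)
  also have "\<dots> = (\<integral>\<^sup>+t. (\<integral>\<^sup>+m. ennreal (exp (- m)) * indicator {t..} m \<partial>lborel) * (ennreal (f t) * indicator {0<..} t) \<partial>lborel)"
  proof (rule nn_integral_cong)
    fix t :: real
    have "(\<integral>\<^sup>+m. ennreal (exp (- m)) * (ennreal (f t) * indicator {0<..<m} t) \<partial>lborel) =
      (\<integral>\<^sup>+m. (ennreal (exp (- m)) * indicator {t..} m) * (ennreal (f t) * indicator {0<..} t) \<partial>lborel)"
      by (intro nn_integral_cong_AE eventually_mono[OF AE_lborel_singleton[of t]]) (auto simp: indicator_def)
    also have "\<dots> = (\<integral>\<^sup>+m. ennreal (exp (- m)) * indicator {t..} m \<partial>lborel) * (ennreal (f t) * indicator {0<..} t)"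
      by (rule nn_integral_multc) auto
    finally show "(\<integral>\<^sup>+m. ennreal (exp (- m)) * (ennreal (f t) * indicator {0<..<m} t) \<partial>lborel) = \<dots>" .
  qed
  also have "\<dots> = (\<integral>\<^sup>+t. ennreal (j - 1/2) * (ennreal (t powr (j - 3/2) * exp (- t - x\<^sup>2 / t)) * indicator {0<..} t) +
      ennreal (x\<^sup>2) * (ennreal (t powr ((j - 1) - 3/2) * exp (- t - x\<^sup>2 / t)) * indicator {0<..} t) \<partial>lborel)"
    unfolding tail
  proof (rule nn_integral_cong)
    fix t :: real
    have "j - 1 - 3/2 = j - 5/2" by simp
    then have "exp (- t) * f t = (j - 1/2) * (t powr (j - 3/2) * exp (- t - x\<^sup>2 / t)) +
        x\<^sup>2 * (t powr (j - 1 - 3/2) * exp (- t - x\<^sup>2 / t))"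
      unfolding f_def ee by (simp only: distrib_left distrib_right mult_ac)
    then have "ennreal (exp (- t)) * ennreal (f t) = ennreal (j - 1/2) * ennreal (t powr (j - 3/2) * exp (- t - x\<^sup>2 / t)) +
        ennreal (x\<^sup>2) * ennreal (t powr (j - 1 - 3/2) * exp (- t - x\<^sup>2 / t))"
      using assms by (simp add: ennreal_mult'[symmetric] ennreal_plus[symmetric] del: ennreal_plus)
    then show "ennreal (exp (- t)) * (ennreal (f t) * indicator {0<..} t) =
        ennreal (j - 1/2) * (ennreal (t powr (j - 3/2) * exp (- t - x\<^sup>2 / t)) * indicator {0<..} t) +
        ennreal (x\<^sup>2) * (ennreal (t powr (j - 1 - 3/2) * exp (- t - x\<^sup>2 / t)) * indicator {0<..} t)"
      by (simp only: mult.assoc[symmetric] distrib_right)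
  qed
  also have "\<dots> = ennreal (j - 1/2) * bessel j x + ennreal (x\<^sup>2) * bessel (j - 1) x"
    unfolding bessel_def by (simp add: nn_integral_add nn_integral_cmult)
  finally show ?thesis .
qed

section \<open>Additivity of the index under convolution\<close>

lemma bessel_measurable [measurable]: "bessel s \<in> borel_measurable borel"
  unfolding bessel_def[abs_def] by measurable

text \<open>Substitute m = a + b and then a = m u. The Beta integral in u splits off because
  \<open>\<psi>\<close> sees only the sum; its value is left open here.\<close>

lemma gamma_convolution_aux:
  fixes \<psi> :: "real \<Rightarrow> ennreal"
  assumes [measurable]: "\<psi> \<in> borel_measurable borel" and st: "s > 0" "t > 0"
  shows "(\<integral>\<^sup>+a. \<integral>\<^sup>+b. ennreal (a powr (s - 1)) * ennreal (b powr (t - 1)) * \<psi> (a + b) * indicator {0<..} a * indicator {0<..} b \<partial>lborel \<partial>lborel) =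
    (\<integral>\<^sup>+u. ennreal (u powr (s - 1) * (1 - u) powr (t - 1)) * indicator {0<..<1} u \<partial>lborel) *
    (\<integral>\<^sup>+m. ennreal (m powr (s + t - 1)) * \<psi> m * indicator {0<..} m \<partial>lborel)" (is "?L = ?B * ?R")
proof -
  let ?G = "\<lambda>a m. ennreal (a powr (s - 1)) * ennreal ((m - a) powr (t - 1)) * \<psi> m * indicator {0<..} a * indicator {0<..} (m - a)"
  have "?L = (\<integral>\<^sup>+a. \<integral>\<^sup>+m. ?G a m \<partial>lborel \<partial>lborel)"
  proof (rule nn_integral_cong)
    fix a :: real
    show "(\<integral>\<^sup>+b. ennreal (a powr (s - 1)) * ennreal (b powr (t - 1)) * \<psi> (a + b) * indicator {0<..} a * indicator {0<..} b \<partial>lborel) =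
      (\<integral>\<^sup>+m. ?G a m \<partial>lborel)"
      by (subst nn_integral_lborel_shift[where t="-a"]) (auto simp: algebra_simps)
  qed
  also have "\<dots> = (\<integral>\<^sup>+m. \<integral>\<^sup>+a. ?G a m \<partial>lborel \<partial>lborel)"
    by (rule nn_integral_swap) auto
  also have "\<dots> = (\<integral>\<^sup>+m. ?B * (ennreal (m powr (s + t - 1)) * \<psi> m * indicator {0<..} m) \<partial>lborel)"
  proof (rule nn_integral_cong)
    fix m :: real
    show "(\<integral>\<^sup>+a. ?G a m \<partial>lborel) = ?B * (ennreal (m powr (s + t - 1)) * \<psi> m * indicator {0<..} m)"
    proof (cases "m > 0")
      case False
      have "(\<integral>\<^sup>+a. ?G a m \<partial>lborel) = (\<integral>\<^sup>+(a::real). 0 \<partial>lborel)"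
        by (rule nn_integral_cong) (use False in \<open>auto simp: indicator_def\<close>)
      then show ?thesis using False by simp
    next
      case True
      have "(\<integral>\<^sup>+a. ?G a m \<partial>lborel) = ennreal m * (\<integral>\<^sup>+u. ?G (m * u) m \<partial>lborel)"
        using True by (intro nn_integral_lborel_scale) auto
      also have "(\<integral>\<^sup>+u. ?G (m * u) m \<partial>lborel) = (\<integral>\<^sup>+u. (ennreal (u powr (s - 1) * (1 - u) powr (t - 1)) * indicator {0<..<1} u) *
          (ennreal (m powr (s - 1 + (t - 1))) * \<psi> m) \<partial>lborel)"
      proof (rule nn_integral_cong)
        fix u :: real
        have i: "indicator {0<..} (m * u) * indicator {0<..} (m - m * u) = (indicator {0<..<1} u :: ennreal)"
          using True by (auto simp: indicator_def zero_less_mult_iff)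
        have "(m * u) powr (s - 1) * (m - m * u) powr (t - 1) = u powr (s - 1) * (1 - u) powr (t - 1) * m powr (s - 1 + (t - 1))"
          if "u \<in> {0<..<1}"
        proof -
          have pm: "m - m * u = m * (1 - u)" by (simp add: algebra_simps)
          show ?thesis unfolding pm powr_add using that True by (simp add: powr_mult)
        qed
        then have "ennreal ((m * u) powr (s - 1)) * ennreal ((m - m * u) powr (t - 1)) * indicator {0<..<1} u =
            ennreal (u powr (s - 1) * (1 - u) powr (t - 1)) * ennreal (m powr (s - 1 + (t - 1))) * indicator {0<..<1} u"
          by (auto simp: indicator_def ennreal_mult'[symmetric])
        then show "?G (m * u) m = (ennreal (u powr (s - 1) * (1 - u) powr (t - 1)) * indicator {0<..<1} u) *
          (ennreal (m powr (s - 1 + (t - 1))) * \<psi> m)"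
          unfolding i[symmetric] by (simp only: mult_ac)
      qed
      also have "\<dots> = ?B * (ennreal (m powr (s - 1 + (t - 1))) * \<psi> m)"
        by (rule nn_integral_multc) auto
      also have "ennreal m * \<dots> = ?B * (ennreal (m * m powr (s - 1 + (t - 1))) * \<psi> m)"
        using True by (simp add: ennreal_mult' mult_ac)
      also have "m * m powr (s - 1 + (t - 1)) = m powr (s + t - 1)"
        using True powr_mult_base[of m "s - 1 + (t - 1)"] by (simp add: algebra_simps)
      finally show ?thesis using True by simp
    qed
  qed
  also have "\<dots> = ?B * ?R" by (rule nn_integral_cmult) auto
  finally show ?thesis .
qed

text \<open>The choice of exp (-m) for \<open>\<psi>\<close> makes all other integrals Gamma
  integrals and thereby evaluates the Beta factor.\<close>

lemma gamma_convolution: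
  fixes \<psi> :: "real \<Rightarrow> ennreal"
  assumes \<psi>: "\<psi> \<in> borel_measurable borel" and st: "s > 0" "t > 0"
  shows "(\<integral>\<^sup>+a. \<integral>\<^sup>+b. ennreal (a powr (s - 1)) * ennreal (b powr (t - 1)) * \<psi> (a + b) * indicator {0<..} a * indicator {0<..} b \<partial>lborel \<partial>lborel) =
    ennreal (Gamma s * Gamma t / Gamma (s + t)) *
    (\<integral>\<^sup>+m. ennreal (m powr (s + t - 1)) * \<psi> m * indicator {0<..} m \<partial>lborel)"
proof -
  let ?g = "\<lambda>s m. ennreal (m powr (s - 1) * exp (- 1 * m)) * indicator {0<..} m"
  define B where "B = (\<integral>\<^sup>+u. ennreal (u powr (s - 1) * (1 - u) powr (t - 1)) * indicator {0<..<1::real} u \<partial>lborel)"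
  have g: "(\<integral>\<^sup>+m. ?g r m \<partial>lborel) = ennreal (Gamma r)" if "r > 0" for r
    using nn_integral_Gamma[OF that, of 1] by simp
  have "ennreal (Gamma s) * ennreal (Gamma t) = (\<integral>\<^sup>+a. ?g s a * (\<integral>\<^sup>+b. ?g t b \<partial>lborel) \<partial>lborel)"
    unfolding g[OF st(1), symmetric] g[OF st(2), symmetric] by (rule nn_integral_multc[symmetric]) auto
  also have "\<dots> = (\<integral>\<^sup>+a. \<integral>\<^sup>+b. ennreal (a powr (s - 1)) * ennreal (b powr (t - 1)) * ennreal (exp (- (a + b))) *
      indicator {0<..} a * indicator {0<..} b \<partial>lborel \<partial>lborel)"
  proof (rule nn_integral_cong)
    fix a :: real
    have "?g s a * (\<integral>\<^sup>+b. ?g t b \<partial>lborel) = (\<integral>\<^sup>+b. ?g s a * ?g t b \<partial>lborel)"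
      by (rule nn_integral_cmult[symmetric]) auto
    also have "\<dots> = (\<integral>\<^sup>+b. ennreal (a powr (s - 1)) * ennreal (b powr (t - 1)) * ennreal (exp (- (a + b))) *
      indicator {0<..} a * indicator {0<..} b \<partial>lborel)"
    proof (rule nn_integral_cong)
      fix b :: real
      have e: "ennreal (exp (- (a + b))) = ennreal (exp (- 1 * a)) * ennreal (exp (- 1 * b))"
        by (simp add: ennreal_mult'[symmetric] flip: exp_add)
      show "?g s a * ?g t b = ennreal (a powr (s - 1)) * ennreal (b powr (t - 1)) * ennreal (exp (- (a + b))) *
        indicator {0<..} a * indicator {0<..} b"
        unfolding e ennreal_mult'[OF powr_ge_zero] by (simp only: mult_ac)
    qed
    finally show "?g s a * (\<integral>\<^sup>+b. ?g t b \<partial>lborel) = \<dots>" .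
  qed
  also have "\<dots> = B * (\<integral>\<^sup>+m. ennreal (m powr (s + t - 1)) * ennreal (exp (- m)) * indicator {0<..} m \<partial>lborel)"
    unfolding B_def by (rule gamma_convolution_aux) (use st in auto)
  also have "(\<integral>\<^sup>+m. ennreal (m powr (s + t - 1)) * ennreal (exp (- m)) * indicator {0<..} m \<partial>lborel) = ennreal (Gamma (s + t))"
    using g[of "s + t"] st by (simp add: ennreal_mult')
  finally have "ennreal (Gamma s) * ennreal (Gamma t) * ennreal (1 / Gamma (s + t)) = B * (ennreal (Gamma (s + t)) * ennreal (1 / Gamma (s + t)))"
    by (simp only: mult.assoc)
  moreover have "ennreal (Gamma (s + t)) * ennreal (1 / Gamma (s + t)) = 1"
    using Gamma_real_pos[OF add_pos_pos[OF st]] by (simp add: ennreal_mult'[symmetric])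
  ultimately have "B = ennreal (Gamma s * Gamma t / Gamma (s + t))"
    using st Gamma_real_pos[OF add_pos_pos[OF st]] Gamma_real_pos[of s] Gamma_real_pos[of t]
    by (simp add: ennreal_mult'[symmetric])
  then show ?thesis using gamma_convolution_aux[OF \<psi> st] unfolding B_def by simp
qed

text \<open>The exponent s - 3/2 is (s - 1) - 1/2: \<open>bessel s\<close> is a mixture of the
  Gaussians exp (-x^2/m) / sqrt m with the Gamma weight m^(s-1) exp (-m). Under convolution the
  parameters m add, and the shapes of Gamma weights add as well.\<close>

lemma bessel_convolution:
  assumes st: "s > 0" "t > 0"
  shows "(\<integral>\<^sup>+y. bessel s (x + y) * bessel t y \<partial>lborel) =
    ennreal (sqrt pi * (Gamma s * Gamma t / Gamma (s + t))) * bessel (s + t) x"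
proof -
  define A where "A = (\<lambda>a y. ennreal (a powr (s - 3/2) * exp (- a - (x + y)\<^sup>2 / a)) * indicator {0<..} a)"
  define B where "B = (\<lambda>b y. ennreal (b powr (t - 3/2) * exp (- b - y\<^sup>2 / b)) * indicator {0<..} b)"
  \<comment> \<open>What remains after integrating out \<open>y\<close>: the Gaussian with parameter
    a + b together with exp (- (a + b)).\<close>
  define \<psi> where "\<psi> = (\<lambda>m. ennreal (m powr (- (1/2)) * exp (- m - x\<^sup>2 / m)))"
  have [measurable]: "case_prod A \<in> borel_measurable (borel \<Otimes>\<^sub>M borel)" "case_prod B \<in> borel_measurable (borel \<Otimes>\<^sub>M borel)"
      "\<psi> \<in> borel_measurable borel"
    unfolding A_def B_def \<psi>_def by measurable
  have "(\<integral>\<^sup>+y. bessel s (x + y) * bessel t y \<partial>lborel) = (\<integral>\<^sup>+y. \<integral>\<^sup>+a. \<integral>\<^sup>+b. A a y * B b y \<partial>lborel \<partial>lborel \<partial>lborel)"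
  proof (rule nn_integral_cong)
    fix y :: real
    have "bessel s (x + y) * bessel t y = (\<integral>\<^sup>+a. A a y \<partial>lborel) * (\<integral>\<^sup>+b. B b y \<partial>lborel)"
      by (simp add: A_def B_def bessel_def)
    also have "\<dots> = (\<integral>\<^sup>+a. \<integral>\<^sup>+b. A a y * B b y \<partial>lborel \<partial>lborel)"
      by (simp add: nn_integral_cmult nn_integral_multc)
    finally show "bessel s (x + y) * bessel t y = \<dots>" .
  qed
  also have "\<dots> = (\<integral>\<^sup>+a. \<integral>\<^sup>+y. \<integral>\<^sup>+b. A a y * B b y \<partial>lborel \<partial>lborel \<partial>lborel)"
    by (rule nn_integral_swap) auto
  also have "\<dots> = (\<integral>\<^sup>+a. \<integral>\<^sup>+b. \<integral>\<^sup>+y. A a y * B b y \<partial>lborel \<partial>lborel \<partial>lborel)"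
    by (rule nn_integral_cong, rule nn_integral_swap) auto
  also have "\<dots> = (\<integral>\<^sup>+a. \<integral>\<^sup>+b. ennreal (sqrt pi) * (ennreal (a powr (s - 1)) * ennreal (b powr (t - 1)) * \<psi> (a + b) *
      indicator {0<..} a * indicator {0<..} b) \<partial>lborel \<partial>lborel)"
  proof (intro nn_integral_cong)
    fix a b :: real
    show "(\<integral>\<^sup>+y. A a y * B b y \<partial>lborel) = ennreal (sqrt pi) * (ennreal (a powr (s - 1)) * ennreal (b powr (t - 1)) * \<psi> (a + b) *
      indicator {0<..} a * indicator {0<..} b)"
    proof (cases "a > 0 \<and> b > 0")
      case False
      have "(\<integral>\<^sup>+y. A a y * B b y \<partial>lborel) = (\<integral>\<^sup>+(y::real). 0 \<partial>lborel)"
        by (rule nn_integral_cong) (use False in \<open>auto simp: A_def B_def\<close>)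
      then show ?thesis using False by auto
    next
      case True
      let ?c = "a powr (s - 3/2) * exp (- a) * (b powr (t - 3/2) * exp (- b))"
      have "(\<integral>\<^sup>+y. A a y * B b y \<partial>lborel) = (\<integral>\<^sup>+y. ennreal ?c * ennreal (exp (- (x + y)\<^sup>2 / a - y\<^sup>2 / b)) \<partial>lborel)"
      proof (rule nn_integral_cong)
        fix y
        have "exp (- a - (x + y)\<^sup>2 / a) * exp (- b - y\<^sup>2 / b) = exp (- a) * exp (- b) * exp (- (x + y)\<^sup>2 / a - y\<^sup>2 / b)"
          by (simp flip: exp_add)
        then have "a powr (s - 3/2) * exp (- a - (x + y)\<^sup>2 / a) * (b powr (t - 3/2) * exp (- b - y\<^sup>2 / b)) = ?c * exp (- (x + y)\<^sup>2 / a - y\<^sup>2 / b)"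
          by (simp add: mult_ac)
        then show "A a y * B b y = ennreal ?c * ennreal (exp (- (x + y)\<^sup>2 / a - y\<^sup>2 / b))"
          using True by (simp add: A_def B_def ennreal_mult'[symmetric])
      qed
      also have "\<dots> = ennreal ?c * ennreal (sqrt pi * sqrt (a * b / (a + b)) * exp (- x\<^sup>2 / (a + b)))"
        unfolding nn_integral_gaussian_convolution[OF conjunct1[OF True] conjunct2[OF True], symmetric]
        by (rule nn_integral_cmult) simp
      also have "\<dots> = ennreal (?c * (sqrt pi * sqrt (a * b / (a + b)) * exp (- x\<^sup>2 / (a + b))))"
        using True by (intro ennreal_mult'[symmetric]) auto
      also have "?c * (sqrt pi * sqrt (a * b / (a + b)) * exp (- x\<^sup>2 / (a + b))) =
          sqrt pi * (a powr (s - 1) * b powr (t - 1) * ((a + b) powr (- (1/2)) * exp (- (a + b) - x\<^sup>2 / (a + b))))"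
      proof -
        have e: "exp (- a) * exp (- b) * exp (- x\<^sup>2 / (a + b)) = exp (- (a + b) - x\<^sup>2 / (a + b))"
          by (simp flip: exp_add)
        have p: "a powr (s - 1) = a powr (s - 3/2) * sqrt a" "b powr (t - 1) = b powr (t - 3/2) * sqrt b"
          using True powr_add[of a "s - 3/2" "1/2"] powr_add[of b "t - 3/2" "1/2"] by (simp_all add: powr_half_sqrt)
        have q: "sqrt (a * b / (a + b)) = sqrt a * sqrt b * (a + b) powr (- (1/2))"
          using True powr_minus_divide[of "a + b" "1/2"] by (simp add: powr_half_sqrt real_sqrt_mult real_sqrt_divide)
        show ?thesis unfolding e[symmetric] p q by (simp only: mult_ac)
      qed
      finally show ?thesis
        using True by (simp add: \<psi>_def ennreal_mult')
    qed
  qed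
  also have "\<dots> = ennreal (sqrt pi) * (\<integral>\<^sup>+a. \<integral>\<^sup>+b. ennreal (a powr (s - 1)) * ennreal (b powr (t - 1)) * \<psi> (a + b) *
      indicator {0<..} a * indicator {0<..} b \<partial>lborel \<partial>lborel)"
    by (simp add: nn_integral_cmult)
  also have "\<dots> = ennreal (sqrt pi) * (ennreal (Gamma s * Gamma t / Gamma (s + t)) *
    (\<integral>\<^sup>+m. ennreal (m powr (s + t - 1)) * \<psi> m * indicator {0<..} m \<partial>lborel))"
    using st by (subst gamma_convolution) auto
  also have "(\<integral>\<^sup>+m. ennreal (m powr (s + t - 1)) * \<psi> m * indicator {0<..} m \<partial>lborel) = bessel (s + t) x"
    unfolding bessel_def
  proof (rule nn_integral_cong)
    fix m :: real
    have "m powr (s + t - 1) * m powr (- (1/2)) = m powr (s + t - 3/2)"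
      using powr_add[of m "s + t - 1" "- (1/2)"] by simp
    then show "ennreal (m powr (s + t - 1)) * \<psi> m * indicator {0<..} m =
        ennreal (m powr (s + t - 3/2) * exp (- m - x\<^sup>2 / m)) * indicator {0<..} m"
      by (simp add: \<psi>_def ennreal_mult'[symmetric] mult.assoc[symmetric])
  qed
  finally show ?thesis
    by (simp only: ennreal_mult'[OF real_sqrt_ge_zero[OF pi_ge_zero]] mult.assoc)
qed

section \<open>Rational polynomials and kernels of integer index\<close>

definition nnrat :: "real set" where "nnrat = {q \<in> \<rat>. q \<ge> 0}"

lemma nnrat_closed [simp, intro]:
  "0 \<in> nnrat" "1 \<in> nnrat" "real n \<in> nnrat" "numeral v \<in> nnrat"
  "a \<in> nnrat \<Longrightarrow> b \<in> nnrat \<Longrightarrow> a + b \<in> nnrat"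
  "a \<in> nnrat \<Longrightarrow> b \<in> nnrat \<Longrightarrow> a * b \<in> nnrat"
  "a \<in> nnrat \<Longrightarrow> b \<in> nnrat \<Longrightarrow> a / b \<in> nnrat"
  "a \<in> nnrat \<Longrightarrow> a ^ n \<in> nnrat"
  by (auto simp: nnrat_def)

lemma fact_nnrat [simp]: "fact n \<in> nnrat"
  using Rats_of_nat[of "fact n", where 'a=real] by (simp add: nnrat_def)

text \<open>Nonnegative coefficients, and not merely rational ones, so that values at nonnegative
  points pass through \<open>ennreal\<close> without truncation.\<close>

definition nnrat_poly :: "real poly \<Rightarrow> bool" where
  "nnrat_poly p \<longleftrightarrow> (\<forall>i. coeff p i \<in> nnrat)"

lemma nnrat_poly_0 [simp]: "nnrat_poly 0"
  by (simp add: nnrat_poly_def)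

lemma nnrat_poly_pCons [simp]: "nnrat_poly (pCons c p) \<longleftrightarrow> c \<in> nnrat \<and> nnrat_poly p"
  unfolding nnrat_poly_def by (auto simp: coeff_pCons split: nat.splits)

lemma nnrat_poly_add: "nnrat_poly p \<Longrightarrow> nnrat_poly q \<Longrightarrow> nnrat_poly (p + q)"
  by (auto simp: nnrat_poly_def)

lemma nnrat_poly_smult: "c \<in> nnrat \<Longrightarrow> nnrat_poly q \<Longrightarrow> nnrat_poly (smult c q)"
  by (auto simp: nnrat_poly_def)

lemma nnrat_poly_poly: "nnrat_poly p \<Longrightarrow> x \<in> nnrat \<Longrightarrow> poly p x \<in> nnrat"
  by (induction p) auto

lemma nnrat_poly_nonneg: "nnrat_poly p \<Longrightarrow> x \<ge> 0 \<Longrightarrow> poly p x \<ge> 0"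
  by (induction p) (auto simp: nnrat_def)

text \<open>Integer index means half-integer Bessel order. The recurrence, with its nonnegative
  rational coefficients, preserves the shape polynomial times exp (-2x); only index 2 is treated
  apart, because it starts from \<open>bessel 0\<close>, where a factor 1/x occurs that x^2
  absorbs.\<close>

lemma bessel_nat:
  "\<exists>p. nnrat_poly p \<and> (\<forall>x\<ge>0. bessel (real (Suc j)) x = ennreal (sqrt pi * poly p x * exp (- 2 * x)))"
proof (induction j rule: less_induct)
  case (less j)
  have b1: "bessel 1 x = ennreal (sqrt pi * exp (- 2 * x))" if "x \<ge> 0" for x
    using bessel_0_1(1)[of x] bessel_at_0[of 1] that by (cases "x = 0") (auto simp: Gamma_one_half_real)
  consider "j = 0" | "j = 1" | k where "j = Suc (Suc k)" by (metis One_nat_def not0_implies_Suc)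
  then show ?case
  proof cases
    case 1
    then show ?thesis using b1 by (intro exI[of _ "[:1:]"]) auto
  next
    case 2
    have "bessel 2 x = ennreal (sqrt pi * poly [:1/2, 1:] x * exp (- 2 * x))" if "x \<ge> 0" for x
    proof -
      have b0: "ennreal (x\<^sup>2) * bessel 0 x = ennreal (x * (sqrt pi * exp (- 2 * x)))"
        using that bessel_0_1(2)[of x] by (cases "x = 0") (auto simp: power2_eq_square ennreal_mult mult.assoc)
      define c where "c = (1/2 :: real)"
      have c: "1 - 1/2 = c" "c \<ge> 0" by (simp_all add: c_def)
      have "bessel 2 x = ennreal c * ennreal (sqrt pi * exp (- 2 * x)) + ennreal (x * (sqrt pi * exp (- 2 * x)))"
        using bessel_recurrence[of 1 x, unfolded c(1)] that b1[OF that] b0 by simp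
      also have "\<dots> = ennreal (c * (sqrt pi * exp (- 2 * x)) + x * (sqrt pi * exp (- 2 * x)))"
        using that c(2) by (simp add: ennreal_mult'[symmetric] ennreal_plus[symmetric] del: ennreal_plus)
      also have "\<dots> = ennreal (sqrt pi * poly [:1/2, 1:] x * exp (- 2 * x))"
        by (simp add: c_def algebra_simps)
      finally show ?thesis .
    qed
    then show ?thesis using 2 by (intro exI[of _ "[:1/2, 1:]"]) auto
  next
    case (3 k)
    obtain p where p: "nnrat_poly p" "\<And>x. x \<ge> 0 \<Longrightarrow> bessel (real (Suc k)) x = ennreal (sqrt pi * poly p x * exp (- 2 * x))"
      using less.IH[of k] 3 by auto
    obtain q where q: "nnrat_poly q" "\<And>x. x \<ge> 0 \<Longrightarrow> bessel (real (Suc (Suc k))) x = ennreal (sqrt pi * poly q x * exp (- 2 * x))"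
      using less.IH[of "Suc k"] 3 by auto
    define c where "c = real k + 3/2"
    have c: "c \<in> nnrat" unfolding c_def by auto
    have "bessel (real (Suc j)) x = ennreal (sqrt pi * poly (smult c q + pCons 0 (pCons 0 p)) x * exp (- 2 * x))" if "x \<ge> 0" for x
    proof -
      have "bessel (real (Suc j)) x = ennreal c * bessel (real (Suc (Suc k))) x + ennreal (x\<^sup>2) * bessel (real (Suc k)) x"
        using bessel_recurrence[of "real (Suc (Suc k))" x] that 3 by (simp add: c_def add_ac)
      also have "\<dots> = ennreal (c * (sqrt pi * poly q x * exp (- 2 * x)) + x\<^sup>2 * (sqrt pi * poly p x * exp (- 2 * x)))"
        using that c nnrat_poly_nonneg[OF p(1) that] nnrat_poly_nonneg[OF q(1) that]
        by (simp add: p q ennreal_mult'[symmetric] ennreal_plus[symmetric] nnrat_def del: ennreal_plus of_nat_Suc)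
      also have "c * (sqrt pi * poly q x * exp (- 2 * x)) + x\<^sup>2 * (sqrt pi * poly p x * exp (- 2 * x)) =
          sqrt pi * poly (smult c q + pCons 0 (pCons 0 p)) x * exp (- 2 * x)"
        by (simp add: algebra_simps power2_eq_square)
      finally show ?thesis .
    qed
    moreover have "nnrat_poly (smult c q + pCons 0 (pCons 0 p))"
      using p q c by (auto intro!: nnrat_poly_add nnrat_poly_smult)
    ultimately show ?thesis by blast
  qed
qed

text \<open>Substituting \<open>m = x y\<close> makes \<open>exp (-2x)\<close> combine with the kernel to \<open>exp (-x (1 + y)\<^sup>2 / y)\<close>.\<close>

lemma bessel_half_integer:
  assumes "x > 0"
  shows "bessel (real p + 1/2) x =
    (\<integral>\<^sup>+y. ennreal (x ^ p * y powr (real p - 1) * exp (- (y + 1 / y) * x)) * indicator {0<..} y \<partial>lborel)"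
proof -
  have "bessel (real p + 1/2) x = ennreal x * (\<integral>\<^sup>+y. ennreal ((x * y) powr (real p + 1/2 - 3/2) * exp (- (x * y) - x\<^sup>2 / (x * y))) * indicator {0<..} (x * y) \<partial>lborel)"
    unfolding bessel_def using assms by (intro nn_integral_lborel_scale) auto
  also have "\<dots> = (\<integral>\<^sup>+y. ennreal x * (ennreal ((x * y) powr (real p + 1/2 - 3/2) * exp (- (x * y) - x\<^sup>2 / (x * y))) * indicator {0<..} (x * y)) \<partial>lborel)"
    by (rule nn_integral_cmult[symmetric]) auto
  also have "\<dots> = (\<integral>\<^sup>+y. ennreal (x ^ p * y powr (real p - 1) * exp (- (y + 1 / y) * x)) * indicator {0<..} y \<partial>lborel)"
  proof (rule nn_integral_cong)
    fix y :: real
    have i: "indicator {0<..} (x * y) = (indicator {0<..} y :: ennreal)"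
      using assms by (auto simp: indicator_def zero_less_mult_iff)
    have "x * ((x * y) powr (real p + 1/2 - 3/2) * exp (- (x * y) - x\<^sup>2 / (x * y))) = x ^ p * y powr (real p - 1) * exp (- (y + 1 / y) * x)"
      if "y > 0"
    proof -
      have e: "- (x * y) - x\<^sup>2 / (x * y) = - (y + 1 / y) * x" "real p + 1/2 - 3/2 = real p - 1"
        using that assms by (simp_all add: field_simps power2_eq_square)
      have "x * x powr (real p - 1) = x ^ p"
        using assms powr_mult_base[of x "real p - 1"] by (simp add: powr_realpow)
      then show ?thesis
        unfolding e using that assms by (simp add: powr_mult mult.assoc[symmetric])
    qed
    then show "ennreal x * (ennreal ((x * y) powr (real p + 1/2 - 3/2) * exp (- (x * y) - x\<^sup>2 / (x * y))) * indicator {0<..} (x * y)) =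
        ennreal (x ^ p * y powr (real p - 1) * exp (- (y + 1 / y) * x)) * indicator {0<..} y"
      unfolding i using assms by (cases "y > 0") (simp_all add: ennreal_mult'[symmetric])
  qed
  finally show ?thesis .
qed

text \<open>The power of 1 / (1 + y) is written as a Gamma integral in \<open>t\<close>, normalized
  by \<open>?c\<close>; integrating over \<open>y\<close> first leaves a second Gamma
  integral.\<close>

lemma nn_integral_beta_prime:
  "(\<integral>\<^sup>+y. ennreal (y ^ a / (1 + y) ^ (a + b + 2)) * indicator {0<..} y \<partial>lborel) =
    ennreal (fact a * fact b / fact (a + b + 1))"
proof -
  let ?c = "1 / fact (a + b + 1) :: real"
  have c0: "0 \<le> ?c * fact a" by simp
  let ?G = "\<lambda>y t. ennreal ?c * (ennreal (y ^ a * t ^ (a + b + 1) * exp (- (1 + y) * t)) * indicator {0<..} y * indicator {0<..} t)"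
  have "(\<integral>\<^sup>+y. ennreal (y ^ a / (1 + y) ^ (a + b + 2)) * indicator {0<..} y \<partial>lborel) = (\<integral>\<^sup>+y. \<integral>\<^sup>+t. ?G y t \<partial>lborel \<partial>lborel)"
  proof (rule nn_integral_cong)
    fix y :: real
    show "ennreal (y ^ a / (1 + y) ^ (a + b + 2)) * indicator {0<..} y = (\<integral>\<^sup>+t. ?G y t \<partial>lborel)"
    proof (cases "y > 0")
      case True
      have "(\<integral>\<^sup>+t. ?G y t \<partial>lborel) = (\<integral>\<^sup>+t. ennreal (?c * y ^ a) * (ennreal (t ^ (a + b + 1) * exp (- (1 + y) * t)) * indicator {0<..} t) \<partial>lborel)"
      proof (rule nn_integral_cong)
        fix t :: real
        show "?G y t = ennreal (?c * y ^ a) * (ennreal (t ^ (a + b + 1) * exp (- (1 + y) * t)) * indicator {0<..} t)"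
          using True by (cases "t > 0") (simp_all add: ennreal_mult'[symmetric] mult_ac del: fact_Suc)
      qed
      also have "\<dots> = ennreal (?c * y ^ a) * ennreal (fact (a + b + 1) / (1 + y) ^ Suc (a + b + 1))"
        using True nn_integral_power_exp[of "1 + y" "a + b + 1"] by (subst nn_integral_cmult) auto
      also have "\<dots> = ennreal (?c * y ^ a * (fact (a + b + 1) / (1 + y) ^ Suc (a + b + 1)))"
        using True by (intro ennreal_mult'[symmetric]) auto
      also have "?c * y ^ a * (fact (a + b + 1) / (1 + y) ^ Suc (a + b + 1)) = y ^ a / (1 + y) ^ (a + b + 2)"
        by (simp del: fact_Suc)
      finally show ?thesis using True by simp
    qed simp
  qed
  also have "\<dots> = (\<integral>\<^sup>+t. \<integral>\<^sup>+y. ?G y t \<partial>lborel \<partial>lborel)"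
    by (rule nn_integral_swap) auto
  also have "\<dots> = (\<integral>\<^sup>+t. ennreal (?c * fact a) * (ennreal (t ^ b * exp (- 1 * t)) * indicator {0<..} t) \<partial>lborel)"
  proof (rule nn_integral_cong)
    fix t :: real
    show "(\<integral>\<^sup>+y. ?G y t \<partial>lborel) = ennreal (?c * fact a) * (ennreal (t ^ b * exp (- 1 * t)) * indicator {0<..} t)"
    proof (cases "t > 0")
      case True
      have "(\<integral>\<^sup>+y. ?G y t \<partial>lborel) = (\<integral>\<^sup>+y. ennreal (?c * t ^ (a + b + 1) * exp (- t)) * (ennreal (y ^ a * exp (- t * y)) * indicator {0<..} y) \<partial>lborel)"
      proof (rule nn_integral_cong)
        fix y :: real
        have "exp (- (1 + y) * t) = exp (- t) * exp (- t * y)"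
          by (simp add: algebra_simps flip: exp_add)
        then show "?G y t = ennreal (?c * t ^ (a + b + 1) * exp (- t)) * (ennreal (y ^ a * exp (- t * y)) * indicator {0<..} y)"
          using True by (cases "y > 0") (simp_all add: ennreal_mult'[symmetric] mult_ac)
      qed
      also have "\<dots> = ennreal (?c * t ^ (a + b + 1) * exp (- t)) * ennreal (fact a / t ^ Suc a)"
        using True nn_integral_power_exp[of t "a"] by (subst nn_integral_cmult) auto
      also have "\<dots> = ennreal (?c * t ^ (a + b + 1) * exp (- t) * (fact a / t ^ Suc a))"
        using True by (intro ennreal_mult'[symmetric]) auto
      also have "?c * t ^ (a + b + 1) * exp (- t) * (fact a / t ^ Suc a) = ?c * fact a * (t ^ b * exp (- 1 * t))"
        using True by (simp add: power_add)
      finally show ?thesis unfolding ennreal_mult'[OF c0] using True by simp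
    qed simp
  qed
  also have "\<dots> = ennreal (?c * fact a) * ennreal (fact b / 1 ^ Suc b)"
    using nn_integral_power_exp[of 1 b] by (subst nn_integral_cmult) auto
  also have "\<dots> = ennreal (?c * fact a * (fact b / 1 ^ Suc b))"
    by (intro ennreal_mult'[symmetric]) auto
  finally show ?thesis by simp
qed

text \<open>The source of rationality for the constrained weights. By
  \<open>bessel_half_integer\<close> the exponent becomes linear in x with coefficient (1 + y)^2 /
  y. Integrating over x first gives y^(a+2p) / (1 + y)^(2a+2p+2), a Beta integral with integer
  parameters.\<close>

lemma bessel_moment:
  "(\<integral>\<^sup>+x. ennreal (x ^ a * exp (- 2 * x)) * bessel (real p + 1/2) x * indicator {0<..} x \<partial>lborel) =
    ennreal (fact (a + p) * (fact (a + 2 * p) * fact a / fact (2 * a + 2 * p + 1)))"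
proof -
  let ?G = "\<lambda>x y. ennreal (y powr (real p - 1)) * ennreal (x ^ (a + p) * exp (- ((1 + y)\<^sup>2 / y) * x)) * indicator {0<..} x * indicator {0<..} y"
  have "(\<integral>\<^sup>+x. ennreal (x ^ a * exp (- 2 * x)) * bessel (real p + 1/2) x * indicator {0<..} x \<partial>lborel) = (\<integral>\<^sup>+x. \<integral>\<^sup>+y. ?G x y \<partial>lborel \<partial>lborel)"
  proof (rule nn_integral_cong)
    fix x :: real
    show "ennreal (x ^ a * exp (- 2 * x)) * bessel (real p + 1/2) x * indicator {0<..} x = (\<integral>\<^sup>+y. ?G x y \<partial>lborel)"
    proof (cases "x > 0")
      case True
      then have "ennreal (x ^ a * exp (- 2 * x)) * bessel (real p + 1/2) x =
        (\<integral>\<^sup>+y. ennreal (x ^ a * exp (- 2 * x)) * (ennreal (x ^ p * y powr (real p - 1) * exp (- (y + 1 / y) * x)) * indicator {0<..} y) \<partial>lborel)"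
        by (subst nn_integral_cmult) (auto simp: bessel_half_integer)
      also have "\<dots> = (\<integral>\<^sup>+y. ?G x y \<partial>lborel)"
      proof (rule nn_integral_cong)
        fix y :: real
        have "exp (- 2 * x) * exp (- (y + 1 / y) * x) = exp (- ((1 + y)\<^sup>2 / y) * x)" if "y > 0"
        proof -
          have "- 2 * x + - (y + 1 / y) * x = - ((1 + y)\<^sup>2 / y) * x"
            using that by (simp add: field_simps power2_eq_square)
          then show ?thesis by (simp only: exp_add[symmetric])
        qed
        then have "x ^ a * exp (- 2 * x) * (x ^ p * y powr (real p - 1) * exp (- (y + 1 / y) * x)) =
          y powr (real p - 1) * (x ^ (a + p) * exp (- ((1 + y)\<^sup>2 / y) * x))" if "y > 0"
          using that by (simp add: power_add mult_ac)
        then show "ennreal (x ^ a * exp (- 2 * x)) * (ennreal (x ^ p * y powr (real p - 1) * exp (- (y + 1 / y) * x)) * indicator {0<..} y) = ?G x y"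
          using True by (cases "y > 0") (simp_all add: ennreal_mult'[symmetric])
      qed
      finally show ?thesis using True by simp
    qed simp
  qed
  also have "\<dots> = (\<integral>\<^sup>+y. \<integral>\<^sup>+x. ?G x y \<partial>lborel \<partial>lborel)"
    by (rule nn_integral_swap) auto
  also have "\<dots> = (\<integral>\<^sup>+y. ennreal (fact (a + p)) * (ennreal (y ^ (a + 2 * p) / (1 + y) ^ (a + 2 * p + a + 2)) * indicator {0<..} y) \<partial>lborel)"
  proof (rule nn_integral_cong)
    fix y :: real
    show "(\<integral>\<^sup>+x. ?G x y \<partial>lborel) = ennreal (fact (a + p)) * (ennreal (y ^ (a + 2 * p) / (1 + y) ^ (a + 2 * p + a + 2)) * indicator {0<..} y)"
    proof (cases "y > 0")
      case True
      have "(\<integral>\<^sup>+x. ?G x y \<partial>lborel) = (\<integral>\<^sup>+x. ennreal (y powr (real p - 1)) * (ennreal (x ^ (a + p) * exp (- ((1 + y)\<^sup>2 / y) * x)) * indicator {0<..} x) \<partial>lborel)"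
        using True by (intro nn_integral_cong) (simp add: mult.assoc)
      also have "\<dots> = ennreal (y powr (real p - 1)) * ennreal (fact (a + p) / ((1 + y)\<^sup>2 / y) ^ Suc (a + p))"
        using True nn_integral_power_exp[of "(1 + y)\<^sup>2 / y" "a + p"] by (subst nn_integral_cmult) auto
      also have "\<dots> = ennreal (y powr (real p - 1) * (fact (a + p) / ((1 + y)\<^sup>2 / y) ^ Suc (a + p)))"
        using True by (intro ennreal_mult'[symmetric]) auto
      also have "y powr (real p - 1) * (fact (a + p) / ((1 + y)\<^sup>2 / y) ^ Suc (a + p)) =
          fact (a + p) * (y ^ (a + 2 * p) / (1 + y) ^ (a + 2 * p + a + 2))"
      proof -
        have "y powr (real p - 1) * y = y ^ p"
          using True powr_mult_base[of y "real p - 1"] by (simp add: powr_realpow mult.commute)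
        moreover have "y powr (real p - 1) * y ^ Suc (a + p) = (y powr (real p - 1) * y) * y ^ (a + p)"
          by simp
        ultimately have "y powr (real p - 1) * y ^ Suc (a + p) = y ^ p * y ^ (a + p)" by (simp only:)
        also have "\<dots> = y ^ (a + 2 * p)" by (simp add: power_add[symmetric] mult_2 add_ac)
        finally have "y powr (real p - 1) * y ^ Suc (a + p) = y ^ (a + 2 * p)" .
        moreover have "((1 + y)\<^sup>2) ^ Suc (a + p) = (1 + y) ^ (a + 2 * p + a + 2)"
          unfolding power_mult[symmetric] by (rule arg_cong[where f="\<lambda>k. (1 + y) ^ k"]) simp
        ultimately show ?thesis unfolding power_divide by simp
      qed
      finally show ?thesis unfolding ennreal_mult'[OF fact_ge_zero] using True by simp
    qed simp
  qed
  also have "\<dots> = ennreal (fact (a + p)) * ennreal (fact (a + 2 * p) * fact a / fact (a + 2 * p + a + 1))"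
    unfolding nn_integral_beta_prime[symmetric] by (rule nn_integral_cmult) auto
  also have "a + 2 * p + a + 1 = 2 * a + 2 * p + 1" by simp
  finally show ?thesis by (simp only: ennreal_mult'[OF fact_ge_zero])
qed

section \<open>Iterated integrals over several weights\<close>

lemma borel_measurable_poly [measurable]:
  fixes q :: "real poly"
  assumes [measurable]: "f \<in> borel_measurable M"
  shows "(\<lambda>x. poly q (f x)) \<in> borel_measurable M"
  by (rule measurable_compose[OF assms]) (intro borel_measurable_continuous_onI continuous_intros)

text \<open>Induction on the polynomial through c + x q(x + y) + y q(x + y). The last summand raises
  the power of y, which is why \<open>a\<close> is arbitrary in the induction; the first one is a
  moment.\<close>

lemma bessel_poly_shift:
  assumes "nnrat_poly q"
  shows "\<exists>r. nnrat_poly r \<and> (\<forall>x\<ge>0. (\<integral>\<^sup>+y. ennreal (y ^ a * exp (- 2 * y) * poly q (x + y)) * bessel (real p + 1/2) y * indicator {0<..} y \<partial>lborel) = ennreal (poly r x))"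
  using assms
proof (induction q arbitrary: a)
  case 0
  show ?case by (intro exI[of _ 0]) simp
next
  case (pCons c q)
  then have c: "c \<in> nnrat" "c \<ge> 0" and q: "nnrat_poly q" by (auto simp: nnrat_def)
  let ?k = "\<lambda>a x y. ennreal (y ^ a * exp (- 2 * y) * poly q (x + y)) * bessel (real p + 1/2) y * indicator {0<..} y"
  obtain r0 where r0: "nnrat_poly r0" "\<And>x. x \<ge> 0 \<Longrightarrow> (\<integral>\<^sup>+y. ?k a x y \<partial>lborel) = ennreal (poly r0 x)"
    using pCons.IH[OF q, of a] by blast
  obtain r1 where r1: "nnrat_poly r1" "\<And>x. x \<ge> 0 \<Longrightarrow> (\<integral>\<^sup>+y. ?k (Suc a) x y \<partial>lborel) = ennreal (poly r1 x)"
    using pCons.IH[OF q, of "Suc a"] by blast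
  define \<mu> :: real where "\<mu> = fact (a + p) * (fact (a + 2 * p) * fact a / fact (2 * a + 2 * p + 1))"
  have \<mu>: "\<mu> \<in> nnrat" "\<mu> \<ge> 0" unfolding \<mu>_def by (auto simp del: fact_Suc)
  have "(\<integral>\<^sup>+y. ennreal (y ^ a * exp (- 2 * y) * poly (pCons c q) (x + y)) * bessel (real p + 1/2) y * indicator {0<..} y \<partial>lborel) =
      ennreal (poly ([:c * \<mu>:] + pCons 0 r0 + r1) x)" if x: "x \<ge> 0" for x
  proof -
    have "(\<integral>\<^sup>+y. ennreal (y ^ a * exp (- 2 * y) * poly (pCons c q) (x + y)) * bessel (real p + 1/2) y * indicator {0<..} y \<partial>lborel) =
      (\<integral>\<^sup>+y. ennreal c * (ennreal (y ^ a * exp (- 2 * y)) * bessel (real p + 1/2) y * indicator {0<..} y) +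
        (ennreal x * ?k a x y + ?k (Suc a) x y) \<partial>lborel)"
    proof (rule nn_integral_cong)
      fix y :: real
      have "ennreal (y ^ a * exp (- 2 * y) * poly (pCons c q) (x + y)) =
        ennreal c * ennreal (y ^ a * exp (- 2 * y)) + (ennreal x * ennreal (y ^ a * exp (- 2 * y) * poly q (x + y)) +
         ennreal (y ^ Suc a * exp (- 2 * y) * poly q (x + y)))" if "y > 0"
      proof -
        have p: "poly q (x + y) \<ge> 0" using that x q by (intro nnrat_poly_nonneg) auto
        have "y ^ a * exp (- 2 * y) * poly (pCons c q) (x + y) = c * (y ^ a * exp (- 2 * y)) + (x * (y ^ a * exp (- 2 * y) * poly q (x + y)) +
         y ^ Suc a * exp (- 2 * y) * poly q (x + y))" by (simp add: algebra_simps)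
        then show ?thesis using p c(2) that x
          by (simp add: ennreal_mult'[symmetric] ennreal_plus[symmetric] del: ennreal_plus poly_pCons)
      qed
      then show "ennreal (y ^ a * exp (- 2 * y) * poly (pCons c q) (x + y)) * bessel (real p + 1/2) y * indicator {0<..} y =
        ennreal c * (ennreal (y ^ a * exp (- 2 * y)) * bessel (real p + 1/2) y * indicator {0<..} y) +
        (ennreal x * ?k a x y + ?k (Suc a) x y)"
        by (cases "y > 0") (simp_all add: distrib_right mult.assoc del: poly_pCons)
    qed
    also have "\<dots> = ennreal c * ennreal \<mu> + (ennreal x * ennreal (poly r0 x) + ennreal (poly r1 x))"
      unfolding r0(2)[OF x, symmetric] r1(2)[OF x, symmetric] \<mu>_def bessel_moment[symmetric]
      by (simp add: nn_integral_add nn_integral_cmult)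
    also have "\<dots> = ennreal (poly ([:c * \<mu>:] + pCons 0 r0 + r1) x)"
      using x c \<mu> nnrat_poly_nonneg[OF r0(1) x] nnrat_poly_nonneg[OF r1(1) x]
      by (simp add: ennreal_mult'[symmetric] ennreal_plus[symmetric] del: ennreal_plus)
    finally show ?thesis .
  qed
  moreover have "nnrat_poly ([:c * \<mu>:] + pCons 0 r0 + r1)"
    using c \<mu> r0 r1 by (intro nnrat_poly_add) auto
  ultimately show ?case by blast
qed

text \<open>Integrating out one positive weight returns a polynomial of the same kind in the
  remaining total. The shift \<open>x\<close> makes the claim stable under induction: it absorbs the
  weight \<open>y\<close> that is integrated last.\<close>

lemma bessel_poly_shift_PiM:
  assumes "finite I" "nnrat_poly q"
  shows "\<exists>r. nnrat_poly r \<and> (\<forall>x\<ge>0. (\<integral>\<^sup>+l. (\<Prod>i\<in>I. bessel (real p + 1/2) (l i) * indicator {0<..} (l i)) *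
     ennreal (exp (- 2 * (\<Sum>i\<in>I. l i)) * poly q (x + (\<Sum>i\<in>I. l i))) \<partial>lborelP I) = ennreal (poly r x))"
  using assms
proof (induction I rule: finite_induct)
  case empty
  then show ?case by (intro exI[of _ q]) (simp add: PiM_empty nn_integral_count_space_finite)
next
  case (insert i I)
  let ?b = "\<lambda>y. bessel (real p + 1/2) y * indicator {0<..} y"
  obtain r where r: "nnrat_poly r" "\<And>x. x \<ge> 0 \<Longrightarrow> (\<integral>\<^sup>+l. (\<Prod>i\<in>I. ?b (l i)) *
     ennreal (exp (- 2 * (\<Sum>i\<in>I. l i)) * poly q (x + (\<Sum>i\<in>I. l i))) \<partial>lborelP I) = ennreal (poly r x)"
    using insert by blast
  obtain u where u: "nnrat_poly u" "\<And>x. x \<ge> 0 \<Longrightarrow> (\<integral>\<^sup>+y. ennreal (y ^ 0 * exp (- 2 * y) * poly r (x + y)) * bessel (real p + 1/2) y * indicator {0<..} y \<partial>lborel) = ennreal (poly u x)"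
    using bessel_poly_shift[OF r(1), of 0 p] by blast
  have "(\<integral>\<^sup>+l. (\<Prod>i\<in>insert i I. ?b (l i)) *
     ennreal (exp (- 2 * (\<Sum>i\<in>insert i I. l i)) * poly q (x + (\<Sum>i\<in>insert i I. l i))) \<partial>lborelP (insert i I)) = ennreal (poly u x)" if x: "x \<ge> 0" for x
  proof -
    have "(\<integral>\<^sup>+l. (\<Prod>i\<in>insert i I. ?b (l i)) *
       ennreal (exp (- 2 * (\<Sum>i\<in>insert i I. l i)) * poly q (x + (\<Sum>i\<in>insert i I. l i))) \<partial>lborelP (insert i I)) =
      (\<integral>\<^sup>+y. \<integral>\<^sup>+l. (\<Prod>j\<in>insert i I. ?b ((l(i := y)) j)) *
       ennreal (exp (- 2 * (\<Sum>j\<in>insert i I. (l(i := y)) j)) * poly q (x + (\<Sum>j\<in>insert i I. (l(i := y)) j))) \<partial>lborelP I \<partial>lborel)"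
      using insert by (intro lborel_prod.product_nn_integral_insert_rev) (auto simp del: sum.insert prod.insert)
    also have "\<dots> = (\<integral>\<^sup>+y. ennreal (y ^ 0 * exp (- 2 * y) * poly r (x + y)) * bessel (real p + 1/2) y * indicator {0<..} y \<partial>lborel)"
    proof (rule nn_integral_cong)
      fix y :: real
      have s: "(\<Sum>j\<in>insert i I. (l(i := y)) j) = y + (\<Sum>j\<in>I. l j)" for l
        using insert.hyps by (simp add: sum.insert) (intro sum.cong, auto)
      have pr: "(\<Prod>j\<in>insert i I. ?b ((l(i := y)) j)) = ?b y * (\<Prod>j\<in>I. ?b (l j))" for l
      proof -
        have "(\<Prod>j\<in>I. ?b ((l(i := y)) j)) = (\<Prod>j\<in>I. ?b (l j))"
          using insert.hyps by (intro prod.cong) auto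
        then show ?thesis using insert.hyps by simp
      qed
      have "(\<integral>\<^sup>+l. (\<Prod>j\<in>insert i I. ?b ((l(i := y)) j)) *
       ennreal (exp (- 2 * (\<Sum>j\<in>insert i I. (l(i := y)) j)) * poly q (x + (\<Sum>j\<in>insert i I. (l(i := y)) j))) \<partial>lborelP I) =
       (\<integral>\<^sup>+l. (?b y * ennreal (exp (- 2 * y))) * ((\<Prod>j\<in>I. ?b (l j)) * ennreal (exp (- 2 * (\<Sum>j\<in>I. l j)) * poly q ((x + y) + (\<Sum>j\<in>I. l j)))) \<partial>lborelP I)"
      proof (rule nn_integral_cong)
        fix l :: "'a \<Rightarrow> real"
        have e: "exp (- 2 * (y + (\<Sum>j\<in>I. l j))) = exp (- 2 * y) * exp (- 2 * (\<Sum>j\<in>I. l j))"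
          by (simp add: algebra_simps flip: exp_add)
        show "(\<Prod>j\<in>insert i I. ?b ((l(i := y)) j)) *
       ennreal (exp (- 2 * (\<Sum>j\<in>insert i I. (l(i := y)) j)) * poly q (x + (\<Sum>j\<in>insert i I. (l(i := y)) j))) =
          (?b y * ennreal (exp (- 2 * y))) * ((\<Prod>j\<in>I. ?b (l j)) * ennreal (exp (- 2 * (\<Sum>j\<in>I. l j)) * poly q ((x + y) + (\<Sum>j\<in>I. l j))))"
          unfolding s pr e mult.assoc[of "exp (- 2 * y)"] ennreal_mult'[OF exp_ge_zero] by (simp only: mult_ac add_ac)
      qed
      also have "\<dots> = (?b y * ennreal (exp (- 2 * y))) * (\<integral>\<^sup>+l. ((\<Prod>j\<in>I. ?b (l j)) * ennreal (exp (- 2 * (\<Sum>j\<in>I. l j)) * poly q ((x + y) + (\<Sum>j\<in>I. l j)))) \<partial>lborelP I)"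
        by (rule nn_integral_cmult) measurable
      also have "\<dots> = ennreal (y ^ 0 * exp (- 2 * y) * poly r (x + y)) * bessel (real p + 1/2) y * indicator {0<..} y"
      proof (cases "y > 0")
        case True
        then have "x + y \<ge> 0" using x by simp
        show ?thesis unfolding r(2)[OF \<open>x + y \<ge> 0\<close>] using True by (simp add: ennreal_mult') (simp only: mult_ac)
      qed simp
      finally show "(\<integral>\<^sup>+l. (\<Prod>j\<in>insert i I. ?b ((l(i := y)) j)) *
       ennreal (exp (- 2 * (\<Sum>j\<in>insert i I. (l(i := y)) j)) * poly q (x + (\<Sum>j\<in>insert i I. (l(i := y)) j))) \<partial>lborelP I) = \<dots>" .
    qed
    also have "\<dots> = ennreal (poly u x)" by (rule u(2)[OF x])
    finally show ?thesis .
  qed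
  then show ?case using u(1) by blast
qed

text \<open>Repeated \<open>bessel_convolution\<close>; the Gamma factors of successive steps
  telescope.\<close>

lemma bessel_convolution_PiM:
  fixes s0 s :: real
  assumes "finite I" "s0 > 0" "s > 0"
  shows "(\<integral>\<^sup>+l. bessel s0 (x + (\<Sum>i\<in>I. l i)) * (\<Prod>i\<in>I. bessel s (l i)) \<partial>lborelP I) =
    ennreal (sqrt pi ^ card I * (Gamma s0 * Gamma s ^ card I / Gamma (s0 + card I * s))) * bessel (s0 + card I * s) x"
  using assms(1)
proof (induction I arbitrary: x rule: finite_induct)
  case empty
  then show ?case using Gamma_real_pos[OF assms(2)] by (simp add: PiM_empty nn_integral_count_space_finite)
next
  case (insert i I)
  define c where "c = sqrt pi ^ card I * (Gamma s0 * Gamma s ^ card I / Gamma (s0 + card I * s))"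
  have pos: "s0 + card I * s > 0" using assms by (simp add: add_pos_nonneg)
  have c: "c \<ge> 0" unfolding c_def using assms Gamma_real_pos[OF pos] Gamma_real_pos[of s0] Gamma_real_pos[of s]
    by (intro mult_nonneg_nonneg divide_nonneg_pos) auto
  have "(\<integral>\<^sup>+l. bessel s0 (x + (\<Sum>i\<in>insert i I. l i)) * (\<Prod>i\<in>insert i I. bessel s (l i)) \<partial>lborelP (insert i I)) =
    (\<integral>\<^sup>+y. \<integral>\<^sup>+l. bessel s0 (x + (\<Sum>j\<in>insert i I. (l(i := y)) j)) * (\<Prod>j\<in>insert i I. bessel s ((l(i := y)) j)) \<partial>lborelP I \<partial>lborel)"
    using insert by (intro lborel_prod.product_nn_integral_insert_rev) (auto simp del: sum.insert prod.insert)
  also have "\<dots> = (\<integral>\<^sup>+y. ennreal c * (bessel (s0 + card I * s) (x + y) * bessel s y) \<partial>lborel)"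
  proof (rule nn_integral_cong)
    fix y :: real
    have s: "(\<Sum>j\<in>insert i I. (l(i := y)) j) = y + (\<Sum>j\<in>I. l j)" for l
      using insert.hyps by (simp add: sum.insert) (intro sum.cong, auto)
    have pr: "(\<Prod>j\<in>insert i I. bessel s ((l(i := y)) j)) = bessel s y * (\<Prod>j\<in>I. bessel s (l j))" for l
    proof -
      have "(\<Prod>j\<in>I. bessel s ((l(i := y)) j)) = (\<Prod>j\<in>I. bessel s (l j))"
        using insert.hyps by (intro prod.cong) auto
      then show ?thesis using insert.hyps by simp
    qed
    have "(\<integral>\<^sup>+l. bessel s0 (x + (\<Sum>j\<in>insert i I. (l(i := y)) j)) * (\<Prod>j\<in>insert i I. bessel s ((l(i := y)) j)) \<partial>lborelP I) =
      (\<integral>\<^sup>+l. bessel s y * (bessel s0 ((x + y) + (\<Sum>j\<in>I. l j)) * (\<Prod>j\<in>I. bessel s (l j))) \<partial>lborelP I)"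
      unfolding s pr by (simp only: mult_ac add_ac)
    also have "\<dots> = bessel s y * (\<integral>\<^sup>+l. bessel s0 ((x + y) + (\<Sum>j\<in>I. l j)) * (\<Prod>j\<in>I. bessel s (l j)) \<partial>lborelP I)"
      by (rule nn_integral_cmult) measurable
    also have "\<dots> = ennreal c * (bessel (s0 + card I * s) (x + y) * bessel s y)"
      unfolding insert.IH c_def by (simp only: mult_ac)
    finally show "(\<integral>\<^sup>+l. bessel s0 (x + (\<Sum>j\<in>insert i I. (l(i := y)) j)) * (\<Prod>j\<in>insert i I. bessel s ((l(i := y)) j)) \<partial>lborelP I) = \<dots>" .
  qed
  also have "\<dots> = ennreal c * (ennreal (sqrt pi * (Gamma (s0 + card I * s) * Gamma s / Gamma (s0 + card I * s + s))) * bessel (s0 + card I * s + s) x)"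
    unfolding bessel_convolution[OF pos assms(3), symmetric] by (rule nn_integral_cmult) measurable
  also have "\<dots> = ennreal (c * (sqrt pi * (Gamma (s0 + card I * s) * Gamma s / Gamma (s0 + card I * s + s)))) * bessel (s0 + card I * s + s) x"
    using c by (simp only: mult.assoc ennreal_mult')
  also have "s0 + card I * s + s = s0 + card (insert i I) * s" using insert by (simp add: algebra_simps)
  also have "c * (sqrt pi * (Gamma (s0 + card I * s) * Gamma s / Gamma (s0 + card (insert i I) * s))) =
      sqrt pi ^ card (insert i I) * (Gamma s0 * Gamma s ^ card (insert i I) / Gamma (s0 + card (insert i I) * s))"
    using insert.hyps Gamma_real_pos[OF pos] by (simp add: c_def field_simps)
  finally show ?case .
qed

text \<open>Repeated Gaussian convolution, in which the parameters add up to
  \<open>m0 + sum m I\<close>. At x = 0 the integrand is the Gaussian of \<open>qform\<close>, whose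
  total mass is obtained in this way.\<close>

lemma nn_integral_gaussian_PiM:
  fixes m :: "'i \<Rightarrow> real"
  assumes "finite I" "m0 > 0" "\<And>i. i \<in> I \<Longrightarrow> m i > 0"
  shows "(\<integral>\<^sup>+l. ennreal (exp (- (x + (\<Sum>i\<in>I. l i))\<^sup>2 / m0 - (\<Sum>i\<in>I. (l i)\<^sup>2 / m i))) \<partial>lborelP I) =
    ennreal (sqrt pi ^ card I * sqrt (m0 * prod m I / (m0 + sum m I)) * exp (- x\<^sup>2 / (m0 + sum m I)))"
  using assms(1,3)
proof (induction I arbitrary: x rule: finite_induct)
  case empty
  then show ?case using assms(2) by (simp add: PiM_empty nn_integral_count_space_finite)
next
  case (insert i I)
  define M where "M = m0 + sum m I"
  define c where "c = sqrt pi ^ card I * sqrt (m0 * prod m I / M)"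
  have M: "M > 0" unfolding M_def using insert assms by (intro add_pos_nonneg sum_nonneg) (auto intro: less_imp_le)
  have mi: "m i > 0" using insert by simp
  have P: "prod m I > 0" using insert by (intro prod_pos) auto
  have c: "c \<ge> 0" unfolding c_def using M P assms by simp
  have "(\<integral>\<^sup>+l. ennreal (exp (- (x + (\<Sum>i\<in>insert i I. l i))\<^sup>2 / m0 - (\<Sum>i\<in>insert i I. (l i)\<^sup>2 / m i))) \<partial>lborelP (insert i I)) =
    (\<integral>\<^sup>+y. \<integral>\<^sup>+l. ennreal (exp (- (x + (\<Sum>j\<in>insert i I. (l(i := y)) j))\<^sup>2 / m0 - (\<Sum>j\<in>insert i I. ((l(i := y)) j)\<^sup>2 / m j))) \<partial>lborelP I \<partial>lborel)"
    using insert by (intro lborel_prod.product_nn_integral_insert_rev) (auto simp del: sum.insert prod.insert)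
  also have "\<dots> = (\<integral>\<^sup>+y. ennreal c * (ennreal (exp (- (x + y)\<^sup>2 / M - y\<^sup>2 / m i))) \<partial>lborel)"
  proof (rule nn_integral_cong)
    fix y :: real
    have s: "(\<Sum>j\<in>insert i I. (l(i := y)) j) = y + (\<Sum>j\<in>I. l j)" for l
      using insert.hyps by (simp add: sum.insert) (intro sum.cong, auto)
    have s2: "(\<Sum>j\<in>insert i I. ((l(i := y)) j)\<^sup>2 / m j) = y\<^sup>2 / m i + (\<Sum>j\<in>I. (l j)\<^sup>2 / m j)" for l
    proof -
      have "(\<Sum>j\<in>I. ((l(i := y)) j)\<^sup>2 / m j) = (\<Sum>j\<in>I. (l j)\<^sup>2 / m j)"
        using insert.hyps by (intro sum.cong) auto
      then show ?thesis using insert.hyps by simp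
    qed
    have "(\<integral>\<^sup>+l. ennreal (exp (- (x + (\<Sum>j\<in>insert i I. (l(i := y)) j))\<^sup>2 / m0 - (\<Sum>j\<in>insert i I. ((l(i := y)) j)\<^sup>2 / m j))) \<partial>lborelP I) =
      (\<integral>\<^sup>+l. ennreal (exp (- y\<^sup>2 / m i)) * ennreal (exp (- ((x + y) + (\<Sum>j\<in>I. l j))\<^sup>2 / m0 - (\<Sum>j\<in>I. (l j)\<^sup>2 / m j))) \<partial>lborelP I)"
    proof (rule nn_integral_cong)
      fix l :: "'i \<Rightarrow> real"
      have r: "- B - (Y + T) = - Y + (- B - T)" for B Y T :: real by simp
      show "ennreal (exp (- (x + (\<Sum>j\<in>insert i I. (l(i := y)) j))\<^sup>2 / m0 - (\<Sum>j\<in>insert i I. ((l(i := y)) j)\<^sup>2 / m j))) =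
        ennreal (exp (- y\<^sup>2 / m i)) * ennreal (exp (- ((x + y) + (\<Sum>j\<in>I. l j))\<^sup>2 / m0 - (\<Sum>j\<in>I. (l j)\<^sup>2 / m j)))"
        unfolding s s2 ennreal_mult'[OF exp_ge_zero, symmetric] exp_add[symmetric] minus_divide_left[symmetric] r add.assoc ..
    qed
    also have "\<dots> = ennreal (exp (- y\<^sup>2 / m i)) * (\<integral>\<^sup>+l. ennreal (exp (- ((x + y) + (\<Sum>j\<in>I. l j))\<^sup>2 / m0 - (\<Sum>j\<in>I. (l j)\<^sup>2 / m j))) \<partial>lborelP I)"
      by (rule nn_integral_cmult) measurable
    also have "\<dots> = ennreal (exp (- y\<^sup>2 / m i)) * ennreal (c * exp (- (x + y)\<^sup>2 / M))"
      using insert.prems by (subst insert.IH) (simp_all add: c_def M_def)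
    also have "\<dots> = ennreal c * (ennreal (exp (- (x + y)\<^sup>2 / M - y\<^sup>2 / m i)))"
      using c by (simp add: ennreal_mult'[symmetric] mult_ac) (simp flip: exp_add)
    finally show "(\<integral>\<^sup>+l. ennreal (exp (- (x + (\<Sum>j\<in>insert i I. (l(i := y)) j))\<^sup>2 / m0 - (\<Sum>j\<in>insert i I. ((l(i := y)) j)\<^sup>2 / m j))) \<partial>lborelP I) = \<dots>" .
  qed
  also have "\<dots> = ennreal c * ennreal (sqrt pi * sqrt (M * m i / (M + m i)) * exp (- x\<^sup>2 / (M + m i)))"
    unfolding nn_integral_gaussian_convolution[OF M mi, symmetric] by (rule nn_integral_cmult) measurable
  also have "\<dots> = ennreal (c * (sqrt pi * sqrt (M * m i / (M + m i)) * exp (- x\<^sup>2 / (M + m i))))"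
    using c by (simp only: ennreal_mult')
  also have "M + m i = m0 + sum m (insert i I)" using insert by (simp add: M_def)
  also have "c * (sqrt pi * sqrt (M * m i / (m0 + sum m (insert i I))) * exp (- x\<^sup>2 / (m0 + sum m (insert i I)))) =
      sqrt pi ^ card (insert i I) * sqrt (m0 * prod m (insert i I) / (m0 + sum m (insert i I))) * exp (- x\<^sup>2 / (m0 + sum m (insert i I)))"
  proof -
    have "sqrt (m0 * prod m I / M) * sqrt (M * m i / N) = sqrt (m0 * (m i * prod m I) / N)" for N
      unfolding real_sqrt_mult[symmetric] using M by (intro arg_cong[where f=sqrt]) (simp add: field_simps)
    moreover have "c * (sqrt pi * sqrt (M * m i / N) * E) =
        (sqrt pi ^ card I * sqrt pi) * (sqrt (m0 * prod m I / M) * sqrt (M * m i / N)) * E" for N E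
      unfolding c_def by (simp only: mult_ac)
    ultimately have key: "c * (sqrt pi * sqrt (M * m i / N) * E) =
        (sqrt pi ^ card I * sqrt pi) * sqrt (m0 * (m i * prod m I) / N) * E" for N E
      by (simp only:)
    show ?thesis unfolding key using insert.hyps by simp
  qed
  finally show ?case .
qed

section \<open>Cones and Gaussian simplices\<close>

text \<open>Keeps the simplifier from turning \<open>{1..d}\<close> into \<open>{Suc 0..d}\<close>.\<close>

declare One_nat_def [simp del]

section \<open>The share of a cone in a radial integral\<close>

lemma AE_lborelP_component:
  assumes "finite I" "i \<in> I"
  shows "AE x in (lborelP I :: ('i \<Rightarrow> 'a::euclidean_space) measure). x i \<noteq> 0"
proof (rule AE_I)
  let ?N = "PiE I (\<lambda>j. if j = i then {0 :: 'a} else UNIV)"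
  show "{x \<in> space (lborelP I). \<not> x i \<noteq> 0} \<subseteq> ?N" by (auto simp: space_PiM PiE_def extensional_def)
  have "emeasure (lborelP I) ?N = (\<Prod>j\<in>I. emeasure lborel (if j = i then {0 :: 'a} else UNIV))"
    using assms by (intro lborel_prod.emeasure_PiM) auto
  also have "\<dots> = 0" using assms by (intro prod_zero bexI[of _ i]) auto
  finally show "emeasure (lborelP I) ?N = 0" .
  show "?N \<in> sets (lborelP I)" using assms by (intro sets_PiM_I_finite) auto
qed

text \<open>Integrate \<open>\<Gamma> (u q x)\<close> against the weight \<open>exp (- 1 / u) / u\<close>: first scaling \<open>x\<close>, then
  substituting \<open>t = u q x\<close>.\<close>

lemma radial_aux:
  fixes q :: "('i \<Rightarrow> real) \<Rightarrow> real" and \<Gamma> :: "real \<Rightarrow> ennreal"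
  assumes fin: "finite I"
    and q [measurable]: "q \<in> borel_measurable (lborelP I)"
    and qhom: "\<And>s x. s > 0 \<Longrightarrow> x \<in> space (lborelP I) \<Longrightarrow> q (\<lambda>i\<in>I. s * x i) = s\<^sup>2 * q x"
    and qpos: "AE x in lborelP I. q x > 0"
    and A [measurable]: "A \<in> sets (lborelP I)"
    and cone: "\<And>s x. s > 0 \<Longrightarrow> x \<in> space (lborelP I) \<Longrightarrow> (\<lambda>i\<in>I. s * x i) \<in> A \<longleftrightarrow> x \<in> A"
    and \<Gamma> [measurable]: "\<Gamma> \<in> borel_measurable borel"
  shows "(\<integral>\<^sup>+u. ennreal (exp (- 1 / u) / u * u powr (- (card I / 2))) * indicator {0<..} u \<partial>lborel) *
      (\<integral>\<^sup>+x. \<Gamma> (q x) * indicator A x \<partial>lborelP I) =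
    (\<integral>\<^sup>+t. \<Gamma> t * ennreal (t powr (card I / 2 - 1)) * indicator {0<..} t \<partial>lborel) *
      (\<integral>\<^sup>+x. ennreal (exp (- q x)) * indicator A x \<partial>lborelP I)"
proof -
  define n where "n = card I"
  \<comment> \<open>Scaling by sqrt t: \<open>q\<close> is homogeneous of degree 2 and
    \<open>A\<close> is a cone, so only the Jacobian t^(n/2) remains.\<close>
  have scale: "(\<integral>\<^sup>+x. H (q x / t) * indicator A x \<partial>lborelP I) =
      ennreal (t powr (n / 2)) * (\<integral>\<^sup>+x. H (q x) * indicator A x \<partial>lborelP I)"
    if [measurable]: "H \<in> borel_measurable borel" and t: "t > 0" for H :: "real \<Rightarrow> ennreal" and t
  proof -
    have "(\<integral>\<^sup>+x. H (q x / t) * indicator A x \<partial>lborelP I) = ennreal (\<bar>sqrt t\<bar> ^ (DIM(real) * card I)) *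
      (\<integral>\<^sup>+x. H (q (\<lambda>i\<in>I. 0 + sqrt t *\<^sub>R x i) / t) * indicator A (\<lambda>i\<in>I. 0 + sqrt t *\<^sub>R x i) \<partial>lborelP I)"
      using t by (intro nn_integral_lborelP_affine[OF fin, where y="\<lambda>_. 0"]) auto
    also have "(\<integral>\<^sup>+x. H (q (\<lambda>i\<in>I. 0 + sqrt t *\<^sub>R x i) / t) * indicator A (\<lambda>i\<in>I. 0 + sqrt t *\<^sub>R x i) \<partial>lborelP I) =
        (\<integral>\<^sup>+x. H (q x) * indicator A x \<partial>lborelP I)"
    proof (rule nn_integral_cong)
      fix x :: "'i \<Rightarrow> real" assume x: "x \<in> space (lborelP I)"
      show "H (q (\<lambda>i\<in>I. 0 + sqrt t *\<^sub>R x i) / t) * indicator A (\<lambda>i\<in>I. 0 + sqrt t *\<^sub>R x i) = H (q x) * indicator A x"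
        using qhom[of "sqrt t" x] cone[of "sqrt t" x] t x by (auto simp: indicator_def)
    qed
    also have "\<bar>sqrt t\<bar> ^ (DIM(real) * card I) = t powr (n / 2)"
      using t by (simp add: n_def powr_half_sqrt[symmetric] powr_realpow[symmetric] powr_powr)
    finally show ?thesis .
  qed
  let ?F = "\<integral>\<^sup>+x. \<Gamma> (q x) * indicator A x \<partial>lborelP I"
  let ?G = "\<integral>\<^sup>+x. ennreal (exp (- q x)) * indicator A x \<partial>lborelP I"
  \<comment> \<open>\<open>?k\<close> and \<open>?l\<close> are the integrand before and after the
    substitution t = u q x. The weight in \<open>u\<close> is chosen so that \<open>?l\<close>
    contains the Gaussian exp (- q x / t), which \<open>scale\<close> reduces to the one at t =
    1.\<close>
  let ?k = "\<lambda>u x. ennreal (exp (- 1 / u) / u) * indicator {0<..} u * (\<Gamma> (u * q x) * indicator A x)"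
  let ?l = "\<lambda>t x. ennreal (exp (- q x / t) / t) * indicator {0<..} t * (\<Gamma> t * indicator A x)"
  have "(\<integral>\<^sup>+u. ennreal (exp (- 1 / u) / u * u powr (- (n / 2))) * indicator {0<..} u \<partial>lborel) * ?F =
      (\<integral>\<^sup>+u. ennreal (exp (- 1 / u) / u * u powr (- (n / 2))) * indicator {0<..} u * ?F \<partial>lborel)"
    by (rule nn_integral_multc[symmetric]) auto
  also have "\<dots> = (\<integral>\<^sup>+u. \<integral>\<^sup>+x. ?k u x \<partial>lborelP I \<partial>lborel)"
  proof (rule nn_integral_cong)
    fix u :: real
    have "(\<integral>\<^sup>+x. ?k u x \<partial>lborelP I) = ennreal (exp (- 1 / u) / u) * indicator {0<..} u * (\<integral>\<^sup>+x. \<Gamma> (u * q x) * indicator A x \<partial>lborelP I)"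
      by (rule nn_integral_cmult) measurable
    also have "\<dots> = ennreal (exp (- 1 / u) / u * u powr (- (n / 2))) * indicator {0<..} u * ?F"
    proof (cases "u > 0")
      case True
      have "(1 / u) powr (n / 2) = u powr (- (n / 2))" using True by (simp add: powr_divide powr_minus_divide)
      then have "(\<integral>\<^sup>+x. \<Gamma> (u * q x) * indicator A x \<partial>lborelP I) = ennreal (u powr (- (n / 2))) * ?F"
        using scale[OF \<Gamma>, of "1 / u"] True by (simp add: mult.commute)
      then show ?thesis using True by (simp only: ennreal_mult' divide_nonneg_pos exp_ge_zero) (simp add: mult_ac)
    qed simp
    finally show "ennreal (exp (- 1 / u) / u * u powr (- (n / 2))) * indicator {0<..} u * ?F = (\<integral>\<^sup>+x. ?k u x \<partial>lborelP I)" ..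
  qed
  also have "\<dots> = (\<integral>\<^sup>+x. \<integral>\<^sup>+u. ?k u x \<partial>lborel \<partial>lborelP I)"
    using fin by (intro nn_integral_swap) auto
  also have "\<dots> = (\<integral>\<^sup>+x. \<integral>\<^sup>+t. ?l t x \<partial>lborel \<partial>lborelP I)"
  proof (rule nn_integral_cong_AE, use qpos in eventually_elim)
    fix x :: "'i \<Rightarrow> real" assume qx: "q x > 0"
    have "(\<integral>\<^sup>+u. ?k u x \<partial>lborel) = ennreal (1 / q x) * (\<integral>\<^sup>+t. ?k (1 / q x * t) x \<partial>lborel)"
      using qx by (intro nn_integral_lborel_scale) auto
    also have "\<dots> = (\<integral>\<^sup>+t. ennreal (1 / q x) * ?k (1 / q x * t) x \<partial>lborel)"
      by (rule nn_integral_cmult[symmetric]) auto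
    also have "\<dots> = (\<integral>\<^sup>+t. ?l t x \<partial>lborel)"
    proof (rule nn_integral_cong)
      fix t :: real
      have i: "indicator {0<..} (1 / q x * t) = (indicator {0<..} t :: ennreal)"
        using qx by (auto simp: indicator_def zero_less_divide_iff)
      have "ennreal (1 / q x) * ennreal (exp (- 1 / (1 / q x * t)) / (1 / q x * t)) = ennreal (exp (- q x / t) / t)" if "t > 0"
        using qx that by (simp add: ennreal_mult'[symmetric])
      then show "ennreal (1 / q x) * ?k (1 / q x * t) x = ?l t x"
        unfolding i using qx by (cases "t > 0") (simp_all add: mult.assoc[symmetric])
    qed
    finally show "(\<integral>\<^sup>+u. ?k u x \<partial>lborel) = (\<integral>\<^sup>+t. ?l t x \<partial>lborel)" .
  qed
  also have "\<dots> = (\<integral>\<^sup>+t. \<integral>\<^sup>+x. ?l t x \<partial>lborelP I \<partial>lborel)"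
    using fin by (intro nn_integral_swap) auto
  also have "\<dots> = (\<integral>\<^sup>+t. (\<Gamma> t * ennreal (t powr (n / 2 - 1)) * indicator {0<..} t) * ?G \<partial>lborel)"
  proof (rule nn_integral_cong)
    fix t :: real
    show "(\<integral>\<^sup>+x. ?l t x \<partial>lborelP I) = (\<Gamma> t * ennreal (t powr (n / 2 - 1)) * indicator {0<..} t) * ?G"
    proof (cases "t > 0")
      case True
      have "(\<integral>\<^sup>+x. ?l t x \<partial>lborelP I) = (\<integral>\<^sup>+x. (\<Gamma> t * ennreal (1 / t)) * (ennreal (exp (- (q x / t))) * indicator A x) \<partial>lborelP I)"
        using True by (intro nn_integral_cong) (simp add: divide_inverse ennreal_mult' mult_ac)
      also have "\<dots> = (\<Gamma> t * ennreal (1 / t)) * (\<integral>\<^sup>+x. ennreal (exp (- (q x / t))) * indicator A x \<partial>lborelP I)"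
        by (rule nn_integral_cmult) measurable
      also have "(\<integral>\<^sup>+x. ennreal (exp (- (q x / t))) * indicator A x \<partial>lborelP I) = ennreal (t powr (n / 2)) * ?G"
        using True by (rule scale[rotated]) measurable
      also have "\<Gamma> t * ennreal (1 / t) * (ennreal (t powr (n / 2)) * ?G) = \<Gamma> t * (ennreal (1 / t) * ennreal (t powr (n / 2))) * ?G"
        by (simp only: mult.assoc)
      also have "ennreal (1 / t) * ennreal (t powr (n / 2)) = ennreal (t powr (n / 2 - 1))"
        using True by (simp add: ennreal_mult'[symmetric] powr_diff)
      finally show ?thesis using True by simp
    qed simp
  qed
  also have "\<dots> = (\<integral>\<^sup>+t. \<Gamma> t * ennreal (t powr (n / 2 - 1)) * indicator {0<..} t \<partial>lborel) * ?G"
    by (rule nn_integral_multc) auto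
  finally show ?thesis unfolding n_def .
qed

text \<open>A cone takes the same share of every radial profile of \<open>q\<close>, and the
  Gaussian profile serves as the reference. In \<open>radial_aux\<close> the two one-dimensional
  factors do not depend on the set, so the equation for \<open>A\<close> is compared with the one
  for the whole space.\<close>

lemma radial_comparison:
  fixes q :: "('i \<Rightarrow> real) \<Rightarrow> real" and \<Gamma> :: "real \<Rightarrow> ennreal"
  assumes fin: "finite I" "I \<noteq> {}"
    and q: "q \<in> borel_measurable (lborelP I)"
    and qhom: "\<And>s x. s > 0 \<Longrightarrow> x \<in> space (lborelP I) \<Longrightarrow> q (\<lambda>i\<in>I. s * x i) = s\<^sup>2 * q x"
    and qpos: "AE x in lborelP I. q x > 0"
    and A: "A \<in> sets (lborelP I)"
    and cone: "\<And>s x. s > 0 \<Longrightarrow> x \<in> space (lborelP I) \<Longrightarrow> (\<lambda>i\<in>I. s * x i) \<in> A \<longleftrightarrow> x \<in> A"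
    and \<Gamma>: "\<Gamma> \<in> borel_measurable borel"
    and G: "(\<integral>\<^sup>+x. ennreal (exp (- q x)) \<partial>lborelP I) \<noteq> 0" "(\<integral>\<^sup>+x. ennreal (exp (- q x)) \<partial>lborelP I) \<noteq> \<infinity>"
  shows "(\<integral>\<^sup>+x. \<Gamma> (q x) * indicator A x \<partial>lborelP I) * (\<integral>\<^sup>+x. ennreal (exp (- q x)) \<partial>lborelP I) =
    (\<integral>\<^sup>+x. ennreal (exp (- q x)) * indicator A x \<partial>lborelP I) * (\<integral>\<^sup>+x. \<Gamma> (q x) \<partial>lborelP I)"
proof -
  let ?S = "space (lborelP I) :: ('i \<Rightarrow> real) set"
  let ?C = "\<integral>\<^sup>+u. ennreal (exp (- 1 / u) / u * u powr (- (card I / 2))) * indicator {0<..} u \<partial>lborel"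
  have S: "(\<integral>\<^sup>+x. f x * indicator ?S x \<partial>lborelP I) = (\<integral>\<^sup>+x. f x \<partial>lborelP I)" for f
    by (rule nn_integral_cong) simp
  have coneS: "(\<lambda>i\<in>I. s * x i) \<in> ?S \<longleftrightarrow> x \<in> ?S" if "x \<in> ?S" for s x
    using that by (auto simp: space_PiM)
  note aux = radial_aux[OF fin(1) q qhom qpos]
  have c: "card I > 0" using fin by (simp add: card_gt_0_iff)
  \<comment> \<open>The Gaussian profile on the whole space evaluates \<open>?C\<close>; it is
    finite and positive and can be cancelled at the end.\<close>
  have "?C * (\<integral>\<^sup>+x. ennreal (exp (- q x)) * indicator ?S x \<partial>lborelP I) =
      (\<integral>\<^sup>+t. ennreal (exp (- t)) * ennreal (t powr (card I / 2 - 1)) * indicator {0<..} t \<partial>lborel) *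
      (\<integral>\<^sup>+x. ennreal (exp (- q x)) * indicator ?S x \<partial>lborelP I)"
    by (rule aux) (use coneS in auto)
  also have "(\<integral>\<^sup>+t. ennreal (exp (- t)) * ennreal (t powr (card I / 2 - 1)) * indicator {0<..} t \<partial>lborel) = ennreal (Gamma (card I / 2))"
    using nn_integral_Gamma[of "card I / 2" 1] c by (simp add: ennreal_mult mult.commute)
  finally have C: "?C = ennreal (Gamma (card I / 2))"
    unfolding S using G by (simp add: ennreal_mult_cancel_left mult.commute[of _ "\<integral>\<^sup>+x. ennreal (exp (- q x)) \<partial>lborelP I"])
  have Gp: "Gamma (card I / 2) > 0" using c by (intro Gamma_real_pos) simp
  let ?FA = "\<integral>\<^sup>+x. \<Gamma> (q x) * indicator A x \<partial>lborelP I"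
  let ?FS = "\<integral>\<^sup>+x. \<Gamma> (q x) \<partial>lborelP I"
  let ?GA = "\<integral>\<^sup>+x. ennreal (exp (- q x)) * indicator A x \<partial>lborelP I"
  let ?GS = "\<integral>\<^sup>+x. ennreal (exp (- q x)) \<partial>lborelP I"
  let ?K = "\<integral>\<^sup>+t. \<Gamma> t * ennreal (t powr (card I / 2 - 1)) * indicator {0<..} t \<partial>lborel"
  have 1: "?C * ?FA = ?K * ?GA" by (rule aux[OF _ _ A cone \<Gamma>])
  have 2: "?C * ?FS = ?K * ?GS"
    using aux[of ?S \<Gamma>, unfolded S] coneS \<Gamma> by blast
  have "?C * (?FA * ?GS) = ?K * ?GA * ?GS" unfolding 1[symmetric] by (simp only: mult.assoc)
  also have "\<dots> = ?GA * (?K * ?GS)" by (simp only: mult_ac)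
  also have "\<dots> = ?C * (?GA * ?FS)" unfolding 2[symmetric] by (simp only: mult_ac)
  finally show ?thesis unfolding C using Gp by (simp add: ennreal_mult_cancel_left)
qed

text \<open>Barycentric weights of total mass zero: \<open>l\<close> lists the weights at \<open>1, \<dots>, d\<close>, and the
  weight at \<open>0\<close> compensates.\<close>

definition bary :: "nat \<Rightarrow> (nat \<Rightarrow> real) \<Rightarrow> nat \<Rightarrow> real" where
  "bary d l i = (if i = 0 then - (\<Sum>j=1..d. l j) else l i)"

definition comb :: "nat \<Rightarrow> (nat \<Rightarrow> real) \<Rightarrow> (nat \<Rightarrow> 'a::real_vector) \<Rightarrow> 'a" where
  "comb d l X = (\<Sum>i\<le>d. bary d l i *\<^sub>R X i)"

definition qform :: "nat \<Rightarrow> (nat \<Rightarrow> real) \<Rightarrow> (nat \<Rightarrow> real) \<Rightarrow> real" where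
  "qform d m l = (\<Sum>i\<le>d. (bary d l i)\<^sup>2 / m i)"

lemma sum_atMost_split_0: "(\<Sum>i\<le>d. f i) = f 0 + (\<Sum>i=1..d. f i :: 'a::comm_monoid_add)" for d :: nat
proof -
  have "{..d} = insert 0 {1..d}" by auto
  then show ?thesis by simp
qed

lemma comb_eq: "comb d l X = (\<Sum>i=1..d. l i *\<^sub>R (X i - X 0))"
  unfolding comb_def sum_atMost_split_0
  by (simp add: bary_def scaleR_diff_right sum_subtractf scaleR_sum_left)

lemma qform_eq: "qform d m l = (\<Sum>i=1..d. l i)\<^sup>2 / m 0 + (\<Sum>i=1..d. (l i)\<^sup>2 / m i)"
  unfolding qform_def sum_atMost_split_0 by (simp add: bary_def)

lemma bary_restrict [simp]: "i \<le> d \<Longrightarrow> bary d (restrict l {1..d}) i = bary d l i"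
  by (auto simp: bary_def)

lemma bary_diff: "bary d (\<lambda>i. l i - l' i) i = bary d l i - bary d l' i"
  by (simp add: bary_def sum_subtractf)

lemma bary_scale: "bary d (\<lambda>i. s * l i) i = s * bary d l i"
  by (simp add: bary_def sum_distrib_left)

lemma sum_bary: "(\<Sum>i\<le>d. bary d l i) = 0"
  unfolding sum_atMost_split_0 by (simp add: bary_def)

text \<open>In general position, with \<open>d\<close> the dimension of the space, this is pi^(d/2)
  divided by the absolute determinant of the edge vectors \<open>X i - X 0\<close>. Kept as an
  integral, it normalizes the Gaussian measure in the coordinates \<open>l\<close>.\<close>

definition total_mass :: "nat \<Rightarrow> (nat \<Rightarrow> 'a::euclidean_space) \<Rightarrow> ennreal" where
  "total_mass d X = (\<integral>\<^sup>+l. ennreal (exp (- (norm (comb d l X))\<^sup>2)) \<partial>lborelP {1..d})"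

lemma comb_measurable [measurable]:
  "(\<lambda>(l, X). comb d l X) \<in> borel_measurable (lborelP {1..d} \<Otimes>\<^sub>M (lborelP {..d} :: (nat \<Rightarrow> 'a::euclidean_space) measure))"
  unfolding comb_eq[abs_def] by measurable

lemma qform_hom: "qform d m (\<lambda>i\<in>{1..d}. s * l i) = s\<^sup>2 * qform d m l"
  unfolding qform_def by (simp add: bary_scale power_mult_distrib sum_distrib_left)

lemma comb_restrict [simp]: "comb d (restrict l {1..d}) X = comb d l X"
  unfolding comb_def by simp

lemma comb_scale: "comb d (\<lambda>i. s * l i) X = s *\<^sub>R comb d l X"
  unfolding comb_def by (simp add: bary_scale scaleR_sum_right)

lemma qform_pos:
  assumes "l i \<noteq> 0" "i \<in> {1..d}" "\<And>i. i \<le> d \<Longrightarrow> m i > 0"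
  shows "qform d m l > 0"
proof -
  have "0 < (bary d l i)\<^sup>2 / m i" using assms by (auto simp: bary_def)
  then show ?thesis
    unfolding qform_def using assms by (intro sum_pos2[of _ i]) (auto intro!: divide_nonneg_pos)
qed

lemma qform_measurable [measurable]: "qform d m \<in> borel_measurable (lborelP {1..d})"
  unfolding qform_eq[abs_def] by measurable

text \<open>Integrated over \<open>l\<close> in a cone, this is the Gaussian weight of the vertices
  times the normalized cone mass. Integrated over \<open>X\<close>, it is a function of
  \<open>l\<close> that turns out to depend on \<open>qform d m l\<close> alone.\<close>

definition angle_kernel :: "nat \<Rightarrow> (nat \<Rightarrow> real) \<Rightarrow> (nat \<Rightarrow> real) \<Rightarrow> (nat \<Rightarrow> 'a::euclidean_space) \<Rightarrow> ennreal" where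
  "angle_kernel d m l X = ennreal (exp (- (\<Sum>i\<le>d. m i * (norm (X i))\<^sup>2))) * inverse (total_mass d X) *
     ennreal (exp (- (norm (comb d l X))\<^sup>2))"

lemma comb_measurable1 [measurable]:
  fixes X :: "nat \<Rightarrow> 'a::euclidean_space"
  shows "(\<lambda>l. comb d l X) \<in> borel_measurable (lborelP {1..d})"
  unfolding comb_eq by measurable

lemma total_mass_measurable [measurable]:
  "total_mass d \<in> borel_measurable (lborelP {..d} :: (nat \<Rightarrow> 'a::euclidean_space) measure)"
proof -
  interpret sigma_finite_measure "lborelP {1..d} :: (nat \<Rightarrow> real) measure" by simp
  have "(\<lambda>(X, l). ennreal (exp (- (norm (comb d l X))\<^sup>2))) \<in>
      borel_measurable ((lborelP {..d} :: (nat \<Rightarrow> 'a) measure) \<Otimes>\<^sub>M lborelP {1..d})"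
    unfolding comb_eq by measurable
  then show ?thesis unfolding total_mass_def[abs_def] by (rule borel_measurable_nn_integral)
qed

lemma angle_kernel_measurable [measurable]:
  "(\<lambda>(l, X). angle_kernel d m l X) \<in> borel_measurable (lborelP {1..d} \<Otimes>\<^sub>M (lborelP {..d} :: (nat \<Rightarrow> 'a::euclidean_space) measure))"
proof -
  note comb_measurable [measurable del] comb_measurable1 [measurable del]
  have [measurable]: "(\<lambda>x. total_mass d (snd x)) \<in> borel_measurable (lborelP {1..d} \<Otimes>\<^sub>M (lborelP {..d} :: (nat \<Rightarrow> 'a) measure))"
    by (rule measurable_compose[OF measurable_snd total_mass_measurable])
  have [measurable]: "(\<lambda>x. comb d (fst x) (snd x)) \<in> borel_measurable (lborelP {1..d} \<Otimes>\<^sub>M (lborelP {..d} :: (nat \<Rightarrow> 'a) measure))"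
    using comb_measurable[of d] by (simp add: split_beta')
  show ?thesis
    unfolding angle_kernel_def split_beta' by measurable
qed

text \<open>The reflection that exchanges \<open>l\<close> and \<open>l'\<close> with respect to the form \<open>qform d m\<close> has a
  dual reflection on the vertices, which preserves the remaining factors.\<close>

lemma angle_kernel_rotation_invariant:
  fixes l l' m :: "nat \<Rightarrow> real"
  assumes m: "\<And>i. i \<le> d \<Longrightarrow> m i > 0"
    and l: "l \<in> space (lborelP {1..d})" "l' \<in> space (lborelP {1..d})"
    and eq: "qform d m l = qform d m l'"
  shows "(\<integral>\<^sup>+X. angle_kernel d m l X \<partial>(lborelP {..d} :: (nat \<Rightarrow> 'a::euclidean_space) measure)) =
    (\<integral>\<^sup>+X. angle_kernel d m l' X \<partial>(lborelP {..d} :: (nat \<Rightarrow> 'a) measure))"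
proof (cases "l = l'")
  case False
  define e where "e = (\<lambda>i. l i - l' i)"
  obtain i where i: "i \<in> {1..d}" "e i \<noteq> 0"
    using False l PiE_ext[of l "{1..d}" "\<lambda>_. UNIV" l'] unfolding e_def by (auto simp: space_PiM)
  \<comment> \<open>The usual reflection formula for \<open>qform d m\<close> in the direction
    \<open>e\<close>: below, \<open>c z\<close> is 2 <z, e> / Q for the associated bilinear form,
    \<open>R\<close> sends z to z - c(z) e, and \<open>T\<close>, built from \<open>a\<close> and
    \<open>b\<close>, acts on the vertices.\<close>
  define Q where "Q = qform d m e"
  have Q: "Q > 0" unfolding Q_def using i m by (intro qform_pos[of e i]) auto
  define b where "b = bary d e"
  define a where "a = (\<lambda>i. 2 * b i / (m i * Q))"
  have Qb: "Q = (\<Sum>i\<le>d. (b i)\<^sup>2 / m i)" unfolding Q_def qform_def b_def ..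
  have ab: "(\<Sum>i\<le>d. a i * b i) = 2"
  proof -
    have "(\<Sum>i\<le>d. a i * b i) = (\<Sum>i\<le>d. 2 / Q * ((b i)\<^sup>2 / m i))"
      by (simp add: a_def power2_eq_square mult_ac)
    also have "\<dots> = 2 / Q * Q" unfolding Qb sum_distrib_left ..
    finally show ?thesis using Q by simp
  qed
  define c where "c = (\<lambda>z. \<Sum>i\<le>d. bary d z i * a i)"
  have c_eq: "c z = (\<Sum>i=1..d. (a i - a 0) * z i)" for z
    unfolding c_def sum_atMost_split_0
    by (simp add: bary_def left_diff_distrib right_diff_distrib sum_subtractf sum_distrib_left mult_ac)
  have ab': "(\<Sum>i=1..d. e i * (a i - a 0)) = 2"
    using ab c_eq[of e] unfolding c_def b_def by (simp add: mult.commute)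
  define T :: "(nat \<Rightarrow> 'a) \<Rightarrow> nat \<Rightarrow> 'a" where "T = (\<lambda>X. \<lambda>i\<in>{..d}. X i - a i *\<^sub>R (\<Sum>j\<le>d. b j *\<^sub>R X j))"
  define R where "R = (\<lambda>z :: nat \<Rightarrow> real. \<lambda>i\<in>{1..d}. z i - e i *\<^sub>R (\<Sum>j=1..d. (a j - a 0) *\<^sub>R z j))"
  have baryR: "bary d (R z) i = bary d z i - c z * b i" if "i \<le> d" for z i
  proof -
    have "R z = (\<lambda>i\<in>{1..d}. z i - c z * e i)" unfolding R_def c_eq by (simp add: mult.commute)
    then show ?thesis using that by (simp add: bary_diff bary_scale b_def)
  qed
  \<comment> \<open>\<open>T\<close> on the vertices and \<open>R\<close> on the weights are adjoint
    to each other; the sum of the barycentric weights of \<open>e\<close> being 0 is built into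
    \<open>b\<close>.\<close>
  have combT: "comb d z (T X) = comb d (R z) X" for z X
  proof -
    have "comb d z (T X) = (\<Sum>i\<le>d. bary d z i *\<^sub>R X i) - c z *\<^sub>R (\<Sum>j\<le>d. b j *\<^sub>R X j)"
      unfolding comb_def T_def by (simp add: scaleR_diff_right sum_subtractf c_def scaleR_sum_left)
    also have "\<dots> = comb d (R z) X"
      unfolding comb_def by (simp add: baryR scaleR_diff_left sum_subtractf scaleR_sum_right)
    finally show ?thesis .
  qed
  \<comment> \<open>Equal values of the form give Q = 2 <l, e>, hence c l = 1, and
    \<open>R l\<close> = l - e = l'.\<close>
  have Rl: "R l = l'"
  proof -
    have "Q = qform d m l - 2 * (\<Sum>i\<le>d. bary d l i * bary d l' i / m i) + qform d m l'"
      unfolding Q_def qform_def e_def bary_diff power2_diff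
      by (simp add: sum.distrib sum_subtractf diff_divide_distrib add_divide_distrib sum_distrib_left mult.assoc)
    also have "\<dots> = 2 * (qform d m l - (\<Sum>i\<le>d. bary d l i * bary d l' i / m i))" using eq by simp
    also have "\<dots> = 2 * (\<Sum>i\<le>d. bary d l i * b i / m i)"
      unfolding qform_def b_def e_def bary_diff
      by (simp add: sum_subtractf[symmetric] power2_eq_square right_diff_distrib diff_divide_distrib)
    also have "\<dots> = Q * c l"
      unfolding c_def a_def sum_distrib_left using Q by (intro sum.cong) (auto simp: field_simps)
    finally have "c l = 1" using Q by simp
    then have "R l = (\<lambda>i\<in>{1..d}. l' i)" unfolding R_def using c_eq[of l] by (auto simp: fun_eq_iff e_def)
    also have "\<dots> = l'" using l by (auto simp: space_PiM PiE_def extensional_def fun_eq_iff)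
    finally show ?thesis .
  qed
  have normT: "(\<Sum>i\<le>d. m i * (norm (T X i))\<^sup>2) = (\<Sum>i\<le>d. m i * (norm (X i))\<^sup>2)" for X
  proof -
    define D where "D = (\<Sum>j\<le>d. b j *\<^sub>R X j)"
    have "(\<Sum>i\<le>d. m i * (norm (T X i))\<^sup>2) = (\<Sum>i\<le>d. m i * (norm (X i))\<^sup>2 - 4 / Q * (b i *\<^sub>R X i \<bullet> D) + 4 / Q\<^sup>2 * (D \<bullet> D) * ((b i)\<^sup>2 / m i))"
    proof (intro sum.cong refl)
      fix i assume "i \<in> {..d}"
      then have mi: "m i > 0" using m by simp
      have "m i * (norm (T X i))\<^sup>2 = m i * ((X i - a i *\<^sub>R D) \<bullet> (X i - a i *\<^sub>R D))"
        using \<open>i \<in> {..d}\<close> by (simp add: T_def D_def power2_norm_eq_inner)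
      also have "\<dots> = m i * (norm (X i))\<^sup>2 - 2 * (m i * a i) * (X i \<bullet> D) + m i * (a i)\<^sup>2 * (D \<bullet> D)"
        unfolding power2_norm_eq_inner
        by (simp add: inner_diff_left inner_diff_right inner_commute algebra_simps power2_eq_square)
      also have "m i * a i = 2 / Q * b i" using mi by (simp add: a_def)
      also have "m i * (a i)\<^sup>2 = 4 / Q\<^sup>2 * ((b i)\<^sup>2 / m i)" using mi by (simp add: a_def power2_eq_square)
      finally show "m i * (norm (T X i))\<^sup>2 = m i * (norm (X i))\<^sup>2 - 4 / Q * (b i *\<^sub>R X i \<bullet> D) + 4 / Q\<^sup>2 * (D \<bullet> D) * ((b i)\<^sup>2 / m i)"
        by (simp add: mult_ac)
    qed
    also have "\<dots> = (\<Sum>i\<le>d. m i * (norm (X i))\<^sup>2) - 4 / Q * (D \<bullet> D) + 4 / Q\<^sup>2 * (D \<bullet> D) * Q"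
      unfolding sum.distrib sum_subtractf sum_distrib_left[symmetric] inner_sum_left[symmetric] D_def[symmetric] Qb[symmetric] ..
    finally show ?thesis using Q by (simp add: power2_eq_square)
  qed
  \<comment> \<open>By \<open>combT\<close> the reflection of the vertices becomes one of the
    integration variable.\<close>
  have tmT: "total_mass d (T X) = total_mass d X" for X
  proof -
    have "total_mass d (T X) = (\<integral>\<^sup>+z. ennreal (exp (- (norm (comb d (R z) X))\<^sup>2)) \<partial>lborelP {1..d})"
      unfolding total_mass_def combT ..
    also have "\<dots> = total_mass d X"
      unfolding total_mass_def R_def by (rule nn_integral_lborelP_reflection[OF _ _ ab']) (simp, measurable)
    finally show ?thesis .
  qed
  have meas: "(\<lambda>X :: nat \<Rightarrow> 'a. angle_kernel d m l X) \<in> borel_measurable (lborelP {..d})"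
    using measurable_compose[OF measurable_Pair1'[OF l(1)] angle_kernel_measurable] by simp
  have "(\<integral>\<^sup>+X. angle_kernel d m l X \<partial>(lborelP {..d} :: (nat \<Rightarrow> 'a) measure)) = (\<integral>\<^sup>+X. angle_kernel d m l (T X) \<partial>lborelP {..d})"
    unfolding T_def by (rule nn_integral_lborelP_reflection[OF _ meas ab, symmetric]) simp
  also have "\<dots> = (\<integral>\<^sup>+X. angle_kernel d m l' X \<partial>(lborelP {..d} :: (nat \<Rightarrow> 'a) measure))"
    unfolding angle_kernel_def normT tmT combT Rl ..
  finally show ?thesis .
qed simp

text \<open>By the reflection invariance the integral over \<open>X\<close> is a radial profile of
  \<open>qform d m\<close>, although no formula for this profile is available;
  \<open>radial_comparison\<close> applies to arbitrary profiles.\<close>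

lemma gaussian_simplex_angle:
  fixes m :: "nat \<Rightarrow> real"
  assumes m: "\<And>i. i \<le> d \<Longrightarrow> m i > 0" and d: "d > 0"
    and A: "A \<in> sets (lborelP {1..d})"
    and cone: "\<And>s x. s > 0 \<Longrightarrow> x \<in> space (lborelP {1..d}) \<Longrightarrow> (\<lambda>i\<in>{1..d}. s * x i) \<in> A \<longleftrightarrow> x \<in> A"
    and G: "(\<integral>\<^sup>+l. ennreal (exp (- qform d m l)) \<partial>lborelP {1..d}) \<noteq> 0" "(\<integral>\<^sup>+l. ennreal (exp (- qform d m l)) \<partial>lborelP {1..d}) \<noteq> \<infinity>"
  shows "(\<integral>\<^sup>+l. (\<integral>\<^sup>+X. angle_kernel d m l X \<partial>(lborelP {..d} :: (nat \<Rightarrow> 'a::euclidean_space) measure)) * indicator A l \<partial>lborelP {1..d}) *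
      (\<integral>\<^sup>+l. ennreal (exp (- qform d m l)) \<partial>lborelP {1..d}) =
    (\<integral>\<^sup>+l. ennreal (exp (- qform d m l)) * indicator A l \<partial>lborelP {1..d}) *
      (\<integral>\<^sup>+l. (\<integral>\<^sup>+X. angle_kernel d m l X \<partial>(lborelP {..d} :: (nat \<Rightarrow> 'a) measure)) \<partial>lborelP {1..d})"
proof -
  interpret sigma_finite_measure "lborelP {..d} :: (nat \<Rightarrow> 'a) measure" by simp
  define g where "g = (\<lambda>l. \<integral>\<^sup>+X. angle_kernel d m l X \<partial>(lborelP {..d} :: (nat \<Rightarrow> 'a) measure))"
  have g [measurable]: "g \<in> borel_measurable (lborelP {1..d})"
    unfolding g_def by (rule borel_measurable_nn_integral) (rule angle_kernel_measurable)
  \<comment> \<open>Any nonzero vector would do. \<open>ray t\<close> is its multiple at which the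
    form takes the value t, so \<open>\<lambda>t. g (ray t)\<close> is the wanted profile.\<close>
  define l1 :: "nat \<Rightarrow> real" where "l1 = (\<lambda>i\<in>{1..d}. if i = 1 then 1 else 0)"
  have q1: "qform d m l1 > 0" using d m by (intro qform_pos[of _ 1]) (auto simp: l1_def)
  define ray where "ray = (\<lambda>t. \<lambda>i\<in>{1..d}. sqrt (t / qform d m l1) * l1 i)"
  have ray_meas: "ray \<in> borel \<rightarrow>\<^sub>M lborelP {1..d}" unfolding ray_def by measurable
  have qray: "qform d m (ray t) = t" if "t \<ge> 0" for t
    unfolding ray_def qform_hom using q1 that by simp
  have pos: "AE l in lborelP {1..d}. qform d m l > 0"
    using AE_lborelP_component[of "{1..d}" 1, where 'a=real] d m by (auto elim!: eventually_mono intro!: qform_pos[of _ 1])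
  have gray: "g l = g (ray (qform d m l))" if "l \<in> space (lborelP {1..d})" for l
    unfolding g_def
  proof (rule angle_kernel_rotation_invariant[OF m that])
    have "0 \<le> qform d m l" unfolding qform_def using m by (intro sum_nonneg divide_nonneg_pos) auto
    then show "qform d m l = qform d m (ray (qform d m l))" by (simp add: qray)
  qed (auto simp: ray_def space_PiM)
  have "(\<integral>\<^sup>+l. g (ray (qform d m l)) * indicator A l \<partial>lborelP {1..d}) * (\<integral>\<^sup>+l. ennreal (exp (- qform d m l)) \<partial>lborelP {1..d}) =
    (\<integral>\<^sup>+l. ennreal (exp (- qform d m l)) * indicator A l \<partial>lborelP {1..d}) * (\<integral>\<^sup>+l. g (ray (qform d m l)) \<partial>lborelP {1..d})"
  proof (rule radial_comparison)
    show "(\<lambda>t. g (ray t)) \<in> borel_measurable borel" by (rule measurable_compose[OF ray_meas g])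
    show "{1..d} \<noteq> {}" using d by simp
  qed (use A cone pos G qform_hom in auto)
  also have "(\<integral>\<^sup>+l. g (ray (qform d m l)) * indicator A l \<partial>lborelP {1..d}) = (\<integral>\<^sup>+l. g l * indicator A l \<partial>lborelP {1..d})"
    by (rule nn_integral_cong) (simp add: gray)
  also have "(\<integral>\<^sup>+l. g (ray (qform d m l)) \<partial>lborelP {1..d}) = (\<integral>\<^sup>+l. g l \<partial>lborelP {1..d})"
    by (rule nn_integral_cong) (simp add: gray)
  finally show ?thesis unfolding g_def .
qed

section \<open>Internal angles of simplices in general position\<close>

lemma nn_integral_gaussian_euclidean:
  assumes "c > 0"
  shows "(\<integral>\<^sup>+x. ennreal (exp (- c * (norm x)\<^sup>2)) \<partial>(lborel :: 'a::euclidean_space measure)) = ennreal (sqrt (pi / c) ^ DIM('a))"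
proof -
  have "(\<integral>\<^sup>+x. ennreal (exp (- c * (norm x)\<^sup>2)) \<partial>(lborel :: 'a measure)) =
      (\<integral>\<^sup>+x. (\<Prod>b\<in>Basis. ennreal (exp (- c * (x \<bullet> b)\<^sup>2))) \<partial>(lborel :: 'a measure))"
  proof (rule nn_integral_cong)
    fix x :: 'a
    have "(norm x)\<^sup>2 = (\<Sum>b\<in>Basis. (x \<bullet> b)\<^sup>2)"
      unfolding power2_norm_eq_inner by (subst euclidean_inner) (simp add: power2_eq_square)
    then show "ennreal (exp (- c * (norm x)\<^sup>2)) = (\<Prod>b\<in>Basis. ennreal (exp (- c * (x \<bullet> b)\<^sup>2)))"
      by (simp add: sum_distrib_left exp_sum prod_ennreal sum_negf[symmetric])
  qed
  also have "\<dots> = (\<Prod>b\<in>(Basis :: 'a set). (\<integral>\<^sup>+y. ennreal (exp (- c * y\<^sup>2)) \<partial>lborel))"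
    by (rule nn_integral_lborel_prod) auto
  also have "\<dots> = ennreal (sqrt (pi / c) ^ DIM('a))"
    using nn_integral_gaussian[OF assms, of 0] assms by (simp add: ennreal_power)
  finally show ?thesis .
qed

section \<open>General position holds almost surely\<close>

lemma span_image_finite:
  fixes Z :: "'i \<Rightarrow> 'a::real_vector"
  assumes "finite J" "x \<in> span (Z ` J)"
  shows "\<exists>c. x = (\<Sum>j\<in>J. c j *\<^sub>R Z j)"
  using assms
proof (induction J arbitrary: x rule: finite_induct)
  case (insert j J)
  then obtain k where "x - k *\<^sub>R Z j \<in> span (Z ` J)" by (auto simp: span_breakdown_eq)
  then obtain c where c: "x - k *\<^sub>R Z j = (\<Sum>j\<in>J. c j *\<^sub>R Z j)" using insert.IH by blast
  have "x = (\<Sum>i\<in>insert j J. (c(j := k)) i *\<^sub>R Z i)"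
  proof -
    have "(\<Sum>i\<in>J. (c(j := k)) i *\<^sub>R Z i) = (\<Sum>j\<in>J. c j *\<^sub>R Z j)"
      using insert.hyps by (intro sum.cong) auto
    then show ?thesis using insert.hyps c by (simp add: algebra_simps)
  qed
  then show ?case by blast
qed auto

text \<open>Serves measurability: membership of one random vector in the span of others becomes a
  countable combination of open conditions. The converse holds because subspaces are closed.\<close>

lemma in_span_image_iff_approx:
  fixes Z :: "'i \<Rightarrow> 'a::euclidean_space"
  assumes fin: "finite J"
  shows "x \<in> span (Z ` J) \<longleftrightarrow> (\<forall>n::nat. \<exists>q\<in>PiE J (\<lambda>_. \<rat>). norm (x - (\<Sum>j\<in>J. q j *\<^sub>R Z j)) < 1 / (real n + 1))"
proof
  assume "x \<in> span (Z ` J)"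
  then obtain c where c: "x = (\<Sum>j\<in>J. c j *\<^sub>R Z j)" using span_image_finite[OF fin] by blast
  show "\<forall>n::nat. \<exists>q\<in>PiE J (\<lambda>_. \<rat>). norm (x - (\<Sum>j\<in>J. q j *\<^sub>R Z j)) < 1 / (real n + 1)"
  proof
    fix n :: nat
    \<comment> \<open>The summand 1 keeps \<open>S\<close> positive and makes the final estimate
      strict.\<close>
    define S where "S = 1 + (\<Sum>j\<in>J. norm (Z j))"
    have S: "S > 0" unfolding S_def by (intro add_pos_nonneg sum_nonneg) auto
    define e where "e = 1 / ((real n + 1) * S)"
    have e: "e > 0" using S unfolding e_def by simp
    have "\<exists>r. r \<in> \<rat> \<and> \<bar>c j - r\<bar> < e" for j
    proof -
      obtain r where "r \<in> \<rat>" "c j - e < r" "r < c j + e"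
        using Rats_dense_in_real[of "c j - e" "c j + e"] e by auto
      then show ?thesis by (intro exI[of _ r]) auto
    qed
    then obtain r where r: "\<And>j. r j \<in> \<rat>" "\<And>j. \<bar>c j - r j\<bar> < e" by metis
    have "norm (x - (\<Sum>j\<in>J. restrict r J j *\<^sub>R Z j)) = norm (\<Sum>j\<in>J. (c j - r j) *\<^sub>R Z j)"
      unfolding c by (simp add: scaleR_diff_left sum_subtractf)
    also have "\<dots> \<le> (\<Sum>j\<in>J. e * norm (Z j))"
      by (rule order.trans[OF norm_sum]) (auto intro!: sum_mono mult_right_mono less_imp_le[OF r(2)])
    also have "\<dots> = e * (S - 1)" unfolding S_def by (simp add: sum_distrib_left)
    also have "\<dots> < e * S" using e by simp
    also have "\<dots> = 1 / (real n + 1)" using S by (simp add: e_def)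
    finally show "\<exists>q\<in>PiE J (\<lambda>_. \<rat>). norm (x - (\<Sum>j\<in>J. q j *\<^sub>R Z j)) < 1 / (real n + 1)"
      using r(1) by (intro bexI[of _ "restrict r J"]) auto
  qed
next
  assume *: "\<forall>n::nat. \<exists>q\<in>PiE J (\<lambda>_. \<rat>). norm (x - (\<Sum>j\<in>J. q j *\<^sub>R Z j)) < 1 / (real n + 1)"
  have "x \<in> closure (span (Z ` J))"
    unfolding closure_approachable
  proof (intro allI impI)
    fix e :: real assume "e > 0"
    then obtain n where n: "1 / (real n + 1) < e" using nat_approx_posE[of e] by (auto simp: add.commute)
    obtain q where "norm (x - (\<Sum>j\<in>J. q j *\<^sub>R Z j)) < 1 / (real n + 1)" using * by blast
    then have "dist (\<Sum>j\<in>J. q j *\<^sub>R Z j) x < e" using n by (simp add: dist_norm norm_minus_commute)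
    moreover have "(\<Sum>j\<in>J. q j *\<^sub>R Z j) \<in> span (Z ` J)" by (intro span_sum span_scale span_base) auto
    ultimately show "\<exists>y\<in>span (Z ` J). dist y x < e" by blast
  qed
  then show "x \<in> span (Z ` J)" by (simp add: closed_subspace closure_closed)
qed

text \<open>Linear independence of the edge vectors, stated successively so that the i-th condition
  excludes, for given earlier vertices, a null set for \<open>X i\<close> alone.\<close>

definition general_position :: "nat \<Rightarrow> (nat \<Rightarrow> 'a::real_vector) \<Rightarrow> bool" where
  "general_position d X \<longleftrightarrow> (\<forall>i\<in>{1..d}. X i - X 0 \<notin> span ((\<lambda>j. X j - X 0) ` {1..<i}))"

text \<open>Fubini with \<open>X i\<close> integrated first: for fixed other vertices the excluded
  positions lie in a translate of a span of at most i - 1 vectors, a proper closed subspace.\<close>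

lemma AE_general_position:
  "AE X in (lborelP {..DIM('a)} :: (nat \<Rightarrow> 'a::euclidean_space) measure). general_position DIM('a) X"
proof -
  let ?M = "lborelP {..DIM('a)} :: (nat \<Rightarrow> 'a) measure"
  have "AE X in ?M. X i - X 0 \<notin> span ((\<lambda>j. X j - X 0) ` {1..<i})" if i: "i \<in> {1..DIM('a)}" for i
  proof -
    define B where "B = {X \<in> space ?M. X i - X 0 \<in> span ((\<lambda>j. X j - X 0) ` {1..<i})}"
    have cnt: "countable (PiE {1..<i} (\<lambda>_. \<rat> :: real set))"
      by (intro countable_PiE countable_rat) auto
    have B: "B \<in> sets ?M"
    proof -
      have comp: "(\<lambda>X :: nat \<Rightarrow> 'a. X j) \<in> borel_measurable ?M" if "j \<le> i" for j
        using measurable_component_singleton[of j "{..DIM('a)}" "\<lambda>_. lborel :: 'a measure"] that i by simp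
      let ?P = "\<lambda>n q X. norm (X i - X 0 - (\<Sum>j\<in>{1..<i}. q j *\<^sub>R (X j - X 0))) < 1 / (real n + 1)"
      have P: "{X \<in> space ?M. ?P n q X} \<in> sets ?M" for n q
      proof -
        have "(\<lambda>X :: nat \<Rightarrow> 'a. X i - X 0 - (\<Sum>j\<in>{1..<i}. q j *\<^sub>R (X j - X 0))) \<in> borel_measurable ?M"
          by (intro borel_measurable_diff borel_measurable_sum borel_measurable_scaleR borel_measurable_const comp) auto
        from measurable_compose[OF this borel_measurable_norm] show ?thesis
          unfolding pred_def[symmetric] by (intro borel_measurable_pred_less borel_measurable_const)
      qed
      have "B = (\<Inter>n. \<Union>q\<in>PiE {1..<i} (\<lambda>_. \<rat>). {X \<in> space ?M. ?P n q X})"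
        unfolding B_def in_span_image_iff_approx[OF finite_atLeastLessThan] by auto
      also have "\<dots> \<in> sets ?M"
      proof (rule sets.countable_INT)
        have "(\<Union>q\<in>PiE {1..<i} (\<lambda>_. \<rat>). {X \<in> space ?M. ?P n q X}) \<in> sets ?M" for n
          using P by (intro sets.countable_UN'[OF cnt]) blast
        then show "range (\<lambda>n. \<Union>q\<in>PiE {1..<i} (\<lambda>_. \<rat>). {X \<in> space ?M. ?P n q X}) \<subseteq> sets ?M"
          by blast
      qed simp
      finally show ?thesis .
    qed
    define J where "J = {..DIM('a)} - {i}"
    have J: "finite J" "i \<notin> J" and ins: "insert i J = {..DIM('a)}" using i by (auto simp: J_def)
    have "emeasure ?M B = (\<integral>\<^sup>+X. indicator B X \<partial>?M)" using B by simp
    also have "\<dots> = (\<integral>\<^sup>+X. \<integral>\<^sup>+y. indicator B (X(i := y)) \<partial>lborel \<partial>lborelP J)"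
      using lborel_prod.product_nn_integral_insert[OF J, of "indicator B"] B unfolding ins by simp
    also have "\<dots> = (\<integral>\<^sup>+X. 0 \<partial>(lborelP J :: (nat \<Rightarrow> 'a) measure))"
    proof (rule nn_integral_cong)
      fix X :: "nat \<Rightarrow> 'a" assume X: "X \<in> space (lborelP J)"
      define S where "S = span ((\<lambda>j. X j - X 0) ` {1..<i})"
      have im: "(\<lambda>j. (X(i := y)) j - (X(i := y)) 0) ` {1..<i} = (\<lambda>j. X j - X 0) ` {1..<i}" for y
        using i by (intro image_cong) auto
      have "dim S \<le> card ((\<lambda>j. X j - X 0) ` {1..<i})" unfolding S_def dim_span by (intro dim_le_card') auto
      also have "\<dots> \<le> card {1..<i}" by (rule card_image_le) simp
      also have "\<dots> < DIM('a)" using i by auto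
      finally have "negligible ((+) (X 0) ` S)" by (intro negligible_translation negligible_lowdim)
      moreover have "closed ((+) (X 0) ` S)" unfolding S_def by (intro closed_translation closed_subspace subspace_span)
      ultimately have "emeasure lborel ((+) (X 0) ` S) = 0"
        by (simp add: negligible_iff_null_sets null_sets_completion_iff borel_closed null_setsD1)
      have "(\<integral>\<^sup>+y. indicator B (X(i := y)) \<partial>lborel) \<le> (\<integral>\<^sup>+y. indicator ((+) (X 0) ` S) y \<partial>lborel)"
      proof (rule nn_integral_mono)
        fix y :: 'a
        have "y \<in> (+) (X 0) ` S" if "X(i := y) \<in> B"
        proof -
          have "(X(i := y)) i - (X(i := y)) 0 \<in> span ((\<lambda>j. (X(i := y)) j - (X(i := y)) 0) ` {1..<i})"
            using that unfolding B_def by blast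
          then have "y - X 0 \<in> S" using i unfolding im S_def by simp
          then show ?thesis by (intro image_eqI[of _ _ "y - X 0"]) auto
        qed
        then show "indicator B (X(i := y)) \<le> (indicator ((+) (X 0) ` S) y :: ennreal)" by (auto simp: indicator_def)
      qed
      also have "\<dots> = 0" using \<open>emeasure lborel _ = 0\<close> \<open>closed _\<close> by (subst nn_integral_indicator) (auto intro: borel_closed)
      finally show "(\<integral>\<^sup>+y. indicator B (X(i := y)) \<partial>lborel) = 0" by simp
    qed
    finally have "emeasure ?M B = 0" by simp
    then show ?thesis using B by (intro AE_I[of _ _ B]) (auto simp: B_def)
  qed
  then show ?thesis unfolding general_position_def by (subst AE_ball_countable) auto
qed

section \<open>Barycentric coordinates and the tangent cone at a face\<close>

lemma general_position_basis:
  fixes X :: "nat \<Rightarrow> 'a::euclidean_space"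
  assumes "general_position DIM('a) X"
  shows "comb DIM('a) l X = 0 \<Longrightarrow> i \<in> {1..DIM('a)} \<Longrightarrow> l i = 0" "\<exists>l. comb DIM('a) l X = v"
proof -
  define Z where "Z = (\<lambda>j. X j - X 0)"
  have "inj_on Z {1..j} \<and> independent (Z ` {1..j})" if "j \<le> DIM('a)" for j
    using that
  proof (induction j)
    case (Suc j)
    have "Z (Suc j) \<notin> span (Z ` {1..<Suc j})"
      using assms Suc.prems unfolding general_position_def Z_def by auto
    moreover have "{1..<Suc j} = {1..j}" "{1..Suc j} = insert (Suc j) {1..j}" by auto
    ultimately show ?case using Suc span_base[of "Z (Suc j)" "Z ` {1..j}"]
      by (auto simp: independent_insert inj_on_insert)
  qed (auto simp: One_nat_def independent_empty)
  then have inj: "inj_on Z {1..DIM('a)}" and ind: "independent (Z ` {1..DIM('a)})" by auto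
  have comb: "comb DIM('a) l X = (\<Sum>i=1..DIM('a). l i *\<^sub>R Z i)" for l unfolding comb_eq Z_def ..
  show "l i = 0" if "comb DIM('a) l X = 0" "i \<in> {1..DIM('a)}"
  proof -
    have "(\<Sum>b\<in>Z ` {1..DIM('a)}. l (inv_into {1..DIM('a)} Z b) *\<^sub>R b) = (\<Sum>i=1..DIM('a). l i *\<^sub>R Z i)"
      using inj by (subst sum.reindex) (auto intro!: sum.cong)
    then have "l (inv_into {1..DIM('a)} Z (Z i)) = 0"
      using that comb[of l] by (intro independentD[OF ind, of "Z ` {1..DIM('a)}" "\<lambda>b. l (inv_into {1..DIM('a)} Z b)"]) auto
    then show ?thesis using that inj by simp
  qed
  have "UNIV \<subseteq> span (Z ` {1..DIM('a)})"
    using ind inj by (intro card_ge_dim_independent) (auto simp: card_image)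
  then show "\<exists>l. comb DIM('a) l X = v"
    using span_image_finite[of "{1..DIM('a)}" v Z] unfolding comb by auto
qed

lemma comb_diff: "comb d (\<lambda>i. l i - l' i) X = comb d l X - comb d l' X"
  unfolding comb_def by (simp add: bary_diff scaleR_diff_left sum_subtractf)

lemma comb_add: "comb d (\<lambda>i. l i + l' i) X = comb d l X + comb d l' X"
  unfolding comb_eq by (simp add: scaleR_add_left sum.distrib)

text \<open>\<open>coord\<close> inverts \<open>comb\<close>. Since \<open>comb\<close> reads only
  the entries 1 to d, the other entries of \<open>coord v\<close> are unspecified, and linearity is
  claimed for these indices only.\<close>

lemma general_position_coordinates:
  fixes X :: "nat \<Rightarrow> 'a::euclidean_space"
  assumes "general_position DIM('a) X"
  obtains coord :: "'a \<Rightarrow> nat \<Rightarrow> real" where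
    "\<And>v. comb DIM('a) (coord v) X = v"
    "\<And>l i. i \<in> {1..DIM('a)} \<Longrightarrow> coord (comb DIM('a) l X) i = l i"
    "\<And>i. i \<in> {1..DIM('a)} \<Longrightarrow> linear (\<lambda>v. coord v i)"
proof -
  note basis = general_position_basis[OF assms]
  obtain coord where c: "\<And>v. comb DIM('a) (coord v) X = v" using basis(2) by metis
  have eqI: "l i = l' i" if "comb DIM('a) l X = comb DIM('a) l' X" "i \<in> {1..DIM('a)}" for l l' i
    using basis(1)[of "\<lambda>i. l i - l' i" i] that by (simp add: comb_diff)
  have "linear (\<lambda>v. coord v i)" if "i \<in> {1..DIM('a)}" for i
  proof (rule linearI)
    show "coord (v + w) i = coord v i + coord w i" for v w
      using eqI[of "coord (v + w)" "\<lambda>i. coord v i + coord w i", OF _ that] by (simp add: c comb_add)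
    show "coord (r *\<^sub>R v) i = r *\<^sub>R coord v i" for r v
      using eqI[of "coord (r *\<^sub>R v)" "\<lambda>i. r * coord v i", OF _ that] by (simp add: c comb_scale)
  qed
  then show thesis using that[of coord] c eqI[of "coord (comb DIM('a) _ X)"] by (metis c eqI)
qed

text \<open>The image of Lebesgue measure under a linear bijection is translation invariant, hence a
  multiple of Lebesgue measure. The factor \<open>c\<close> is the reciprocal of a determinant; only
  its being finite and nonzero is recorded.\<close>

lemma comb_pushforward:
  fixes X :: "nat \<Rightarrow> 'a::euclidean_space"
  assumes "general_position DIM('a) X"
  obtains c :: ennreal where "c \<noteq> 0" "c \<noteq> \<infinity>"
    "\<And>F. F \<in> borel_measurable borel \<Longrightarrow>
      (\<integral>\<^sup>+l. F (comb DIM('a) l X) \<partial>lborelP {1..DIM('a)}) = c * (\<integral>\<^sup>+v. F v \<partial>lborel)"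
proof -
  obtain coord where coord: "\<And>v. comb DIM('a) (coord v) X = v"
    "\<And>l i. i \<in> {1..DIM('a)} \<Longrightarrow> coord (comb DIM('a) l X) i = l i"
    "\<And>i. i \<in> {1..DIM('a)} \<Longrightarrow> linear (\<lambda>v. coord v i)"
    using general_position_coordinates[OF assms] by metis
  \<comment> \<open>The target is a power with the one-element index set {0}, to fit
    \<open>haar_PiM\<close>.\<close>
  define L where "L = (\<lambda>l :: nat \<Rightarrow> real. \<lambda>j\<in>{0::nat}. comb DIM('a) l X)"
  have L: "L \<in> lborelP {1..DIM('a)} \<rightarrow>\<^sub>M lborelP {0}"
    unfolding L_def by (rule measurable_restrict) simp
  define F0 where "F0 = (\<lambda>y :: nat \<Rightarrow> 'a. indicator (cbox 0 One) (y 0) :: ennreal)"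
  have F0: "F0 \<in> borel_measurable (lborelP {0})" unfolding F0_def by measurable
  have sing: "(\<integral>\<^sup>+y. F (y 0) \<partial>lborelP {0::nat}) = (\<integral>\<^sup>+v. F v \<partial>lborel)" if "F \<in> borel_measurable borel" for F :: "'a \<Rightarrow> ennreal"
    using that by (intro lborel_prod.product_nn_integral_singleton) simp
  have F0i: "(\<integral>\<^sup>+y. F0 y \<partial>lborelP {0}) = 1"
    unfolding F0_def by (subst sing) (auto simp: emeasure_lborel_cbox_eq)
  have trans: "\<exists>\<mu>. \<forall>x\<in>space (lborelP {1..DIM('a)}). L (\<lambda>i\<in>{1..DIM('a)}. \<mu> i + x i) = (\<lambda>j\<in>{0}. y j + L x j)"
    if "y \<in> space (lborelP {0})" for y
    by (intro exI[of _ "coord (y 0)"]) (auto simp: L_def comb_add coord fun_eq_iff)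
  define c where "c = (\<integral>\<^sup>+x. F0 (L x) \<partial>lborelP {1..DIM('a)})"
  have c: "(\<integral>\<^sup>+l. F (comb DIM('a) l X) \<partial>lborelP {1..DIM('a)}) = c * (\<integral>\<^sup>+v. F v \<partial>lborel)"
    if F: "F \<in> borel_measurable borel" for F
  proof -
    have "(\<lambda>y :: nat \<Rightarrow> 'a. F (y 0)) \<in> borel_measurable (lborelP {0})"
      by (rule measurable_compose[OF measurable_component_singleton[of 0]]) (use F in auto)
    from haar_PiM[OF _ _ L trans this F0] show ?thesis
      unfolding F0i c_def[symmetric] sing[OF F] by (simp add: L_def)
  qed
  \<comment> \<open>The parallelepiped spanned by the edges. Its preimage is the unit cube, so c
    times its volume is 1, which rules out both 0 and infinity for \<open>c\<close>.\<close>
  define E where "E = {v. \<forall>i\<in>{1..DIM('a)}. coord v i \<in> {0..1}}"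
  have "closed {v. coord v i \<in> {0..1}}" if "i \<in> {1..DIM('a)}" for i
  proof -
    have "continuous_on UNIV (\<lambda>v. coord v i)"
      using coord(3)[OF that] by (simp add: linear_continuous_on linear_conv_bounded_linear)
    then show ?thesis using continuous_closed_vimage[of "{0..1::real}" "\<lambda>v. coord v i"]
      by (simp add: vimage_def continuous_on_eq_continuous_at)
  qed
  then have "closed E" unfolding E_def by (auto simp: Collect_ball_eq intro!: closed_INT)
  then have E [measurable]: "E \<in> sets borel" by simp
  have "(\<integral>\<^sup>+l. indicator E (comb DIM('a) l X) \<partial>lborelP {1..DIM('a)}) =
      (\<integral>\<^sup>+l. (\<Prod>i\<in>{1..DIM('a)}. indicator (cbox 0 One) (l i)) \<partial>(lborelP {1..DIM('a)} :: (nat \<Rightarrow> real) measure))"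
  proof (rule nn_integral_cong)
    fix l :: "nat \<Rightarrow> real"
    show "(indicator E (comb DIM('a) l X) :: ennreal) = (\<Prod>i\<in>{1..DIM('a)}. indicator (cbox 0 One) (l i))"
    proof (cases "comb DIM('a) l X \<in> E")
      case True
      then have "\<forall>i\<in>{1..DIM('a)}. l i \<in> {0..1}" unfolding E_def by (auto simp: coord(2))
      then show ?thesis using True by simp
    next
      case False
      then obtain i where "i \<in> {1..DIM('a)}" "l i \<notin> {0..1}" unfolding E_def by (auto simp: coord(2))
      then have "(\<Prod>i\<in>{1..DIM('a)}. indicator (cbox 0 One) (l i) :: ennreal) = 0"
        by (intro prod_zero bexI[of _ i]) auto
      then show ?thesis using False by simp
    qed
  qed
  also have "\<dots> = 1" by (rule nn_integral_lborelP_unit_cube) simp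
  finally have cE: "c * emeasure lborel E = 1" using c[of "indicator E"] by simp
  have "c \<noteq> 0" using cE by auto
  moreover have "c \<noteq> \<infinity>" using cE by (auto simp: ennreal_top_mult split: if_splits)
  ultimately show thesis using that c by blast
qed

lemma general_position_unique:
  fixes X :: "nat \<Rightarrow> 'a::euclidean_space"
  assumes "general_position DIM('a) X"
    and "(\<Sum>i\<le>DIM('a). w i) = 0" "(\<Sum>i\<le>DIM('a). w i *\<^sub>R X i) = comb DIM('a) l X" "i \<le> DIM('a)"
  shows "w i = bary DIM('a) l i"
proof -
  have w: "bary DIM('a) w i = w i" if "i \<le> DIM('a)" for i
    using assms(2) unfolding sum_atMost_split_0 by (auto simp: bary_def)
  have "comb DIM('a) w X = (\<Sum>i\<le>DIM('a). w i *\<^sub>R X i)" unfolding comb_def by (simp add: w)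
  then have "comb DIM('a) (\<lambda>i. w i - l i) X = 0" using assms by (simp add: comb_diff)
  then have "\<forall>i\<in>{1..DIM('a)}. w i = l i" using general_position_basis(1)[OF assms(1)] by force
  then have "bary DIM('a) w i = bary DIM('a) l i" using assms(4) by (auto simp: bary_def Suc_le_eq One_nat_def)
  then show ?thesis using w assms by simp
qed

lemma general_position_inj:
  fixes X :: "nat \<Rightarrow> 'a::euclidean_space"
  assumes "general_position DIM('a) X"
  shows "inj_on X {..DIM('a)}"
proof (rule inj_onI, rule ccontr)
  fix i j assume ij: "i \<in> {..DIM('a)}" "j \<in> {..DIM('a)}" "X i = X j" "i \<noteq> j"
  let ?w = "\<lambda>k. (if k = i then 1 else 0) - (if k = j then 1 else 0) :: real"
  have "(\<Sum>k\<le>DIM('a). ?w k) = 0" "(\<Sum>k\<le>DIM('a). ?w k *\<^sub>R X k) = comb DIM('a) (\<lambda>_. 0) X"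
    using ij by (simp_all add: sum_subtractf scaleR_diff_left comb_eq if_distrib[of "\<lambda>c. c *\<^sub>R _"] cong: if_cong)
  from general_position_unique[OF assms this, of i] ij show False by (auto simp: bary_def split: if_splits)
qed

lemma general_position_affine_independent:
  fixes X :: "nat \<Rightarrow> 'a::euclidean_space"
  assumes gp: "general_position DIM('a) X" and J: "J \<subseteq> {..DIM('a)}"
  shows "\<not> affine_dependent (X ` J)"
proof
  assume dep: "affine_dependent (X ` J)"
  have fin: "finite J" using J finite_subset by blast
  have inj: "inj_on X J" using general_position_inj[OF gp] J inj_on_subset by blast
  obtain U where U: "sum U (X ` J) = 0" "\<exists>v\<in>X ` J. U v \<noteq> 0" "(\<Sum>v\<in>X ` J. U v *\<^sub>R v) = 0"
    using dep affine_dependent_explicit_finite[of "X ` J"] fin by auto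
  define w where "w = (\<lambda>i. if i \<in> J then U (X i) else 0)"
  have "(\<Sum>i\<le>DIM('a). w i) = 0" "(\<Sum>i\<le>DIM('a). w i *\<^sub>R X i) = comb DIM('a) (\<lambda>_. 0) X"
    using U(1,3) J inj unfolding w_def
    by (simp_all add: sum.reindex comb_eq if_distrib[of "\<lambda>c. c *\<^sub>R _"] sum.If_cases Int_absorb1 cong: if_cong)
  from general_position_unique[OF gp this] have "w i = 0" if "i \<le> DIM('a)" for i using that by (simp add: bary_def)
  moreover obtain j where "j \<in> J" "U (X j) \<noteq> 0" using U(2) by auto
  ultimately show False using J by (force simp: w_def)
qed

lemma convex_hull_image_inj:
  fixes X :: "'i \<Rightarrow> 'a::real_vector"
  assumes "finite J" "inj_on X J"
  shows "convex hull (X ` J) = {y. \<exists>u. (\<forall>j\<in>J. 0 \<le> u j) \<and> sum u J = 1 \<and> (\<Sum>j\<in>J. u j *\<^sub>R X j) = y}"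
proof (intro set_eqI iffI)
  fix y assume "y \<in> convex hull (X ` J)"
  then obtain u where "\<forall>x\<in>X ` J. 0 \<le> u x" "sum u (X ` J) = 1" "(\<Sum>x\<in>X ` J. u x *\<^sub>R x) = y"
    using assms by (auto simp: convex_hull_finite)
  then show "y \<in> {y. \<exists>u. (\<forall>j\<in>J. 0 \<le> u j) \<and> sum u J = 1 \<and> (\<Sum>j\<in>J. u j *\<^sub>R X j) = y}"
    using assms(2) by (intro CollectI exI[of _ "\<lambda>j. u (X j)"]) (auto simp: sum.reindex o_def)
next
  fix y assume "y \<in> {y. \<exists>u. (\<forall>j\<in>J. 0 \<le> u j) \<and> sum u J = 1 \<and> (\<Sum>j\<in>J. u j *\<^sub>R X j) = y}"
  then obtain u where u: "\<forall>j\<in>J. 0 \<le> u j" "sum u J = 1" "(\<Sum>j\<in>J. u j *\<^sub>R X j) = y" by auto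
  have "(\<Sum>j\<in>J. u j *\<^sub>R X j) \<in> convex hull (X ` J)"
    using assms(1) u by (intro convex_sum convex_convex_hull) (auto intro: hull_inc)
  then show "y \<in> convex hull (X ` J)" using u by simp
qed


text \<open>At a relative interior point of the face its own vertices have positive weights, so
  small displacements keep those constraints satisfied. The other weights are 0 at \<open>z\<close>,
  and only their signs decide: near \<open>z\<close> the simplex is its tangent cone.\<close>

lemma simplex_near_face:
  fixes X :: "nat \<Rightarrow> 'a::euclidean_space"
  assumes gp: "general_position DIM('a) X" and k: "k \<le> DIM('a)"
    and coord: "\<And>v. comb DIM('a) (coord v) X = v"
      "\<And>i. i \<in> {1..DIM('a)} \<Longrightarrow> linear (\<lambda>v. coord v i)"
    and z: "z \<in> rel_interior (convex hull (X ` {..<k}))"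
  obtains r0 where "r0 > 0"
    "\<And>r v. r < r0 \<Longrightarrow> norm v < r \<Longrightarrow> z + v \<in> convex hull (X ` {..<DIM('a) + 1}) \<longleftrightarrow> (\<forall>i\<in>{k..DIM('a)}. bary DIM('a) (coord v) i \<ge> 0)"
proof -
  let ?d = "DIM('a)"
  have inj: "inj_on X {..?d}" by (rule general_position_inj[OF gp])
  then have injk: "inj_on X {..<k}" using k by (auto intro: inj_on_subset)
  have "\<not> affine_dependent (X ` {..<k})" using k by (intro general_position_affine_independent[OF gp]) auto
  from rel_interior_convex_hull_explicit[OF this] z obtain u where
    u: "\<forall>x\<in>X ` {..<k}. 0 < u x" "sum u (X ` {..<k}) = 1" "(\<Sum>x\<in>X ` {..<k}. u x *\<^sub>R x) = z"
    by auto
  define c where "c = (\<lambda>i. if i < k then u (X i) else 0)"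
  have sub: "{..?d} \<inter> {i. i < k} = {..<k}" using k by auto
  have c1: "(\<Sum>i\<le>?d. c i) = 1" and cz: "(\<Sum>i\<le>?d. c i *\<^sub>R X i) = z"
    using u(2,3) injk unfolding c_def
    by (simp_all add: sum.reindex sum.If_cases if_distrib[of "\<lambda>c. c *\<^sub>R _"] sub cong: if_cong)
  have cpos: "c i > 0" if "i < k" for i using that u(1) by (auto simp: c_def)
  \<comment> \<open>The barycentric weights of z + v are those of \<open>z\<close> plus those of the
    displacement, and they are unique.\<close>
  have key: "z + v \<in> convex hull (X ` {..<?d + 1}) \<longleftrightarrow> (\<forall>i\<le>?d. c i + bary ?d (coord v) i \<ge> 0)" for v
  proof -
    have J: "{..<?d + 1} = {..?d}" by auto
    have zv: "z + v = (\<Sum>i\<le>?d. (c i + bary ?d (coord v) i) *\<^sub>R X i)"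
      using coord(1)[of v] unfolding comb_def by (simp add: scaleR_add_left sum.distrib cz)
    have s1: "(\<Sum>i\<le>?d. c i + bary ?d (coord v) i) = 1" by (simp add: sum.distrib c1 sum_bary)
    show ?thesis
      unfolding J convex_hull_image_inj[OF finite_atMost inj]
    proof (intro iffI CollectI)
      assume "z + v \<in> {y. \<exists>u. (\<forall>j\<in>{..?d}. 0 \<le> u j) \<and> sum u {..?d} = 1 \<and> (\<Sum>j\<le>?d. u j *\<^sub>R X j) = y}"
      then obtain w where w: "\<forall>j\<in>{..?d}. 0 \<le> w j" "sum w {..?d} = 1" "(\<Sum>j\<le>?d. w j *\<^sub>R X j) = z + v" by auto
      have "(\<Sum>i\<le>?d. w i - c i) = 0" "(\<Sum>i\<le>?d. (w i - c i) *\<^sub>R X i) = comb ?d (coord v) X"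
        using w c1 cz coord(1)[of v] by (simp_all add: sum_subtractf scaleR_diff_left)
      from general_position_unique[OF gp this] have "w i = c i + bary ?d (coord v) i" if "i \<le> ?d" for i
        using that by (simp add: algebra_simps)
      then show "\<forall>i\<le>?d. c i + bary ?d (coord v) i \<ge> 0" using w(1) by auto
    next
      assume "\<forall>i\<le>?d. c i + bary ?d (coord v) i \<ge> 0"
      then show "\<exists>u. (\<forall>j\<in>{..?d}. 0 \<le> u j) \<and> sum u {..?d} = 1 \<and> (\<Sum>j\<le>?d. u j *\<^sub>R X j) = z + v"
        using zv s1 by (intro exI[of _ "\<lambda>i. c i + bary ?d (coord v) i"]) auto
    qed
  qed
  have "\<exists>B. \<forall>v. norm (bary ?d (coord v) i) \<le> norm v * B" if "i \<le> ?d" for i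
  proof -
    have "linear (\<lambda>v. bary ?d (coord v) i)"
    proof (cases "i = 0")
      case True
      have "linear (\<lambda>v. - (\<Sum>j=1..?d. coord v j))" by (intro linear_compose_neg linear_compose_sum) (use coord(2) in auto)
      then show ?thesis using True by (simp add: bary_def)
    next
      case False
      then show ?thesis using coord(2)[of i] that by (simp add: bary_def Suc_le_eq One_nat_def)
    qed
    then have "bounded_linear (\<lambda>v. bary ?d (coord v) i)" by (simp add: linear_conv_bounded_linear)
    then show ?thesis using bounded_linear.bounded by blast
  qed
  then obtain B where B: "\<And>i v. i \<le> ?d \<Longrightarrow> \<bar>bary ?d (coord v) i\<bar> \<le> norm v * B i" by (metis real_norm_def)
  \<comment> \<open>\<open>B i\<close> bounds the i-th weight of a displacement relative to its
    norm, so below this radius it cannot exceed \<open>c i\<close>. The 1 added to the absolute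
    value of \<open>B i\<close> avoids division by 0.\<close>
  define r0 where "r0 = Min (insert 1 ((\<lambda>i. c i / (\<bar>B i\<bar> + 1)) ` {..<k}))"
  have "r0 > 0" unfolding r0_def using cpos by (subst Min_gr_iff) (auto intro!: divide_pos_pos)
  moreover have "z + v \<in> convex hull (X ` {..<?d + 1}) \<longleftrightarrow> (\<forall>i\<in>{k..?d}. bary ?d (coord v) i \<ge> 0)"
    if r: "r < r0" "norm v < r" for r v
  proof -
    have "c i + bary ?d (coord v) i \<ge> 0" if i: "i < k" for i
    proof -
      have "norm v < c i / (\<bar>B i\<bar> + 1)"
        using r i unfolding r0_def by (meson Min_le finite_imageI finite_insert finite_lessThan imageI insertI2 lessThan_iff less_le_trans less_trans)
      then have "norm v * (\<bar>B i\<bar> + 1) < c i" by (simp add: pos_less_divide_eq)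
      moreover have "norm v * B i \<le> norm v * (\<bar>B i\<bar> + 1)" by (intro mult_left_mono) auto
      ultimately show ?thesis using B[of i v] i k by auto
    qed
    moreover have "c i = 0" if "i \<ge> k" for i using that by (simp add: c_def)
    ultimately show ?thesis unfolding key using k by (metis add_0 atLeastAtMost_iff le_less_linear)
  qed
  ultimately show thesis using that by blast
qed

text \<open>The Gaussian mass of the tangent cone in weight coordinates, not yet normalized. For k
  >= 1 the weight at 0 is unconstrained, so the conditions can be put on \<open>l\<close> itself
  instead of \<open>bary d l\<close>.\<close>

definition cone_mass :: "nat \<Rightarrow> nat \<Rightarrow> (nat \<Rightarrow> 'a::euclidean_space) \<Rightarrow> ennreal" where
  "cone_mass d k X = (\<integral>\<^sup>+l. ennreal (exp (- (norm (comb d l X))\<^sup>2)) * indicator {l. \<forall>i\<in>{k..d}. 0 \<le> l i} l \<partial>lborelP {1..d})"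

lemma cone_sets: 
  assumes "1 \<le> k"
  shows "{l \<in> space (lborelP {1..d}). \<forall>i\<in>{k..d}. 0 \<le> l i} \<in> sets (lborelP {1..d} :: (nat \<Rightarrow> real) measure)"
proof -
  have "{l \<in> space (lborelP {1..d}). 0 \<le> l i} \<in> sets (lborelP {1..d} :: (nat \<Rightarrow> real) measure)" if "i \<in> {k..d}" for i
  proof -
    have "i \<in> {1..d}" using that assms by auto
    from measurable_component_singleton[OF this, of "\<lambda>_. lborel :: real measure"] show ?thesis by simp
  qed
  then show ?thesis by (intro sets.sets_Collect_finite_All) auto
qed

lemma total_mass_finite:
  fixes X :: "nat \<Rightarrow> 'a::euclidean_space"
  assumes gp: "general_position DIM('a) X"
  shows "total_mass DIM('a) X \<noteq> 0" "total_mass DIM('a) X \<noteq> \<infinity>"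
proof -
  obtain c where c: "c \<noteq> 0" "c \<noteq> \<infinity>"
    "\<And>F. F \<in> borel_measurable borel \<Longrightarrow> (\<integral>\<^sup>+l. F (comb DIM('a) l X) \<partial>lborelP {1..DIM('a)}) = c * (\<integral>\<^sup>+v. F v \<partial>lborel)"
    using comb_pushforward[OF gp] by metis
  have "total_mass DIM('a) X = c * (\<integral>\<^sup>+v. ennreal (exp (- 1 * (norm v)\<^sup>2)) \<partial>(lborel :: 'a measure))"
    unfolding total_mass_def by (subst c(3)[symmetric]) auto
  also have "\<dots> = c * ennreal (sqrt (pi / 1) ^ DIM('a))"
    by (subst nn_integral_gaussian_euclidean) auto
  finally show "total_mass DIM('a) X \<noteq> 0" "total_mass DIM('a) X \<noteq> \<infinity>"
    using c by (auto simp: ennreal_mult_eq_top_iff)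
qed

lemma emeasure_lborel_translate:
  fixes z :: "'a::euclidean_space"
  assumes "S \<in> sets borel" "T \<in> sets borel" "\<And>v. z + v \<in> S \<longleftrightarrow> v \<in> T"
  shows "emeasure lborel S = emeasure lborel T"
proof -
  have "emeasure lborel S = (\<integral>\<^sup>+v. indicator S v \<partial>lborel)" using assms by simp
  also have "\<dots> = (\<integral>\<^sup>+v. indicator S (z + v) \<partial>lborel)"
    using nn_integral_lborel_affine[of "indicator S" 1 z] assms(1) by simp
  also have "\<dots> = (\<integral>\<^sup>+v. indicator T v \<partial>lborel)" by (intro nn_integral_cong) (auto simp: indicator_def assms(3))
  also have "\<dots> = emeasure lborel T" using assms by simp
  finally show ?thesis .
qed

text \<open>For small r the quotient in the limit is the share of the tangent cone in a ball, which
  is constant in r. A ball is one more radial profile of the squared norm of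
  \<open>comb d l X\<close>, so this share equals the Gaussian one. Any \<open>z\<close> in the
  relative interior gives the same value, whatever the choice operator picks.\<close>

lemma internal_angle_eq:
  fixes X :: "nat \<Rightarrow> 'a::euclidean_space"
  assumes gp: "general_position DIM('a) X" and k: "1 \<le> k" "k \<le> DIM('a)"
  shows "ennreal (internal_angle (convex hull (X ` {..<k})) (convex hull (X ` {..<DIM('a) + 1}))) =
      inverse (total_mass DIM('a) X) * cone_mass DIM('a) k X"
    "internal_angle (convex hull (X ` {..<k})) (convex hull (X ` {..<DIM('a) + 1})) \<ge> 0"
proof -
  let ?d = "DIM('a)"
  let ?T = "convex hull (X ` {..<?d + 1})"
  define F where "F = convex hull (X ` {..<k})"
  define z where "z = (SOME z. z \<in> rel_interior F)"
  have "F \<noteq> {}" using k unfolding F_def by (auto simp: lessThan_empty_iff bot_nat_def)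
  then have "rel_interior F \<noteq> {}" unfolding F_def by (simp add: rel_interior_eq_empty)
  then have z: "z \<in> rel_interior F" unfolding z_def using some_in_eq by blast
  obtain coord where coord: "\<And>v. comb ?d (coord v) X = v"
    "\<And>l i. i \<in> {1..?d} \<Longrightarrow> coord (comb ?d l X) i = l i"
    "\<And>i. i \<in> {1..?d} \<Longrightarrow> linear (\<lambda>v. coord v i)"
    using general_position_coordinates[OF gp] by metis
  obtain r0 where r0: "r0 > 0"
    "\<And>r v. r < r0 \<Longrightarrow> norm v < r \<Longrightarrow> z + v \<in> ?T \<longleftrightarrow> (\<forall>i\<in>{k..?d}. bary ?d (coord v) i \<ge> 0)"
    using simplex_near_face[OF gp k(2) coord(1,3) z[unfolded F_def]] by metis
  obtain c where c: "c \<noteq> 0" "c \<noteq> \<infinity>"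
    "\<And>F. F \<in> borel_measurable borel \<Longrightarrow> (\<integral>\<^sup>+l. F (comb ?d l X) \<partial>lborelP {1..?d}) = c * (\<integral>\<^sup>+v. F v \<partial>lborel)"
    using comb_pushforward[OF gp] by metis
  define C where "C = {v. \<forall>i\<in>{k..?d}. coord v i \<ge> 0}"
  have "closed {v. coord v i \<ge> 0}" if "i \<in> {1..?d}" for i
    using coord(3)[OF that] by (intro closed_Collect_le continuous_on_const)
      (simp add: linear_continuous_on linear_conv_bounded_linear)
  then have "closed C" unfolding C_def Collect_ball_eq using k by (intro closed_INT) auto
  then have C [measurable]: "C \<in> sets borel" by simp
  have T [measurable]: "?T \<in> sets borel" by (intro borel_closed compact_imp_closed finite_imp_compact_convex_hull) auto
  define A where "A = {l \<in> space (lborelP {1..?d} :: (nat \<Rightarrow> real) measure). \<forall>i\<in>{k..?d}. 0 \<le> l i}"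
  define GA where "GA = cone_mass ?d k X"
  define GS where "GS = total_mass ?d X"
  have GS: "GS \<noteq> 0" "GS \<noteq> \<infinity>" unfolding GS_def by (rule total_mass_finite[OF gp])+
  have GA_eq: "GA = (\<integral>\<^sup>+l. ennreal (exp (- (norm (comb ?d l X))\<^sup>2)) * indicator A l \<partial>lborelP {1..?d})"
    unfolding GA_def cone_mass_def A_def by (intro nn_integral_cong) (auto simp: indicator_def)
  have "GA \<le> GS" unfolding GA_eq GS_def total_mass_def by (intro nn_integral_mono) (auto simp: indicator_def)
  then have GA: "GA \<noteq> \<infinity>" using GS(2) by (auto simp: top_unique)
  define a where "a = enn2real GA / enn2real GS"
  have ratio: "measure lborel (ball z r \<inter> ?T) / measure lborel (ball z r) = a" if r: "0 < r" "r < r0" for r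
  proof -
    have t1: "emeasure lborel (ball z r \<inter> ?T) = emeasure lborel (ball 0 r \<inter> C)"
    proof (rule emeasure_lborel_translate)
      fix v
      have "bary ?d (coord v) i = coord v i" if "i \<in> {k..?d}" for i using that k by (auto simp: bary_def)
      then show "z + v \<in> ball z r \<inter> ?T \<longleftrightarrow> v \<in> ball 0 r \<inter> C"
        using r0(2)[OF r(2), of v] by (auto simp: C_def dist_norm)
    qed measurable
    have t2: "emeasure lborel (ball z r) = emeasure lborel (ball (0::'a) r)"
      by (rule emeasure_lborel_translate[of _ _ z]) (auto simp: dist_norm)
    \<comment> \<open>The profile whose composition with the squared norm is the indicator of the
      ball of radius \<open>r\<close>.\<close>
    define \<Gamma> where "\<Gamma> = (\<lambda>t. indicator {t. t < r\<^sup>2} t :: ennreal)"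
    have \<Gamma> [measurable]: "\<Gamma> \<in> borel_measurable borel" unfolding \<Gamma>_def by measurable
    have ball: "\<Gamma> ((norm v)\<^sup>2) = indicator (ball 0 r) v" for v :: 'a
    proof -
      have "(norm v)\<^sup>2 < r\<^sup>2 \<longleftrightarrow> norm v < r"
        using r(1) power_strict_mono[of "norm v" r 2] power_less_imp_less_base[of "norm v" 2 r] by auto
      then show ?thesis by (auto simp: \<Gamma>_def indicator_def)
    qed
    have "c * emeasure lborel (ball 0 r \<inter> C) = (\<integral>\<^sup>+l. indicator (ball 0 r \<inter> C) (comb ?d l X) \<partial>lborelP {1..?d})"
    proof -
      have BC: "ball 0 r \<inter> C \<in> sets borel" using C by (intro sets.Int) auto
      show ?thesis using c(3)[OF borel_measurable_indicator[OF BC]] BC by simp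
    qed
    also have "\<dots> = (\<integral>\<^sup>+l. \<Gamma> ((norm (comb ?d l X))\<^sup>2) * indicator A l \<partial>lborelP {1..?d})"
    proof (rule nn_integral_cong)
      fix l assume "l \<in> space (lborelP {1..?d} :: (nat \<Rightarrow> real) measure)"
      moreover have "coord (comb ?d l X) i = l i" if "i \<in> {k..?d}" for i using that k by (intro coord(2)) auto
      ultimately show "indicator (ball 0 r \<inter> C) (comb ?d l X) = \<Gamma> ((norm (comb ?d l X))\<^sup>2) * indicator A l"
        unfolding ball by (auto simp: indicator_def A_def C_def)
    qed
    finally have e1: "c * emeasure lborel (ball 0 r \<inter> C) = (\<integral>\<^sup>+l. \<Gamma> ((norm (comb ?d l X))\<^sup>2) * indicator A l \<partial>lborelP {1..?d})" .
    have "c * emeasure lborel (ball (0::'a) r) = (\<integral>\<^sup>+l. indicator (ball 0 r) (comb ?d l X) \<partial>lborelP {1..?d})"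
      using c(3)[OF borel_measurable_indicator[OF borel_open[OF open_ball]], of 0 r] by simp
    then have e2: "c * emeasure lborel (ball (0::'a) r) = (\<integral>\<^sup>+l. \<Gamma> ((norm (comb ?d l X))\<^sup>2) \<partial>lborelP {1..?d})"
      unfolding ball .
    have "(\<integral>\<^sup>+l. \<Gamma> ((norm (comb ?d l X))\<^sup>2) * indicator A l \<partial>lborelP {1..?d}) * GS =
        GA * (\<integral>\<^sup>+l. \<Gamma> ((norm (comb ?d l X))\<^sup>2) \<partial>lborelP {1..?d})"
      unfolding GA_eq GS_def total_mass_def
    proof (rule radial_comparison)
      show "AE l in lborelP {1..?d}. 0 < (norm (comb ?d l X))\<^sup>2"
      proof -
        have d1: "1 \<in> {1..?d}" by (simp add: Suc_le_eq One_nat_def)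
        show ?thesis
          by (rule eventually_mono[OF AE_lborelP_component[OF _ d1, where 'a=real]])
             (use general_position_basis(1)[OF gp _ d1] in auto)
      qed
      show "A \<in> sets (lborelP {1..?d})" unfolding A_def by (rule cone_sets[OF k(1)])
      show "(\<lambda>i\<in>{1..?d}. s * l i) \<in> A \<longleftrightarrow> l \<in> A" if "s > 0" "l \<in> space (lborelP {1..?d})" for s l
        using that k unfolding A_def by (auto simp: space_PiM zero_le_mult_iff)
      show "(\<integral>\<^sup>+l. ennreal (exp (- (norm (comb ?d l X))\<^sup>2)) \<partial>lborelP {1..?d}) \<noteq> 0"
        "(\<integral>\<^sup>+l. ennreal (exp (- (norm (comb ?d l X))\<^sup>2)) \<partial>lborelP {1..?d}) \<noteq> \<infinity>"
        using GS unfolding GS_def total_mass_def .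
      show "(\<lambda>l. (norm (comb ?d l X))\<^sup>2) \<in> borel_measurable (lborelP {1..?d})" by measurable
      show "(norm (comb ?d (\<lambda>i\<in>{1..?d}. s * l i) X))\<^sup>2 = s\<^sup>2 * (norm (comb ?d l X))\<^sup>2" for s l
        by (simp add: comb_scale power_mult_distrib)
    qed (auto simp: \<Gamma> Suc_le_eq One_nat_def)
    then have "c * (emeasure lborel (ball 0 r \<inter> C) * GS) = c * (GA * emeasure lborel (ball (0::'a) r))"
      unfolding e1[symmetric] e2[symmetric] by (simp only: mult_ac)
    then have main: "emeasure lborel (ball 0 r \<inter> C) * GS = GA * emeasure lborel (ball (0::'a) r)"
      using c by (auto simp: ennreal_mult_cancel_left)
    have "measure lborel (ball z r \<inter> ?T) * enn2real GS = enn2real GA * measure lborel (ball z r)"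
      unfolding measure_def t1 t2 using arg_cong[OF main, of enn2real] by (simp add: enn2real_mult)
    moreover have "measure lborel (ball z r) \<noteq> 0"
      using content_ball_pos[OF r(1), of z] by simp
    moreover have "enn2real GS \<noteq> 0" using GS by (simp add: enn2real_eq_0_iff)
    ultimately show ?thesis unfolding a_def by (simp add: field_simps)
  qed
  have "((\<lambda>r. measure lborel (ball z r \<inter> ?T) / measure lborel (ball z r)) \<longlongrightarrow> a) (at_right 0)"
    by (rule tendsto_eventually) (use ratio r0(1) in \<open>auto simp: eventually_at_right_field intro!: exI[of _ r0]\<close>)
  then have ang: "internal_angle F ?T = a"
    unfolding internal_angle_def Let_def z_def[symmetric] by (intro tendsto_Lim) auto
  show "internal_angle (convex hull (X ` {..<k})) ?T \<ge> 0"
    using ang unfolding F_def by (simp add: a_def)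
  have "ennreal a = GA / GS"
    using GA GS unfolding a_def by (cases GA; cases GS) (auto simp: divide_ennreal)
  then show "ennreal (internal_angle (convex hull (X ` {..<k})) ?T) = inverse (total_mass ?d X) * cone_mass ?d k X"
    using ang unfolding F_def by (simp add: GA_def GS_def divide_ennreal_def mult.commute)
qed

section \<open>Averaging over beta' simplices\<close>

text \<open>A Gamma integral for the power of 1 + |x|^2. The Gaussians exp (- m |x|^2) are not
  normalized; their masses contribute the powers m^(-d/2) that shift the exponents later on.\<close>

lemma betap_density_mixture:
  fixes x :: "'a::euclidean_space"
  assumes "\<beta> > real DIM('a) / 2"
  shows "ennreal (betap_density \<beta> x) = (\<integral>\<^sup>+m. ennreal (betap_const DIM('a) \<beta> / Gamma \<beta>) *
    (ennreal (m powr (\<beta> - 1) * exp (- m)) * indicator {0<..} m * ennreal (exp (- (m * (norm x)\<^sup>2)))) \<partial>lborel)"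
proof -
  have \<beta>: "\<beta> > 0" using assms by (meson less_trans of_nat_0_less_iff DIM_positive divide_pos_pos zero_less_numeral)
  define K where "K = betap_const DIM('a) \<beta> / Gamma \<beta>"
  have K: "K \<ge> 0" unfolding K_def betap_const_def using \<beta> assms by (simp add: Gamma_real_pos less_imp_le)
  have c: "1 + (norm x)\<^sup>2 > 0" by (simp add: add_pos_nonneg)
  have "ennreal (betap_density \<beta> x) = ennreal (K * (Gamma \<beta> * (1 + (norm x)\<^sup>2) powr (- \<beta>)))"
    unfolding betap_density_def K_def using Gamma_real_pos[OF \<beta>] by simp
  also have "\<dots> = ennreal K * ennreal (Gamma \<beta> * (1 + (norm x)\<^sup>2) powr (- \<beta>))"
    using K by (rule ennreal_mult')
  also have "\<dots> = (\<integral>\<^sup>+m. ennreal K * (ennreal (m powr (\<beta> - 1) * exp (- (1 + (norm x)\<^sup>2) * m)) * indicator {0<..} m) \<partial>lborel)"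
    unfolding nn_integral_Gamma[OF \<beta> c, symmetric] by (rule nn_integral_cmult[symmetric]) auto
  also have "\<dots> = (\<integral>\<^sup>+m. ennreal K * (ennreal (m powr (\<beta> - 1) * exp (- m)) * indicator {0<..} m * ennreal (exp (- (m * (norm x)\<^sup>2)))) \<partial>lborel)"
  proof (rule nn_integral_cong)
    fix m :: real
    have "exp (- (1 + (norm x)\<^sup>2) * m) = exp (- m) * exp (- (m * (norm x)\<^sup>2))"
      by (simp add: algebra_simps flip: exp_add)
    then have "ennreal (m powr (\<beta> - 1) * exp (- (1 + (norm x)\<^sup>2) * m)) = ennreal (m powr (\<beta> - 1) * exp (- m)) * ennreal (exp (- (m * (norm x)\<^sup>2)))"
      by (simp add: ennreal_mult'[symmetric] mult.assoc)
    then show "ennreal K * (ennreal (m powr (\<beta> - 1) * exp (- (1 + (norm x)\<^sup>2) * m)) * indicator {0<..} m) =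
        ennreal K * (ennreal (m powr (\<beta> - 1) * exp (- m)) * indicator {0<..} m * ennreal (exp (- (m * (norm x)\<^sup>2))))"
      by (simp only: mult_ac)
  qed
  finally show ?thesis unfolding K_def .
qed

lemma betap_density_measurable [measurable]: "betap_density \<beta> \<in> borel_measurable (borel :: 'a::euclidean_space measure)"
  unfolding betap_density_def[abs_def] by measurable

lemma sqrt_pi_div_power:
  assumes "m > 0"
  shows "sqrt (pi / m) ^ d = pi powr (real d / 2) * m powr (- (real d / 2))"
  using assms by (simp add: powr_half_sqrt[symmetric] powr_realpow[symmetric] powr_powr powr_divide powr_minus_divide)

text \<open>Integrating the Gaussians of the mixture over \<open>x\<close> leaves a Gamma integral
  of shape \<beta> - d/2, which is where the constant in \<open>betap_const\<close> and the bound on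
  \<beta> come from.\<close>

lemma prob_space_betap_measure:
  assumes \<beta>: "\<beta> > real DIM('a) / 2"
  shows "prob_space (betap_measure \<beta> :: 'a::euclidean_space measure)"
proof
  let ?d = "DIM('a)"
  have sp: "\<beta> - real ?d / 2 > 0" using \<beta> by simp
  have b0: "\<beta> > 0" using assms by (meson less_trans of_nat_0_less_iff DIM_positive divide_pos_pos zero_less_numeral)
  define K where "K = betap_const ?d \<beta> / Gamma \<beta>"
  have K: "K \<ge> 0" unfolding K_def betap_const_def using b0 assms by (simp add: Gamma_real_pos less_imp_le)
  define g where "g = (\<lambda>m. ennreal (m powr (\<beta> - 1) * exp (- m)) * indicator {0<..} m)"
  have [measurable]: "g \<in> borel_measurable borel" unfolding g_def by measurable
  have "emeasure (betap_measure \<beta> :: 'a measure) (space (betap_measure \<beta>)) = (\<integral>\<^sup>+x. ennreal (betap_density \<beta> x) \<partial>(lborel :: 'a measure))"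
    unfolding betap_measure_def by (simp add: emeasure_density)
  also have "\<dots> = (\<integral>\<^sup>+x. \<integral>\<^sup>+m. ennreal K * (g m * ennreal (exp (- (m * (norm (x::'a))\<^sup>2)))) \<partial>lborel \<partial>lborel)"
    unfolding betap_density_mixture[OF \<beta>] K_def g_def ..
  also have "\<dots> = (\<integral>\<^sup>+m. \<integral>\<^sup>+x. ennreal K * (g m * ennreal (exp (- (m * (norm (x::'a))\<^sup>2)))) \<partial>lborel \<partial>lborel)"
    by (rule nn_integral_swap) auto
  also have "\<dots> = (\<integral>\<^sup>+m. ennreal (K * pi powr (real ?d / 2)) * (ennreal (m powr (\<beta> - real ?d / 2 - 1) * exp (- 1 * m)) * indicator {0<..} m) \<partial>lborel)"
  proof (rule nn_integral_cong)
    fix m :: real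
    have "(\<integral>\<^sup>+x. ennreal K * (g m * ennreal (exp (- (m * (norm (x::'a))\<^sup>2)))) \<partial>lborel) = ennreal K * (g m * (\<integral>\<^sup>+x. ennreal (exp (- m * (norm (x::'a))\<^sup>2)) \<partial>lborel))"
      by (simp add: nn_integral_cmult)
    also have "\<dots> = ennreal (K * pi powr (real ?d / 2)) * (ennreal (m powr (\<beta> - real ?d / 2 - 1) * exp (- 1 * m)) * indicator {0<..} m)"
    proof (cases "m > 0")
      case True
      have "m powr (\<beta> - 1) * m powr (- (real ?d / 2)) = m powr (\<beta> - real ?d / 2 - 1)"
        unfolding powr_add[symmetric] by (simp add: algebra_simps)
      then have e: "K * (m powr (\<beta> - 1) * exp (- m) * (pi powr (real ?d / 2) * m powr (- (real ?d / 2)))) =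
          K * pi powr (real ?d / 2) * (m powr (\<beta> - real ?d / 2 - 1) * exp (- 1 * m))"
        by (simp add: mult_ac)
      show ?thesis
        unfolding nn_integral_gaussian_euclidean[OF True] sqrt_pi_div_power[OF True] g_def
        using True K e by (simp add: ennreal_mult'[symmetric])
    qed (simp add: g_def)
    finally show "(\<integral>\<^sup>+x. ennreal K * (g m * ennreal (exp (- (m * (norm (x::'a))\<^sup>2)))) \<partial>lborel) = \<dots>" .
  qed
  also have "\<dots> = ennreal (K * pi powr (real ?d / 2)) * ennreal (Gamma (\<beta> - real ?d / 2) * 1 powr (- (\<beta> - real ?d / 2)))"
    unfolding nn_integral_Gamma[OF sp zero_less_one, symmetric]
    by (rule nn_integral_cmult) auto
  also have "\<dots> = ennreal (K * pi powr (real ?d / 2) * Gamma (\<beta> - real ?d / 2))"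
    using K by (simp add: ennreal_mult'[symmetric])
  also have "K * pi powr (real ?d / 2) * Gamma (\<beta> - real ?d / 2) = 1"
    using less_imp_neq[OF Gamma_real_pos[OF b0]] less_imp_neq[OF Gamma_real_pos[OF sp]] unfolding K_def betap_const_def by simp
  finally show "emeasure (betap_measure \<beta> :: 'a measure) (space (betap_measure \<beta>)) = 1" by simp
qed

lemma PiM_density:
  fixes f :: "'a::euclidean_space \<Rightarrow> ennreal"
  assumes "finite I" "prob_space (density lborel f)" and f [measurable]: "f \<in> borel_measurable borel"
  shows "PiM I (\<lambda>_. density lborel f) = density (lborelP I) (\<lambda>X. \<Prod>i\<in>I. f (X i))"
proof -
  interpret prob_space "density lborel f" by fact
  interpret P: product_sigma_finite "\<lambda>_. density lborel f" ..
  show ?thesis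
  proof (rule P.PiM_eqI[symmetric, OF assms(1)])
    show "sets (density (lborelP I) (\<lambda>X. \<Prod>i\<in>I. f (X i))) = sets (PiM I (\<lambda>_. density lborel f))"
      by (simp cong: sets_PiM_cong)
    fix A :: "'b \<Rightarrow> 'a set" assume A: "\<And>i. i \<in> I \<Longrightarrow> A i \<in> sets (density lborel f)"
    have PA: "PiE I A \<in> sets (lborelP I)" using A assms(1) by (intro sets_PiM_I_finite) auto
    have "emeasure (density (lborelP I) (\<lambda>X. \<Prod>i\<in>I. f (X i))) (PiE I A) =
        (\<integral>\<^sup>+X. (\<Prod>i\<in>I. f (X i)) * indicator (PiE I A) X \<partial>lborelP I)"
      using PA by (intro emeasure_density) auto
    also have "\<dots> = (\<integral>\<^sup>+X. (\<Prod>i\<in>I. f (X i) * indicator (A i) (X i)) \<partial>lborelP I)"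
    proof (rule nn_integral_cong)
      fix X :: "'b \<Rightarrow> 'a" assume "X \<in> space (lborelP I)"
      then have ext: "X \<in> extensional I" by (simp add: space_PiM PiE_def)
      have "indicator (PiE I A) X = (\<Prod>i\<in>I. indicator (A i) (X i) :: ennreal)"
      proof (cases "X \<in> PiE I A")
        case True
        then have "(\<Prod>i\<in>I. indicator (A i) (X i) :: ennreal) = 1" by (intro prod.neutral) (auto dest: PiE_mem)
        then show ?thesis using True by simp
      next
        case False
        then obtain i where "i \<in> I" "X i \<notin> A i" using ext by (auto simp: PiE_def)
        then have "(\<Prod>i\<in>I. indicator (A i) (X i) :: ennreal) = 0" using assms(1) by (intro prod_zero bexI[of _ i]) auto
        then show ?thesis using False by simp
      qed
      then show "(\<Prod>i\<in>I. f (X i)) * indicator (PiE I A) X = (\<Prod>i\<in>I. f (X i) * indicator (A i) (X i))"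
        by (simp add: prod.distrib)
    qed
    also have "\<dots> = (\<Prod>i\<in>I. \<integral>\<^sup>+x. f x * indicator (A i) x \<partial>lborel)"
      using A assms(1) by (intro lborel_prod.product_nn_integral_prod) auto
    also have "\<dots> = (\<Prod>i\<in>I. emeasure (density lborel f) (A i))"
      using A by (intro prod.cong refl emeasure_density[symmetric]) auto
    finally show "emeasure (density (lborelP I) (\<lambda>X. \<Prod>i\<in>I. f (X i))) (PiE I A) = (\<Prod>i\<in>I. emeasure (density lborel f) (A i))" .
  qed
qed

section \<open>Averages over the Gamma mixing variables\<close>

definition mixing_weight :: "nat \<Rightarrow> real \<Rightarrow> (nat \<Rightarrow> real) \<Rightarrow> ennreal" where
  "mixing_weight d r m = (\<Prod>i\<le>d. ennreal (m i powr r) * indicator {0<..} (m i))"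

lemma mixing_weight_measurable [measurable]: "mixing_weight d r \<in> borel_measurable (lborelP {..d})"
  unfolding mixing_weight_def[abs_def] by measurable

definition cone_gauss :: "nat \<Rightarrow> (nat \<Rightarrow> real) set \<Rightarrow> (nat \<Rightarrow> real) \<Rightarrow> ennreal" where
  "cone_gauss d A m = (\<integral>\<^sup>+l. ennreal (exp (- qform d m l)) * indicator A l \<partial>lborelP {1..d})"

lemma qform_measurable2:
  "(\<lambda>(m, l). qform d m l) \<in> borel_measurable (lborelP {..d} \<Otimes>\<^sub>M lborelP {1..d})"
  unfolding qform_eq[abs_def] by measurable

lemma cone_gauss_measurable:
  assumes A: "A \<in> sets (lborelP {1..d})"
  shows "cone_gauss d A \<in> borel_measurable (lborelP {..d})"
proof -
  interpret sigma_finite_measure "lborelP {1..d} :: (nat \<Rightarrow> real) measure" by simp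
  have [measurable]: "(\<lambda>x. qform d (fst x) (snd x)) \<in> borel_measurable (lborelP {..d} \<Otimes>\<^sub>M lborelP {1..d})"
    using qform_measurable2 by (simp add: split_beta')
  have [measurable]: "(\<lambda>x. indicator A (snd x) :: ennreal) \<in> borel_measurable (lborelP {..d} \<Otimes>\<^sub>M lborelP {1..d})"
    by (rule measurable_compose[OF measurable_snd]) (use A in simp)
  have "(\<lambda>(m, l). ennreal (exp (- qform d m l)) * indicator A l) \<in> borel_measurable (lborelP {..d} \<Otimes>\<^sub>M lborelP {1..d})"
    unfolding split_beta' by measurable
  then show ?thesis unfolding cone_gauss_def[abs_def] by (rule borel_measurable_nn_integral)
qed

lemma cone_gauss_full:
  assumes "\<And>i. i \<le> d \<Longrightarrow> m i > 0"
  shows "(\<integral>\<^sup>+l. ennreal (exp (- qform d m l)) \<partial>lborelP {1..d}) = ennreal (sqrt pi ^ d * sqrt (prod m {..d} / sum m {..d}))"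
proof -
  have "(\<integral>\<^sup>+l. ennreal (exp (- (0 + (\<Sum>i\<in>{1..d}. l i))\<^sup>2 / m 0 - (\<Sum>i\<in>{1..d}. (l i)\<^sup>2 / m i))) \<partial>lborelP {1..d}) =
    ennreal (sqrt pi ^ card {1..d} * sqrt (m 0 * prod m {1..d} / (m 0 + sum m {1..d})) * exp (- 0\<^sup>2 / (m 0 + sum m {1..d})))"
    using assms by (intro nn_integral_gaussian_PiM) auto
  moreover have "{..d} = insert 0 {1..d}" by auto
  ultimately show ?thesis by (simp add: qform_eq)
qed

lemma cone_gauss_scale:
  assumes u: "u > 0" and A: "A \<in> sets (lborelP {1..d})"
    and cone: "\<And>s x. s > 0 \<Longrightarrow> x \<in> space (lborelP {1..d}) \<Longrightarrow> (\<lambda>i\<in>{1..d}. s * x i) \<in> A \<longleftrightarrow> x \<in> A"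
  shows "cone_gauss d A (\<lambda>i\<in>{..d}. u * m i) = ennreal (u powr (real d / 2)) * cone_gauss d A m"
proof -
  have q: "qform d (\<lambda>i\<in>{..d}. u * m i) (\<lambda>i\<in>{1..d}. sqrt u * l i) = qform d m l" for l
    unfolding qform_def using u by (intro sum.cong) (auto simp: bary_scale power_mult_distrib)
  have "cone_gauss d A (\<lambda>i\<in>{..d}. u * m i) = ennreal (\<bar>sqrt u\<bar> ^ (DIM(real) * card {1..d})) *
     (\<integral>\<^sup>+l. ennreal (exp (- qform d (\<lambda>i\<in>{..d}. u * m i) (\<lambda>i\<in>{1..d}. 0 + sqrt u *\<^sub>R l i))) * indicator A (\<lambda>i\<in>{1..d}. 0 + sqrt u *\<^sub>R l i) \<partial>lborelP {1..d})"
    unfolding cone_gauss_def using u A by (intro nn_integral_lborelP_affine[where y="\<lambda>_. 0"]) auto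
  also have "(\<integral>\<^sup>+l. ennreal (exp (- qform d (\<lambda>i\<in>{..d}. u * m i) (\<lambda>i\<in>{1..d}. 0 + sqrt u *\<^sub>R l i))) * indicator A (\<lambda>i\<in>{1..d}. 0 + sqrt u *\<^sub>R l i) \<partial>lborelP {1..d}) = cone_gauss d A m"
    unfolding cone_gauss_def
  proof (rule nn_integral_cong)
    fix l :: "nat \<Rightarrow> real" assume l: "l \<in> space (lborelP {1..d})"
    show "ennreal (exp (- qform d (\<lambda>i\<in>{..d}. u * m i) (\<lambda>i\<in>{1..d}. 0 + sqrt u *\<^sub>R l i))) * indicator A (\<lambda>i\<in>{1..d}. 0 + sqrt u *\<^sub>R l i) =
       ennreal (exp (- qform d m l)) * indicator A l"
      using q[of l] cone[OF _ l, of "sqrt u"] u by (simp add: indicator_def)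
  qed
  also have "\<bar>sqrt u\<bar> ^ (DIM(real) * card {1..d}) = u powr (real d / 2)"
    using u by (simp add: powr_half_sqrt[symmetric] powr_realpow[symmetric] powr_powr)
  finally show ?thesis .
qed

text \<open>\<open>H\<^sub>k\<close> and \<open>H\<close> of the overview, for \<open>A\<close> the
  cone and the whole space. The product runs over all d + 1 weights, the one at 0 being determined
  by the others.\<close>

definition cone_integral :: "nat \<Rightarrow> (nat \<Rightarrow> real) set \<Rightarrow> real \<Rightarrow> ennreal" where
  "cone_integral d A s = (\<integral>\<^sup>+l. (\<Prod>i\<le>d. bessel s (bary d l i)) * indicator A l \<partial>lborelP {1..d})"

text \<open>What the expected cone share reduces to, up to a constant, once the vertices are
  integrated out. The square root comes from the normalization of the Gaussian on the weights; the
  scale \<open>u\<close> is introduced for the homogeneity argument that removes it.\<close>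

definition gamma_average :: "nat \<Rightarrow> (nat \<Rightarrow> real) set \<Rightarrow> real \<Rightarrow> real \<Rightarrow> ennreal" where
  "gamma_average d A s u = (\<integral>\<^sup>+m. mixing_weight d (s - 3/2) m * ennreal (sqrt (sum m {..d})) * cone_gauss d A m *
     ennreal (exp (- u * sum m {..d})) \<partial>lborelP {..d})"

lemma mixing_weight_scale:
  assumes "u > 0"
  shows "mixing_weight d r (\<lambda>i\<in>{..d}. u * m i) = ennreal (u powr (r * (real d + 1))) * mixing_weight d r m"
proof -
  have "mixing_weight d r (\<lambda>i\<in>{..d}. u * m i) = (\<Prod>i\<le>d. ennreal (u powr r) * (ennreal (m i powr r) * indicator {0<..} (m i)))"
    unfolding mixing_weight_def
  proof (rule prod.cong)
    fix i assume "i \<in> {..d}"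
    then show "ennreal ((\<lambda>i\<in>{..d}. u * m i) i powr r) * indicator {0<..} ((\<lambda>i\<in>{..d}. u * m i) i) =
        ennreal (u powr r) * (ennreal (m i powr r) * indicator {0<..} (m i))"
      using assms by (cases "m i > 0") (auto simp: powr_mult ennreal_mult' mult.assoc zero_less_mult_iff)
  qed simp
  also have "\<dots> = ennreal (u powr r) ^ Suc d * mixing_weight d r m"
    unfolding mixing_weight_def prod.distrib by simp
  also have "ennreal (u powr r) ^ Suc d = ennreal (u powr (r * (real d + 1)))"
    using assms by (simp add: ennreal_power powr_realpow[symmetric] powr_powr add.commute del: power_Suc)
  finally show ?thesis .
qed

text \<open>Substitution of u m for m. The powers of u are d + 1 from the Jacobian, (s - 3/2)(d + 1)
  from the weight, 1/2 from the square root and d/2 from the Gaussian cone mass; they add up to s (d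
  + 1).\<close>

lemma gamma_average_scale:
  assumes u: "u > 0" and A: "A \<in> sets (lborelP {1..d})"
    and cone: "\<And>s x. s > 0 \<Longrightarrow> x \<in> space (lborelP {1..d}) \<Longrightarrow> (\<lambda>i\<in>{1..d}. s * x i) \<in> A \<longleftrightarrow> x \<in> A"
  shows "gamma_average d A s 1 = ennreal (u powr (s * (real d + 1))) * gamma_average d A s u"
proof -
  note [measurable] = cone_gauss_measurable[OF A]
  let ?f = "\<lambda>u m. mixing_weight d (s - 3/2) m * ennreal (sqrt (sum m {..d})) * cone_gauss d A m * ennreal (exp (- u * sum m {..d}))"
  have "gamma_average d A s 1 = ennreal (\<bar>u\<bar> ^ (DIM(real) * card {..d})) * (\<integral>\<^sup>+m. ?f 1 (\<lambda>i\<in>{..d}. 0 + u *\<^sub>R m i) \<partial>lborelP {..d})"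
    unfolding gamma_average_def using u by (intro nn_integral_lborelP_affine[where y="\<lambda>_. 0"]) auto
  also have "(\<integral>\<^sup>+m. ?f 1 (\<lambda>i\<in>{..d}. 0 + u *\<^sub>R m i) \<partial>lborelP {..d}) =
      (\<integral>\<^sup>+m. ennreal (u powr ((s - 3/2) * (real d + 1)) * u powr (1/2) * u powr (real d / 2)) * ?f u m \<partial>lborelP {..d})"
  proof (rule nn_integral_cong)
    fix m :: "nat \<Rightarrow> real"
    have sm: "sum (\<lambda>i\<in>{..d}. u * m i) {..d} = u * sum m {..d}" by (simp add: sum_distrib_left)
    have sq: "ennreal (sqrt (u * sum m {..d})) = ennreal (u powr (1/2)) * ennreal (sqrt (sum m {..d}))"
      using u by (simp add: real_sqrt_mult powr_half_sqrt ennreal_mult')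
    have "?f 1 (\<lambda>i\<in>{..d}. u * m i) = (ennreal (u powr ((s - 3/2) * (real d + 1))) * ennreal (u powr (1/2)) * ennreal (u powr (real d / 2))) * ?f u m"
    proof -
      have cg: "cone_gauss d A (\<lambda>i\<in>{..d}. u * m i) = ennreal (u powr (real d / 2)) * cone_gauss d A m"
        by (rule cone_gauss_scale[OF u A]) (rule cone)
      show ?thesis unfolding sm sq mixing_weight_scale[OF u] cg by (simp add: mult_ac)
    qed
    then show "?f 1 (\<lambda>i\<in>{..d}. 0 + u *\<^sub>R m i) = ennreal (u powr ((s - 3/2) * (real d + 1)) * u powr (1/2) * u powr (real d / 2)) * ?f u m"
      by (simp add: ennreal_mult')
  qed
  also have "\<dots> = ennreal (u powr ((s - 3/2) * (real d + 1)) * u powr (1/2) * u powr (real d / 2)) * gamma_average d A s u"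
    unfolding gamma_average_def by (rule nn_integral_cmult) measurable
  also have "ennreal (\<bar>u\<bar> ^ (DIM(real) * card {..d})) * \<dots> =
      ennreal (u ^ Suc d * (u powr ((s - 3/2) * (real d + 1)) * u powr (1/2) * u powr (real d / 2))) * gamma_average d A s u"
    using u by (simp add: mult.assoc[symmetric] ennreal_mult'[symmetric] del: power_Suc)
  also have "u ^ Suc d * (u powr ((s - 3/2) * (real d + 1)) * u powr (1/2) * u powr (real d / 2)) = u powr (s * (real d + 1))"
  proof -
    have "u ^ Suc d = u powr (real d + 1)" using u by (simp add: powr_realpow[symmetric] add.commute del: power_Suc)
    moreover have "real d + 1 + ((s - 3/2) * (real d + 1) + 1/2 + real d / 2) = s * (real d + 1)"
      by (simp add: field_simps)
    ultimately show ?thesis by (simp only: powr_add[symmetric])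
  qed
  finally show ?thesis .
qed

text \<open>The factor \<open>sqrt (sum m {..d})\<close> of \<open>gamma_average\<close> is removed by writing \<open>M\<close> to the power
  \<open>-1/2\<close> as a Gaussian integral over \<open>\<mu>\<close> and using homogeneity in \<open>m\<close>.\<close>

lemma cone_integral_eq_gamma_average:
  assumes A: "A \<in> sets (lborelP {1..d})"
    and cone: "\<And>s x. s > 0 \<Longrightarrow> x \<in> space (lborelP {1..d}) \<Longrightarrow> (\<lambda>i\<in>{1..d}. s * x i) \<in> A \<longleftrightarrow> x \<in> A"
  shows "cone_integral d A s = (\<integral>\<^sup>+\<mu>. ennreal (1 / sqrt pi * (1 + \<mu>\<^sup>2) powr (- (s * (real d + 1)))) \<partial>lborel) * gamma_average d A s 1"
proof -
  note CG [measurable] = cone_gauss_measurable[OF A]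
  have wq: "(\<Prod>i\<le>d. ennreal (m i powr (s - 3/2) * exp (- m i - (bary d l i)\<^sup>2 / m i)) * indicator {0<..} (m i)) =
      mixing_weight d (s - 3/2) m * ennreal (exp (- sum m {..d})) * ennreal (exp (- qform d m l))" for m l
  proof -
    have "(\<Prod>i\<le>d. ennreal (m i powr (s - 3/2) * exp (- m i - (bary d l i)\<^sup>2 / m i)) * indicator {0<..} (m i)) =
        (\<Prod>i\<le>d. (ennreal (m i powr (s - 3/2)) * indicator {0<..} (m i)) * ennreal (exp (- m i)) * ennreal (exp (- ((bary d l i)\<^sup>2 / m i))))"
    proof (rule prod.cong[OF refl])
      fix i
      have "exp (- m i - (bary d l i)\<^sup>2 / m i) = exp (- m i) * exp (- ((bary d l i)\<^sup>2 / m i))" by (simp flip: exp_add)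
      then show "ennreal (m i powr (s - 3/2) * exp (- m i - (bary d l i)\<^sup>2 / m i)) * indicator {0<..} (m i) =
        (ennreal (m i powr (s - 3/2)) * indicator {0<..} (m i)) * ennreal (exp (- m i)) * ennreal (exp (- ((bary d l i)\<^sup>2 / m i)))"
        by (simp add: ennreal_mult' mult_ac)
    qed
    also have "\<dots> = mixing_weight d (s - 3/2) m * ennreal (exp (- sum m {..d})) * ennreal (exp (- qform d m l))"
      unfolding prod.distrib mixing_weight_def qform_def by (simp add: prod_ennreal exp_sum sum_negf[symmetric])
    finally show ?thesis .
  qed
  have meas: "(\<lambda>(l, m). mixing_weight d (s - 3/2) m * ennreal (exp (- sum m {..d})) * ennreal (exp (- qform d m l)) * indicator A l)
      \<in> borel_measurable (lborelP {1..d} \<Otimes>\<^sub>M lborelP {..d})"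
  proof -
    have [measurable]: "(\<lambda>x. qform d (snd x) (fst x)) \<in> borel_measurable (lborelP {1..d} \<Otimes>\<^sub>M lborelP {..d})"
      using measurable_compose[OF measurable_Pair[OF measurable_snd measurable_fst] qform_measurable2[of d]] by simp
    have [measurable]: "(\<lambda>x. mixing_weight d (s - 3/2) (snd x)) \<in> borel_measurable (lborelP {1..d} \<Otimes>\<^sub>M lborelP {..d})"
      by (rule measurable_compose[OF measurable_snd mixing_weight_measurable])
    have [measurable]: "(\<lambda>x. indicator A (fst x) :: ennreal) \<in> borel_measurable (lborelP {1..d} \<Otimes>\<^sub>M lborelP {..d})"
      by (rule measurable_compose[OF measurable_fst]) (use A in simp)
    show ?thesis unfolding split_beta' by measurable
  qed
  have "cone_integral d A s = (\<integral>\<^sup>+l. \<integral>\<^sup>+m. mixing_weight d (s - 3/2) m * ennreal (exp (- sum m {..d})) * ennreal (exp (- qform d m l)) * indicator A l \<partial>lborelP {..d} \<partial>lborelP {1..d})"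
    unfolding cone_integral_def
  proof (rule nn_integral_cong)
    fix l :: "nat \<Rightarrow> real"
    let ?w = "\<lambda>m. mixing_weight d (s - 3/2) m * ennreal (exp (- sum m {..d})) * ennreal (exp (- qform d m l))"
    have "(\<Prod>i\<le>d. bessel s (bary d l i)) = (\<integral>\<^sup>+m. (\<Prod>i\<le>d. ennreal (m i powr (s - 3/2) * exp (- m i - (bary d l i)\<^sup>2 / m i)) * indicator {0<..} (m i)) \<partial>lborelP {..d})"
      unfolding bessel_def by (subst lborel_prod.product_nn_integral_prod) auto
    then have eq: "(\<Prod>i\<le>d. bessel s (bary d l i)) = (\<integral>\<^sup>+m. ?w m \<partial>lborelP {..d})"
      unfolding wq .
    have [measurable]: "(\<lambda>m. qform d m l) \<in> borel_measurable (lborelP {..d})"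
      unfolding qform_def by measurable
    have "?w \<in> borel_measurable (lborelP {..d})" by measurable
    from nn_integral_multc[OF this] show "(\<Prod>i\<le>d. bessel s (bary d l i)) * indicator A l = (\<integral>\<^sup>+m. ?w m * indicator A l \<partial>lborelP {..d})"
      unfolding eq ..
  qed
  also have "\<dots> = (\<integral>\<^sup>+m. \<integral>\<^sup>+l. mixing_weight d (s - 3/2) m * ennreal (exp (- sum m {..d})) * ennreal (exp (- qform d m l)) * indicator A l \<partial>lborelP {1..d} \<partial>lborelP {..d})"
    by (rule nn_integral_swap[OF _ _ meas]) simp_all
  also have "\<dots> = (\<integral>\<^sup>+m. mixing_weight d (s - 3/2) m * ennreal (exp (- sum m {..d})) * cone_gauss d A m \<partial>lborelP {..d})"
  proof (rule nn_integral_cong)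
    fix m :: "nat \<Rightarrow> real"
    have "(\<lambda>l. ennreal (exp (- qform d m l)) * indicator A l) \<in> borel_measurable (lborelP {1..d})"
      using A by measurable
    from nn_integral_cmult[OF this, of "mixing_weight d (s - 3/2) m * ennreal (exp (- sum m {..d}))"]
    show "(\<integral>\<^sup>+l. mixing_weight d (s - 3/2) m * ennreal (exp (- sum m {..d})) * ennreal (exp (- qform d m l)) * indicator A l \<partial>lborelP {1..d}) =
        mixing_weight d (s - 3/2) m * ennreal (exp (- sum m {..d})) * cone_gauss d A m"
      unfolding cone_gauss_def by (simp only: mult.assoc)
  qed
  \<comment> \<open>With M = \<open>sum m {..d}\<close>, the number 1 is inserted as sqrt (M / pi)
    times the integral of exp (- M \<mu>^2). This creates the factor sqrt M and replaces exp (- M)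
    by exp (- (1 + \<mu>^2) M), which is \<open>gamma_average\<close> at scale 1 + \<mu>^2.\<close>
  also have "\<dots> = (\<integral>\<^sup>+m. \<integral>\<^sup>+\<mu>. ennreal (1 / sqrt pi) * (mixing_weight d (s - 3/2) m * ennreal (sqrt (sum m {..d})) * cone_gauss d A m * ennreal (exp (- (1 + \<mu>\<^sup>2) * sum m {..d}))) \<partial>lborel \<partial>lborelP {..d})"
  proof (rule nn_integral_cong)
    fix m :: "nat \<Rightarrow> real"
    define W where "W = mixing_weight d (s - 3/2) m"
    define M where "M = sum m {..d}"
    have "(\<integral>\<^sup>+\<mu>. ennreal (1 / sqrt pi) * (W * ennreal (sqrt M) * cone_gauss d A m * ennreal (exp (- (1 + \<mu>\<^sup>2) * M))) \<partial>lborel) =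
        (\<integral>\<^sup>+\<mu>. (W * ennreal (exp (- M)) * cone_gauss d A m) * (ennreal (sqrt M / sqrt pi) * ennreal (exp (- M * (0 + \<mu>)\<^sup>2))) \<partial>lborel)"
    proof (rule nn_integral_cong)
      fix \<mu> :: real
      have "exp (- (1 + \<mu>\<^sup>2) * M) = exp (- M) * exp (- M * (0 + \<mu>)\<^sup>2)" by (simp add: algebra_simps flip: exp_add)
      moreover have "ennreal (sqrt M / sqrt pi) = ennreal (1 / sqrt pi) * ennreal (sqrt M)" by (simp add: ennreal_mult'[symmetric])
      ultimately show "ennreal (1 / sqrt pi) * (W * ennreal (sqrt M) * cone_gauss d A m * ennreal (exp (- (1 + \<mu>\<^sup>2) * M))) =
        (W * ennreal (exp (- M)) * cone_gauss d A m) * (ennreal (sqrt M / sqrt pi) * ennreal (exp (- M * (0 + \<mu>)\<^sup>2)))"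
        by (simp only: ennreal_mult'[OF exp_ge_zero] mult_ac)
    qed
    also have "\<dots> = (W * ennreal (exp (- M)) * cone_gauss d A m) * (ennreal (sqrt M / sqrt pi) * (\<integral>\<^sup>+\<mu>. ennreal (exp (- M * (0 + \<mu>)\<^sup>2)) \<partial>lborel))"
      by (simp add: nn_integral_cmult)
    also have "\<dots> = W * ennreal (exp (- M)) * cone_gauss d A m"
    \<comment> \<open>The Gaussian identity requires M > 0; wherever the weight is nonzero all
      \<open>m i\<close> are positive.\<close>
    proof (cases "W = 0")
      case False
      have "m i > 0" if "i \<le> d" for i
      proof (rule ccontr)
        assume "\<not> m i > 0"
        then have "W = 0" unfolding W_def mixing_weight_def using that by (intro prod_zero bexI[of _ i]) auto
        then show False using False by simp
      qed
      then have M: "M > 0" unfolding M_def by (intro sum_pos) auto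
      have "ennreal (sqrt M / sqrt pi) * ennreal (sqrt (pi / M)) = 1"
        using M by (simp add: ennreal_mult'[symmetric] real_sqrt_divide)
      then show ?thesis unfolding nn_integral_gaussian[OF M] by simp
    qed simp
    finally show "mixing_weight d (s - 3/2) m * ennreal (exp (- sum m {..d})) * cone_gauss d A m =
      (\<integral>\<^sup>+\<mu>. ennreal (1 / sqrt pi) * (mixing_weight d (s - 3/2) m * ennreal (sqrt (sum m {..d})) * cone_gauss d A m * ennreal (exp (- (1 + \<mu>\<^sup>2) * sum m {..d}))) \<partial>lborel)"
      unfolding W_def M_def ..
  qed
  also have "\<dots> = (\<integral>\<^sup>+\<mu>. \<integral>\<^sup>+m. ennreal (1 / sqrt pi) * (mixing_weight d (s - 3/2) m * ennreal (sqrt (sum m {..d})) * cone_gauss d A m * ennreal (exp (- (1 + \<mu>\<^sup>2) * sum m {..d}))) \<partial>lborelP {..d} \<partial>lborel)"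
  proof (rule nn_integral_swap)
    have [measurable]: "(\<lambda>x :: (nat \<Rightarrow> real) \<times> real. cone_gauss d A (fst x)) \<in> borel_measurable (lborelP {..d} \<Otimes>\<^sub>M lborel)"
      "(\<lambda>x :: (nat \<Rightarrow> real) \<times> real. mixing_weight d (s - 3/2) (fst x)) \<in> borel_measurable (lborelP {..d} \<Otimes>\<^sub>M lborel)"
      by (rule measurable_compose[OF measurable_fst CG], rule measurable_compose[OF measurable_fst mixing_weight_measurable])
    show "(\<lambda>(m, \<mu>). ennreal (1 / sqrt pi) * (mixing_weight d (s - 3/2) m * ennreal (sqrt (sum m {..d})) * cone_gauss d A m * ennreal (exp (- (1 + \<mu>\<^sup>2) * sum m {..d}))))
        \<in> borel_measurable (lborelP {..d} \<Otimes>\<^sub>M lborel)"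
      unfolding split_beta' by measurable
  qed simp_all
  also have "\<dots> = (\<integral>\<^sup>+\<mu>. ennreal (1 / sqrt pi * (1 + \<mu>\<^sup>2) powr (- (s * (real d + 1)))) * gamma_average d A s 1 \<partial>lborel)"
  proof (rule nn_integral_cong)
    fix \<mu> :: real
    define u where "u = 1 + \<mu>\<^sup>2"
    have u: "u > 0" unfolding u_def by (simp add: add_pos_nonneg)
    have "(\<integral>\<^sup>+m. ennreal (1 / sqrt pi) * (mixing_weight d (s - 3/2) m * ennreal (sqrt (sum m {..d})) * cone_gauss d A m * ennreal (exp (- u * sum m {..d}))) \<partial>lborelP {..d}) =
        ennreal (1 / sqrt pi) * gamma_average d A s u"
      unfolding gamma_average_def by (rule nn_integral_cmult) measurable
    also have "\<dots> = ennreal (1 / sqrt pi * u powr (- (s * (real d + 1)))) * gamma_average d A s 1"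
    proof -
      have "u powr (- (s * (real d + 1))) * u powr (s * (real d + 1)) = 1" using u by (simp flip: powr_add)
      then have "ennreal (1 / sqrt pi * u powr (- (s * (real d + 1)))) * ennreal (u powr (s * (real d + 1))) = ennreal (1 / sqrt pi)"
        by (simp add: ennreal_mult'[symmetric] mult.assoc)
      moreover have gs: "gamma_average d A s 1 = ennreal (u powr (s * (real d + 1))) * gamma_average d A s u"
        by (rule gamma_average_scale[OF u A]) (rule cone)
      ultimately show ?thesis unfolding gs by (simp only: mult.assoc[symmetric])
    qed
    finally show "(\<integral>\<^sup>+m. ennreal (1 / sqrt pi) * (mixing_weight d (s - 3/2) m * ennreal (sqrt (sum m {..d})) * cone_gauss d A m * ennreal (exp (- (1 + \<mu>\<^sup>2) * sum m {..d}))) \<partial>lborelP {..d}) =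
        ennreal (1 / sqrt pi * (1 + \<mu>\<^sup>2) powr (- (s * (real d + 1)))) * gamma_average d A s 1"
      unfolding u_def .
  qed
  \<comment> \<open>The factor in front does not depend on \<open>A\<close>, so it cancels when two
    cones are compared.\<close>
  also have "\<dots> = (\<integral>\<^sup>+\<mu>. ennreal (1 / sqrt pi * (1 + \<mu>\<^sup>2) powr (- (s * (real d + 1)))) \<partial>lborel) * gamma_average d A s 1"
    by (rule nn_integral_multc) measurable
  finally show ?thesis .
qed

section \<open>The expected share of a cone over random simplices\<close>

definition gauss_mass :: "nat \<Rightarrow> (nat \<Rightarrow> real) set \<Rightarrow> (nat \<Rightarrow> 'a::euclidean_space) \<Rightarrow> ennreal" where
  "gauss_mass d A X = (\<integral>\<^sup>+l. ennreal (exp (- (norm (comb d l X))\<^sup>2)) * indicator A l \<partial>lborelP {1..d})"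

lemma gauss_mass_measurable:
  assumes "A \<in> sets (lborelP {1..d})"
  shows "gauss_mass d A \<in> borel_measurable (lborelP {..d} :: (nat \<Rightarrow> 'a::euclidean_space) measure)"
proof -
  interpret sigma_finite_measure "lborelP {1..d} :: (nat \<Rightarrow> real) measure" by simp
  have [measurable]: "(\<lambda>x. indicator A (snd x) :: ennreal) \<in> borel_measurable ((lborelP {..d} :: (nat \<Rightarrow> 'a) measure) \<Otimes>\<^sub>M lborelP {1..d})"
    by (rule measurable_compose[OF measurable_snd]) (use assms in simp)
  have "(\<lambda>(X, l). ennreal (exp (- (norm (comb d l X))\<^sup>2)) * indicator A l) \<in>
      borel_measurable ((lborelP {..d} :: (nat \<Rightarrow> 'a) measure) \<Otimes>\<^sub>M lborelP {1..d})"
    unfolding comb_eq split_beta' by measurable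
  then show ?thesis unfolding gauss_mass_def[abs_def] by (rule borel_measurable_nn_integral)
qed

lemma ennreal_inverse_mult_self: "a \<noteq> 0 \<Longrightarrow> a \<noteq> \<infinity> \<Longrightarrow> inverse a * a = (1 :: ennreal)"
  using ennreal_divide_self[of a] by (simp add: divide_ennreal_def mult.commute less_top)

text \<open>For fixed \<open>m\<close>, \<open>gaussian_simplex_angle\<close> gives the average up
  to two normalizations: the mass \<open>D\<close> of the Gaussian on the weights, and the average
  for the whole space, which is a plain product of Gaussian integrals over the vertices.\<close>

lemma gaussian_angle_average:
  fixes m :: "nat \<Rightarrow> real"
  defines "d \<equiv> DIM('a::euclidean_space)"
  assumes m: "\<And>i. i \<le> d \<Longrightarrow> m i > 0"
    and A: "A \<in> sets (lborelP {1..d})"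
    and cone: "\<And>s x. s > 0 \<Longrightarrow> x \<in> space (lborelP {1..d}) \<Longrightarrow> (\<lambda>i\<in>{1..d}. s * x i) \<in> A \<longleftrightarrow> x \<in> A"
  shows "(\<integral>\<^sup>+X. ennreal (exp (- (\<Sum>i\<le>d. m i * (norm (X i))\<^sup>2))) * (inverse (total_mass d X) * gauss_mass d A X) \<partial>(lborelP {..d} :: (nat \<Rightarrow> 'a) measure)) =
    ennreal ((\<Prod>i\<le>d. sqrt (pi / m i) ^ d) / (sqrt pi ^ d * sqrt (prod m {..d} / sum m {..d}))) * cone_gauss d A m"
proof -
  let ?M = "lborelP {..d} :: (nat \<Rightarrow> 'a) measure"
  define D where "D = sqrt pi ^ d * sqrt (prod m {..d} / sum m {..d})"
  have D: "D > 0"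
    unfolding D_def using m by (intro mult_pos_pos zero_less_power real_sqrt_gt_zero divide_pos_pos prod_pos sum_pos) auto
  have Dint: "(\<integral>\<^sup>+l. ennreal (exp (- qform d m l)) \<partial>lborelP {1..d}) = ennreal D"
    unfolding D_def by (rule cone_gauss_full[OF m])
  have swap: "(\<integral>\<^sup>+X. ennreal (exp (- (\<Sum>i\<le>d. m i * (norm (X i))\<^sup>2))) * (inverse (total_mass d X) * gauss_mass d B X) \<partial>?M) =
      (\<integral>\<^sup>+l. (\<integral>\<^sup>+X. angle_kernel d m l X \<partial>?M) * indicator B l \<partial>lborelP {1..d})"
    if B: "B \<in> sets (lborelP {1..d})" for B
  proof -
    have ind: "(\<lambda>x. indicator B (fst x) :: ennreal) \<in> borel_measurable (lborelP {1..d} \<Otimes>\<^sub>M ?M)"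
      by (rule measurable_compose[OF measurable_fst]) (use B in simp)
    have meas: "(\<lambda>(l, X). angle_kernel d m l X * indicator B l) \<in> borel_measurable (lborelP {1..d} \<Otimes>\<^sub>M ?M)"
      using borel_measurable_times_ennreal[OF angle_kernel_measurable ind] by (simp add: split_beta')
    have "(\<integral>\<^sup>+X. ennreal (exp (- (\<Sum>i\<le>d. m i * (norm (X i))\<^sup>2))) * (inverse (total_mass d X) * gauss_mass d B X) \<partial>?M) =
        (\<integral>\<^sup>+X. \<integral>\<^sup>+l. angle_kernel d m l X * indicator B l \<partial>lborelP {1..d} \<partial>?M)"
    proof (rule nn_integral_cong)
      fix X :: "nat \<Rightarrow> 'a"
      have "(\<lambda>l. ennreal (exp (- (norm (comb d l X))\<^sup>2)) * indicator B l) \<in> borel_measurable (lborelP {1..d})"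
        using B by measurable
      from nn_integral_cmult[OF this, of "ennreal (exp (- (\<Sum>i\<le>d. m i * (norm (X i))\<^sup>2))) * inverse (total_mass d X)"]
      show "ennreal (exp (- (\<Sum>i\<le>d. m i * (norm (X i))\<^sup>2))) * (inverse (total_mass d X) * gauss_mass d B X) =
          (\<integral>\<^sup>+l. angle_kernel d m l X * indicator B l \<partial>lborelP {1..d})"
        unfolding angle_kernel_def gauss_mass_def by (simp only: mult.assoc)
    qed
    also have "\<dots> = (\<integral>\<^sup>+l. \<integral>\<^sup>+X. angle_kernel d m l X * indicator B l \<partial>?M \<partial>lborelP {1..d})"
      by (rule nn_integral_swap[OF _ _ meas, symmetric]) simp_all
    also have "\<dots> = (\<integral>\<^sup>+l. (\<integral>\<^sup>+X. angle_kernel d m l X \<partial>?M) * indicator B l \<partial>lborelP {1..d})"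
    proof (rule nn_integral_cong)
      fix l :: "nat \<Rightarrow> real" assume l: "l \<in> space (lborelP {1..d})"
      have "(\<lambda>X :: nat \<Rightarrow> 'a. angle_kernel d m l X) \<in> borel_measurable ?M"
        using measurable_compose[OF measurable_Pair1'[OF l] angle_kernel_measurable] by simp
      then show "(\<integral>\<^sup>+X. angle_kernel d m l X * indicator B l \<partial>?M) = (\<integral>\<^sup>+X. angle_kernel d m l X \<partial>?M) * indicator B l"
        by (rule nn_integral_multc)
    qed
    finally show ?thesis .
  qed
  let ?S = "space (lborelP {1..d}) :: (nat \<Rightarrow> real) set"
  have "(\<integral>\<^sup>+l. (\<integral>\<^sup>+X. angle_kernel d m l X \<partial>?M) \<partial>lborelP {1..d}) = (\<integral>\<^sup>+l. (\<integral>\<^sup>+X. angle_kernel d m l X \<partial>?M) * indicator ?S l \<partial>lborelP {1..d})"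
    by (rule nn_integral_cong) simp
  also have "\<dots> = (\<integral>\<^sup>+X. ennreal (exp (- (\<Sum>i\<le>d. m i * (norm (X i))\<^sup>2))) * (inverse (total_mass d X) * gauss_mass d ?S X) \<partial>?M)"
    by (rule swap[symmetric]) simp
  \<comment> \<open>Almost surely the simplex is in general position; then the total mass cancels
    against its inverse and the share of the whole space is 1.\<close>
  also have "\<dots> = (\<integral>\<^sup>+X. (\<Prod>i\<le>d. ennreal (exp (- m i * (norm (X i))\<^sup>2))) \<partial>?M)"
  proof (rule nn_integral_cong_AE, rule eventually_mono[OF AE_general_position[where 'a='a, folded d_def]])
    fix X :: "nat \<Rightarrow> 'a" assume gp: "general_position d X"
    have "gauss_mass d ?S X = total_mass d X"
      unfolding gauss_mass_def total_mass_def by (rule nn_integral_cong) simp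
    moreover have "inverse (total_mass d X) * total_mass d X = 1"
      using total_mass_finite[OF gp[unfolded d_def]] unfolding d_def by (intro ennreal_inverse_mult_self)
    ultimately show "ennreal (exp (- (\<Sum>i\<le>d. m i * (norm (X i))\<^sup>2))) * (inverse (total_mass d X) * gauss_mass d ?S X) =
        (\<Prod>i\<le>d. ennreal (exp (- m i * (norm (X i))\<^sup>2)))"
      by (simp add: prod_ennreal exp_sum sum_negf[symmetric])
  qed
  also have "\<dots> = (\<Prod>i\<le>d. \<integral>\<^sup>+x. ennreal (exp (- m i * (norm (x :: 'a))\<^sup>2)) \<partial>lborel)"
    by (rule lborel_prod.product_nn_integral_prod) auto
  also have "\<dots> = (\<Prod>i\<le>d. ennreal (sqrt (pi / m i) ^ d))"
    using m unfolding d_def by (intro prod.cong refl nn_integral_gaussian_euclidean) auto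
  also have "\<dots> = ennreal (\<Prod>i\<le>d. sqrt (pi / m i) ^ d)"
    by (rule prod_ennreal) (use m in \<open>auto intro!: zero_le_power divide_nonneg_pos\<close>)
  finally have R: "(\<integral>\<^sup>+l. (\<integral>\<^sup>+X. angle_kernel d m l X \<partial>?M) \<partial>lborelP {1..d}) = ennreal (\<Prod>i\<le>d. sqrt (pi / m i) ^ d)" .
  define P where "P = (\<Prod>i\<le>d. sqrt (pi / m i) ^ d)"
  have P: "P \<ge> 0" unfolding P_def by (intro prod_nonneg) (use m in \<open>auto intro!: zero_le_power divide_nonneg_pos\<close>)
  define RA where "RA = (\<integral>\<^sup>+l. (\<integral>\<^sup>+X. angle_kernel d m l X \<partial>?M) * indicator A l \<partial>lborelP {1..d})"
  have "RA * (\<integral>\<^sup>+l. ennreal (exp (- qform d m l)) \<partial>lborelP {1..d}) =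
    (\<integral>\<^sup>+l. ennreal (exp (- qform d m l)) * indicator A l \<partial>lborelP {1..d}) * (\<integral>\<^sup>+l. (\<integral>\<^sup>+X. angle_kernel d m l X \<partial>?M) \<partial>lborelP {1..d})"
    unfolding RA_def
  proof (rule gaussian_simplex_angle[OF m _ A cone])
    show "(\<integral>\<^sup>+l. ennreal (exp (- qform d m l)) \<partial>lborelP {1..d}) \<noteq> 0" "(\<integral>\<^sup>+l. ennreal (exp (- qform d m l)) \<partial>lborelP {1..d}) \<noteq> \<infinity>"
      unfolding Dint using D by auto
  qed (auto simp: d_def)
  then have RD: "RA * ennreal D = cone_gauss d A m * ennreal P"
    unfolding R Dint P_def[symmetric] cone_gauss_def .
  have D1: "ennreal D * ennreal (1 / D) = 1" "ennreal P * ennreal (1 / D) = ennreal (P / D)"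
    using D P by (simp_all add: ennreal_mult'[symmetric])
  have "RA = (RA * ennreal D) * ennreal (1 / D)" by (simp add: mult.assoc D1)
  also have "\<dots> = ennreal (P / D) * cone_gauss d A m" unfolding RD mult.assoc D1 by (rule mult.commute)
  finally have "RA = ennreal (P / D) * cone_gauss d A m" .
  then show ?thesis unfolding swap[OF A] RA_def P_def D_def .
qed

text \<open>Bookkeeping of exponents: each \<open>m i\<close> receives -d/2 from the Gaussian
  integral over its vertex and -1/2 from sqrt (prod m). The factor sqrt (sum m) is the only one that
  does not split over the vertices.\<close>

lemma mixing_weight_angle:
  fixes m :: "nat \<Rightarrow> real"
  assumes m: "\<And>i. i \<le> d \<Longrightarrow> m i > 0"
  shows "mixing_weight d (\<beta> - 1) m * ennreal ((\<Prod>i\<le>d. sqrt (pi / m i) ^ d) / (sqrt pi ^ d * sqrt (prod m {..d} / sum m {..d}))) =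
    ennreal ((pi powr (real d / 2)) ^ Suc d / sqrt pi ^ d) * (mixing_weight d (\<beta> - real d / 2 - 3/2) m * ennreal (sqrt (sum m {..d})))"
proof -
  have w: "mixing_weight d r m = ennreal (\<Prod>i\<le>d. m i powr r)" for r
    unfolding mixing_weight_def using m by (subst prod_ennreal[symmetric]) auto
  have sp: "sqrt (prod m {..d} / sum m {..d}) = (\<Prod>i\<le>d. sqrt (m i)) / sqrt (sum m {..d})"
  proof -
    have "sqrt (prod m {..d}) = (\<Prod>i\<le>d. sqrt (m i))" by (induction d) (simp_all add: real_sqrt_mult)
    then show ?thesis by (simp add: real_sqrt_divide)
  qed
  have "(\<Prod>i\<le>d. m i powr (\<beta> - 1)) * (\<Prod>i\<le>d. sqrt (pi / m i) ^ d) / (\<Prod>i\<le>d. sqrt (m i)) =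
      (\<Prod>i\<le>d. m i powr (\<beta> - 1) * sqrt (pi / m i) ^ d / sqrt (m i))"
    by (simp add: prod_dividef prod.distrib)
  also have "\<dots> = (\<Prod>i\<le>d. pi powr (real d / 2) * m i powr (\<beta> - real d / 2 - 3/2))"
  proof (rule prod.cong[OF refl])
    fix i assume "i \<in> {..d}"
    then have mi: "m i > 0" using m by simp
    have p: "m i powr (\<beta> - 1) * m i powr (- (real d / 2)) * m i powr (- (1/2)) = m i powr (\<beta> - real d / 2 - 3/2)"
      unfolding powr_add[symmetric] by (simp add: field_simps)
    have q: "1 / sqrt (m i) = m i powr (- (1/2))" using mi by (simp add: powr_minus_divide powr_half_sqrt)
    have "m i powr (\<beta> - 1) * sqrt (pi / m i) ^ d / sqrt (m i) =
        pi powr (real d / 2) * (m i powr (\<beta> - 1) * m i powr (- (real d / 2)) * (1 / sqrt (m i)))"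
      unfolding sqrt_pi_div_power[OF mi] by simp
    then show "m i powr (\<beta> - 1) * sqrt (pi / m i) ^ d / sqrt (m i) = pi powr (real d / 2) * m i powr (\<beta> - real d / 2 - 3/2)"
      unfolding q p .
  qed
  also have "\<dots> = (pi powr (real d / 2)) ^ Suc d * (\<Prod>i\<le>d. m i powr (\<beta> - real d / 2 - 3/2))"
    by (simp add: prod.distrib)
  finally have e: "(\<Prod>i\<le>d. m i powr (\<beta> - 1)) * (\<Prod>i\<le>d. sqrt (pi / m i) ^ d) / (\<Prod>i\<le>d. sqrt (m i)) =
    (pi powr (real d / 2)) ^ Suc d * (\<Prod>i\<le>d. m i powr (\<beta> - real d / 2 - 3/2))" .
  have nn: "0 \<le> (\<Prod>i\<le>d. m i powr (\<beta> - 1))" "0 \<le> (\<Prod>i\<le>d. m i powr (\<beta> - real d / 2 - 3/2))" by (auto intro!: prod_nonneg)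
  have n2: "0 \<le> (pi powr (real d / 2)) ^ Suc d / sqrt pi ^ d" by simp
  have "(\<Prod>i\<le>d. m i powr (\<beta> - 1)) * ((\<Prod>i\<le>d. sqrt (pi / m i) ^ d) / (sqrt pi ^ d * ((\<Prod>i\<le>d. sqrt (m i)) / sqrt (sum m {..d})))) =
      ((\<Prod>i\<le>d. m i powr (\<beta> - 1)) * (\<Prod>i\<le>d. sqrt (pi / m i) ^ d) / (\<Prod>i\<le>d. sqrt (m i))) * (sqrt (sum m {..d}) / sqrt pi ^ d)"
    by (simp add: mult_ac)
  also have "\<dots> = (pi powr (real d / 2)) ^ Suc d / sqrt pi ^ d * ((\<Prod>i\<le>d. m i powr (\<beta> - real d / 2 - 3/2)) * sqrt (sum m {..d}))"
    unfolding e by (simp add: mult_ac)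
  finally show ?thesis
    unfolding w sp ennreal_mult'[OF nn(1), symmetric] ennreal_mult'[OF nn(2), symmetric] ennreal_mult'[OF n2, symmetric] by simp
qed

text \<open>The collected constants of the mixture and of the Gaussian integrals. Independent of the
  cone, they are eliminated by comparison with the whole space.\<close>

definition angle_const :: "nat \<Rightarrow> real \<Rightarrow> ennreal" where
  "angle_const d \<beta> = ennreal (betap_const d \<beta> / Gamma \<beta>) ^ Suc d * ennreal ((pi powr (real d / 2)) ^ Suc d / sqrt pi ^ d)"

text \<open>Each vertex density is replaced by its Gamma mixture; exchanging the integrals turns the
  expectation into an average over \<open>m\<close> of the Gaussian case with \<open>m\<close>
  fixed.\<close>

lemma expected_cone_probability:
  fixes \<beta> :: real
  defines "d \<equiv> DIM('a::euclidean_space)"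
  assumes \<beta>: "\<beta> > real d / 2" and A: "A \<in> sets (lborelP {1..d})"
    and cone: "\<And>s x. s > 0 \<Longrightarrow> x \<in> space (lborelP {1..d}) \<Longrightarrow> (\<lambda>i\<in>{1..d}. s * x i) \<in> A \<longleftrightarrow> x \<in> A"
  shows "(\<integral>\<^sup>+X. inverse (total_mass d X) * gauss_mass d A X \<partial>(PiM {..d} (\<lambda>_. betap_measure \<beta> :: 'a measure))) =
    angle_const d \<beta> * gamma_average d A (\<beta> - real d / 2) 1"
proof -
  let ?M = "lborelP {..d} :: (nat \<Rightarrow> 'a) measure"
  define F where "F = (\<lambda>X :: nat \<Rightarrow> 'a. inverse (total_mass d X) * gauss_mass d A X)"
  have F: "F \<in> borel_measurable ?M"
    unfolding F_def using gauss_mass_measurable[OF A] total_mass_measurable by measurable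
  define K where "K = ennreal (betap_const d \<beta> / Gamma \<beta>)"
  define N where "N = (\<lambda>m (X :: nat \<Rightarrow> 'a). \<Sum>i\<le>d. m i * (norm (X i))\<^sup>2)"
  define G where "G = (\<lambda>m. K ^ Suc d * mixing_weight d (\<beta> - 1) m * ennreal (exp (- sum m {..d})))"
  have G: "G \<in> borel_measurable (lborelP {..d})" unfolding G_def by measurable
  have dens: "(\<Prod>i\<le>d. ennreal (betap_density \<beta> (X i))) = (\<integral>\<^sup>+m. G m * ennreal (exp (- N m X)) \<partial>lborelP {..d})" for X :: "nat \<Rightarrow> 'a"
  proof -
    have "(\<Prod>i\<le>d. ennreal (betap_density \<beta> (X i))) =
      (\<integral>\<^sup>+m. (\<Prod>i\<le>d. K * (ennreal (m i powr (\<beta> - 1) * exp (- m i)) * indicator {0<..} (m i) * ennreal (exp (- (m i * (norm (X i))\<^sup>2))))) \<partial>lborelP {..d})"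
      unfolding betap_density_mixture[OF \<beta>[unfolded d_def]] K_def[unfolded d_def, symmetric]
      by (rule lborel_prod.product_nn_integral_prod[symmetric]) auto
    also have "\<dots> = (\<integral>\<^sup>+m. G m * ennreal (exp (- N m X)) \<partial>lborelP {..d})"
    proof (rule nn_integral_cong)
      fix m :: "nat \<Rightarrow> real"
      have "(\<Prod>i\<le>d. K * (ennreal (m i powr (\<beta> - 1) * exp (- m i)) * indicator {0<..} (m i) * ennreal (exp (- (m i * (norm (X i))\<^sup>2))))) =
        (\<Prod>i\<le>d. K * ((ennreal (m i powr (\<beta> - 1)) * indicator {0<..} (m i)) * (ennreal (exp (- m i)) * ennreal (exp (- (m i * (norm (X i))\<^sup>2))))))"
        by (intro prod.cong refl) (simp add: ennreal_mult' mult_ac)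
      also have "\<dots> = K ^ Suc d * (mixing_weight d (\<beta> - 1) m * ((\<Prod>i\<le>d. ennreal (exp (- m i))) * (\<Prod>i\<le>d. ennreal (exp (- (m i * (norm (X i))\<^sup>2))))))"
        unfolding prod.distrib mixing_weight_def by simp
      also have "(\<Prod>i\<le>d. ennreal (exp (- m i))) = ennreal (exp (- sum m {..d}))"
        by (simp add: prod_ennreal exp_sum sum_negf[symmetric])
      also have "(\<Prod>i\<le>d. ennreal (exp (- (m i * (norm (X i))\<^sup>2)))) = ennreal (exp (- N m X))"
        unfolding N_def by (simp add: prod_ennreal exp_sum sum_negf[symmetric])
      finally show "(\<Prod>i\<le>d. K * (ennreal (m i powr (\<beta> - 1) * exp (- m i)) * indicator {0<..} (m i) * ennreal (exp (- (m i * (norm (X i))\<^sup>2))))) =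
        G m * ennreal (exp (- N m X))"
        unfolding G_def by (simp only: mult.assoc)
    qed
    finally show ?thesis .
  qed
  have N2: "(\<lambda>x. N (snd x) (fst x)) \<in> borel_measurable (?M \<Otimes>\<^sub>M lborelP {..d})"
    unfolding N_def by measurable
  have meas: "(\<lambda>(X, m). G m * ennreal (exp (- N m X)) * F X) \<in> borel_measurable (?M \<Otimes>\<^sub>M lborelP {..d})"
  proof -
    note [measurable] = N2 measurable_compose[OF measurable_snd G] measurable_compose[OF measurable_fst F]
    show ?thesis unfolding split_beta' by measurable
  qed
  have N1: "(\<lambda>X. N m X) \<in> borel_measurable ?M" for m unfolding N_def by measurable
  have N3: "(\<lambda>m. N m X) \<in> borel_measurable (lborelP {..d})" for X unfolding N_def by measurable
  have "(\<integral>\<^sup>+X. F X \<partial>(PiM {..d} (\<lambda>_. betap_measure \<beta> :: 'a measure))) = (\<integral>\<^sup>+X. (\<Prod>i\<le>d. ennreal (betap_density \<beta> (X i))) * F X \<partial>?M)"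
  proof -
    have ps: "prob_space (density lborel (\<lambda>x :: 'a. ennreal (betap_density \<beta> x)))"
      using prob_space_betap_measure[OF \<beta>[unfolded d_def]] unfolding betap_measure_def .
    show ?thesis
      unfolding betap_measure_def by (subst PiM_density[OF _ ps], simp, measurable, rule nn_integral_density[OF _ F], measurable)
  qed
  also have "\<dots> = (\<integral>\<^sup>+X. \<integral>\<^sup>+m. G m * ennreal (exp (- N m X)) * F X \<partial>lborelP {..d} \<partial>?M)"
  proof (rule nn_integral_cong)
    fix X :: "nat \<Rightarrow> 'a"
    note [measurable] = G N3
    have "(\<lambda>m. G m * ennreal (exp (- N m X))) \<in> borel_measurable (lborelP {..d})" by measurable
    from nn_integral_multc[OF this, of "F X"] show "(\<Prod>i\<le>d. ennreal (betap_density \<beta> (X i))) * F X = (\<integral>\<^sup>+m. G m * ennreal (exp (- N m X)) * F X \<partial>lborelP {..d})"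
      unfolding dens by simp
  qed
  also have "\<dots> = (\<integral>\<^sup>+m. \<integral>\<^sup>+X. G m * ennreal (exp (- N m X)) * F X \<partial>?M \<partial>lborelP {..d})"
    by (rule nn_integral_swap[OF _ _ meas]) simp_all
  also have "\<dots> = (\<integral>\<^sup>+m. angle_const d \<beta> * (mixing_weight d (\<beta> - real d / 2 - 3/2) m * ennreal (sqrt (sum m {..d})) * cone_gauss d A m * ennreal (exp (- 1 * sum m {..d}))) \<partial>lborelP {..d})"
  proof (rule nn_integral_cong)
    fix m :: "nat \<Rightarrow> real"
    note [measurable] = N1 F
    have "(\<lambda>X. ennreal (exp (- N m X)) * F X) \<in> borel_measurable ?M" by measurable
    from nn_integral_cmult[OF this, of "G m"]
    have "(\<integral>\<^sup>+X. G m * ennreal (exp (- N m X)) * F X \<partial>?M) = G m * (\<integral>\<^sup>+X. ennreal (exp (- N m X)) * F X \<partial>?M)"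
      by (simp only: mult.assoc)
    also have "\<dots> = angle_const d \<beta> * (mixing_weight d (\<beta> - real d / 2 - 3/2) m * ennreal (sqrt (sum m {..d})) * cone_gauss d A m * ennreal (exp (- 1 * sum m {..d})))"
    proof (cases "\<forall>i\<le>d. m i > 0")
      case False
      then obtain i where i: "i \<le> d" "\<not> m i > 0" by auto
      then have "mixing_weight d r m = 0" for r unfolding mixing_weight_def by (intro prod_zero bexI[of _ i]) auto
      then show ?thesis by (simp add: G_def)
    next
      case True
      then have m: "\<And>i. i \<le> d \<Longrightarrow> m i > 0" by simp
      have "(\<integral>\<^sup>+X. ennreal (exp (- N m X)) * F X \<partial>?M) =
          ennreal ((\<Prod>i\<le>d. sqrt (pi / m i) ^ d) / (sqrt pi ^ d * sqrt (prod m {..d} / sum m {..d}))) * cone_gauss d A m" (is "_ = ?c * _")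
        unfolding N_def F_def d_def by (rule gaussian_angle_average) (use m A cone in \<open>auto simp: d_def\<close>)
      then have "G m * (\<integral>\<^sup>+X. ennreal (exp (- N m X)) * F X \<partial>?M) =
          K ^ Suc d * (mixing_weight d (\<beta> - 1) m * ?c) * (ennreal (exp (- sum m {..d})) * cone_gauss d A m)"
        unfolding G_def by (simp only: mult_ac)
      also have "\<dots> = angle_const d \<beta> * (mixing_weight d (\<beta> - real d / 2 - 3/2) m * ennreal (sqrt (sum m {..d})) * cone_gauss d A m * ennreal (exp (- 1 * sum m {..d})))"
      proof -
        have key: "mixing_weight d (\<beta> - 1) m * ?c = ennreal ((pi powr (real d / 2)) ^ Suc d / sqrt pi ^ d) *
            (mixing_weight d (\<beta> - real d / 2 - 3/2) m * ennreal (sqrt (sum m {..d})))"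
          by (rule mixing_weight_angle[OF m])
        show ?thesis unfolding key angle_const_def K_def[symmetric] mult_minus1 by (simp only: mult_ac)
      qed
      finally show ?thesis .
    qed
    finally show "(\<integral>\<^sup>+X. G m * ennreal (exp (- N m X)) * F X \<partial>?M) = \<dots>" .
  qed
  also have "\<dots> = angle_const d \<beta> * gamma_average d A (\<beta> - real d / 2) 1"
    unfolding gamma_average_def
    by (rule nn_integral_cmult) (use cone_gauss_measurable[OF A] in measurable)
  finally show ?thesis unfolding F_def .
qed

lemma AE_betap_general_position:
  assumes \<beta>: "\<beta> > real DIM('a) / 2"
  shows "AE X in PiM {..DIM('a)} (\<lambda>_. betap_measure \<beta> :: 'a::euclidean_space measure). general_position DIM('a) X"
proof -
  have ps: "prob_space (density lborel (\<lambda>x :: 'a. ennreal (betap_density \<beta> x)))"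
    using prob_space_betap_measure[OF \<beta>] unfolding betap_measure_def .
  have f: "(\<lambda>X. \<Prod>i\<le>DIM('a). ennreal (betap_density \<beta> (X i :: 'a))) \<in> borel_measurable (lborelP {..DIM('a)})"
    by measurable
  have "PiM {..DIM('a)} (\<lambda>_. betap_measure \<beta> :: 'a measure) =
      density (lborelP {..DIM('a)}) (\<lambda>X. \<Prod>i\<le>DIM('a). ennreal (betap_density \<beta> (X i)))"
    unfolding betap_measure_def by (rule PiM_density[OF _ ps]) auto
  note eq = this
  show ?thesis
    unfolding eq by (subst AE_density[OF f], rule eventually_mono[OF AE_general_position]) simp
qed

text \<open>The share of the whole space is almost surely 1, which normalizes the constants, and the
  factor \<open>\<kappa>\<close> between \<open>cone_integral\<close> and
  \<open>gamma_average\<close> is common to both sets. The equation is multiplicative because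
  finiteness of the whole-space integral becomes known only with its explicit value.\<close>

lemma expected_cone_probability_ratio:
  fixes \<beta> :: real
  defines "d \<equiv> DIM('a::euclidean_space)"
  assumes \<beta>: "\<beta> > real d / 2" and A: "A \<in> sets (lborelP {1..d})"
    and cone: "\<And>s x. s > 0 \<Longrightarrow> x \<in> space (lborelP {1..d}) \<Longrightarrow> (\<lambda>i\<in>{1..d}. s * x i) \<in> A \<longleftrightarrow> x \<in> A"
  shows "(\<integral>\<^sup>+X. inverse (total_mass d X) * gauss_mass d A X \<partial>(PiM {..d} (\<lambda>_. betap_measure \<beta> :: 'a measure))) *
      cone_integral d (space (lborelP {1..d})) (\<beta> - real d / 2) = cone_integral d A (\<beta> - real d / 2)"
    "cone_integral d (space (lborelP {1..d})) (\<beta> - real d / 2) \<noteq> 0"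
proof -
  let ?S = "space (lborelP {1..d}) :: (nat \<Rightarrow> real) set"
  let ?P = "PiM {..d} (\<lambda>_. betap_measure \<beta> :: 'a measure)"
  let ?s = "\<beta> - real d / 2"
  interpret prob_space "betap_measure \<beta> :: 'a measure" by (rule prob_space_betap_measure) (use \<beta> d_def in simp)
  interpret P: product_prob_space "\<lambda>_. betap_measure \<beta> :: 'a measure" "{..d}" ..
  have S: "?S \<in> sets (lborelP {1..d})" by simp
  have coneS: "(\<lambda>i\<in>{1..d}. s * x i) \<in> ?S \<longleftrightarrow> x \<in> ?S" if "x \<in> ?S" for s x
    using that by (auto simp: space_PiM)
  have "1 = (\<integral>\<^sup>+X. 1 \<partial>?P)" using P.emeasure_space_1 by simp
  also have "\<dots> = (\<integral>\<^sup>+X. inverse (total_mass d X) * gauss_mass d ?S X \<partial>?P)"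
  proof (rule nn_integral_cong_AE, rule eventually_mono[OF AE_betap_general_position[OF \<beta>[unfolded d_def], folded d_def]])
    fix X :: "nat \<Rightarrow> 'a" assume gp: "general_position d X"
    have "gauss_mass d ?S X = total_mass d X"
      unfolding gauss_mass_def total_mass_def by (rule nn_integral_cong) simp
    then show "1 = inverse (total_mass d X) * gauss_mass d ?S X"
      using total_mass_finite[OF gp[unfolded d_def]] unfolding d_def by (simp add: ennreal_inverse_mult_self)
  qed
  also have "\<dots> = angle_const d \<beta> * gamma_average d ?S ?s 1"
    unfolding d_def by (rule expected_cone_probability) (use \<beta> coneS in \<open>auto simp: d_def\<close>)
  finally have one: "angle_const d \<beta> * gamma_average d ?S ?s 1 = 1" ..
  define \<kappa> where "\<kappa> = (\<integral>\<^sup>+\<mu>. ennreal (1 / sqrt pi * (1 + \<mu>\<^sup>2) powr (- (?s * (real d + 1)))) \<partial>lborel)"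
  have HS: "cone_integral d ?S ?s = \<kappa> * gamma_average d ?S ?s 1"
    unfolding \<kappa>_def by (rule cone_integral_eq_gamma_average[OF S]) (use coneS in auto)
  have HA: "cone_integral d A ?s = \<kappa> * gamma_average d A ?s 1"
    unfolding \<kappa>_def by (rule cone_integral_eq_gamma_average[OF A]) (rule cone)
  have EA: "(\<integral>\<^sup>+X. inverse (total_mass d X) * gauss_mass d A X \<partial>?P) = angle_const d \<beta> * gamma_average d A ?s 1"
    unfolding d_def by (rule expected_cone_probability) (use \<beta> A cone in \<open>auto simp: d_def\<close>)
  have "(\<integral>\<^sup>+X. inverse (total_mass d X) * gauss_mass d A X \<partial>?P) * cone_integral d ?S ?s =
      (angle_const d \<beta> * gamma_average d ?S ?s 1) * (\<kappa> * gamma_average d A ?s 1)"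
    unfolding EA HS by (simp only: mult_ac)
  then show "(\<integral>\<^sup>+X. inverse (total_mass d X) * gauss_mass d A X \<partial>?P) * cone_integral d ?S ?s = cone_integral d A ?s"
    unfolding one HA by simp
  have "\<kappa> \<noteq> 0"
  proof
    assume "\<kappa> = 0"
    then have "AE \<mu> in lborel. ennreal (1 / sqrt pi * (1 + \<mu>\<^sup>2) powr (- (?s * (real d + 1)))) = 0"
      unfolding \<kappa>_def by (subst (asm) nn_integral_0_iff_AE) auto
    then have "AE \<mu> in (lborel :: real measure). False"
    proof (rule eventually_mono)
      fix \<mu> :: real
      have "1 + \<mu>\<^sup>2 > 0" by (simp add: add_pos_nonneg)
      then have "1 / sqrt pi * (1 + \<mu>\<^sup>2) powr (- (?s * (real d + 1))) > 0" by (intro mult_pos_pos) auto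
      then show "ennreal (1 / sqrt pi * (1 + \<mu>\<^sup>2) powr (- (?s * (real d + 1)))) = 0 \<Longrightarrow> False"
        by (metis ennreal_eq_0_iff not_le)
    qed
    then have "(\<integral>\<^sup>+\<mu>. 1 \<partial>(lborel :: real measure)) = (\<integral>\<^sup>+\<mu>. 0 \<partial>(lborel :: real measure))"
      by (intro nn_integral_cong_AE) (auto elim: eventually_mono)
    then show False by simp
  qed
  moreover have "gamma_average d ?S ?s 1 \<noteq> 0" using one by auto
  ultimately show "cone_integral d ?S ?s \<noteq> 0" unfolding HS by simp
qed

section \<open>Arithmetic of the cone integrals\<close>

lemma Gamma_half_nnrat: "\<exists>q\<in>nnrat. Gamma (real p + 1/2) = sqrt pi * q"
proof (induction p)
  case 0
  show ?case by (intro bexI[of _ 1]) (auto simp: Gamma_one_half_real)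
next
  case (Suc p)
  then obtain q where q: "q \<in> nnrat" "Gamma (real p + 1/2) = sqrt pi * q" by blast
  have "real p + 1/2 > 0" by simp
  then have "Gamma (real p + 1/2 + 1) = (real p + 1/2) * Gamma (real p + 1/2)"
    by (intro Gamma_plus1) (auto elim!: nonpos_Ints_cases)
  then have "Gamma (real (Suc p) + 1/2) = sqrt pi * ((real p + 1/2) * q)"
    using q by (simp add: add_ac)
  moreover have "(real p + 1/2) * q \<in> nnrat" using q by auto
  ultimately show ?case by blast
qed

text \<open>The kernel is even, so the sign of the compensating weight at 0 drops out.\<close>

lemma cone_integral_integrand:
  "(\<Prod>i\<le>d. bessel s (bary d l i)) = bessel s (\<Sum>i=1..d. l i) * (\<Prod>i=1..d. bessel s (l i))"
proof -
  have "{..d} = insert 0 {1..d}" by auto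
  moreover have "(\<Prod>i=1..d. bessel s (bary d l i)) = (\<Prod>i=1..d. bessel s (l i))"
    by (intro prod.cong) (auto simp: bary_def)
  ultimately show ?thesis by (simp add: bary_def)
qed

text \<open>The weights 0, ..., k - 1 are free and integrate to a k-fold convolution at the sum of
  the constrained ones, where it is a polynomial times an exponential. Its powers of sqrt pi are k -
  1 from the convolutions, k from \<open>Gamma s ^ k\<close> and 1 from the kernel of integer index,
  in total pi^k. The value k = d + 1 is included: then nothing is constrained and the cone is the
  whole space.\<close>

lemma cone_integral_even:
  assumes k: "even k" "2 \<le> k" "k \<le> d + 1"
  shows "\<exists>\<rho>\<in>nnrat. cone_integral d {l \<in> space (lborelP {1..d}). \<forall>i\<in>{k..d}. 0 \<le> l i} (real p + 1/2) = ennreal (pi ^ k * \<rho>)"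
proof -
  define s where "s = real p + 1/2"
  have s: "s > 0" unfolding s_def by simp
  define I where "I = {k..d}"
  define J where "J = {1..<k}"
  have IJ: "I \<inter> J = {}" "finite I" "finite J" "I \<union> J = {1..d}" using k by (auto simp: I_def J_def)
  have cJ: "card J = k - 1" by (simp add: J_def)
  obtain h where h: "k = 2 * h" "h > 0" using k by (auto elim!: evenE)
  \<comment> \<open>Chosen so that \<open>Suc j\<close> = k s = k p + k/2, an integer because k is
    even.\<close>
  define j where "j = k * p + h - 1"
  have j: "s + real (card J) * s = real (Suc j)"
  proof -
    have "s + real (card J) * s = real k * s" using k by (simp add: cJ of_nat_diff algebra_simps)
    also have "\<dots> = real (k * p + h)" by (simp add: s_def h algebra_simps)
    also have "k * p + h = Suc j" using h by (simp add: j_def)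
    finally show ?thesis .
  qed
  obtain P where P: "nnrat_poly P" "\<And>x. x \<ge> 0 \<Longrightarrow> bessel (real (Suc j)) x = ennreal (sqrt pi * poly P x * exp (- 2 * x))"
    using bessel_nat[of j] by blast
  obtain r where r: "nnrat_poly r" "\<And>x. x \<ge> 0 \<Longrightarrow> (\<integral>\<^sup>+l. (\<Prod>i\<in>I. bessel s (l i) * indicator {0<..} (l i)) *
     ennreal (exp (- 2 * (\<Sum>i\<in>I. l i)) * poly P (x + (\<Sum>i\<in>I. l i))) \<partial>lborelP I) = ennreal (poly r x)"
    using bessel_poly_shift_PiM[OF IJ(2) P(1), of p] unfolding s_def by blast
  obtain q where q: "q \<in> nnrat" "Gamma s = sqrt pi * q" using Gamma_half_nnrat unfolding s_def by blast
  define c where "c = sqrt pi ^ card J * (Gamma s * Gamma s ^ card J / Gamma (s + card J * s))"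
  have c0: "c \<ge> 0" unfolding c_def j using Gamma_real_pos[OF s] Gamma_real_pos[of "real (Suc j)"]
    by (intro mult_nonneg_nonneg divide_nonneg_pos) auto
  \<comment> \<open>Strict positivity in place of nonnegativity, as in the moment integrals; the
    difference is the null set where some weight vanishes.\<close>
  define f where "f = (\<lambda>l. bessel s (\<Sum>i\<in>{1..d}. l i) * (\<Prod>i\<in>{1..d}. bessel s (l i)) * (\<Prod>i\<in>I. indicator {0<..} (l i)))"
  have f: "f \<in> borel_measurable (lborelP (I \<union> J))"
    unfolding f_def IJ(4)[symmetric] by measurable
  have "cone_integral d {l \<in> space (lborelP {1..d}). \<forall>i\<in>{k..d}. 0 \<le> l i} s = (\<integral>\<^sup>+l. f l \<partial>lborelP {1..d})"
    unfolding cone_integral_def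
  proof (rule nn_integral_cong_AE)
    have "AE l in (lborelP {1..d} :: (nat \<Rightarrow> real) measure). \<forall>i\<in>I. l i \<noteq> 0"
      by (subst AE_ball_countable) (use IJ in \<open>auto intro!: AE_lborelP_component\<close>)
    moreover have "AE l in (lborelP {1..d} :: (nat \<Rightarrow> real) measure). l \<in> space (lborelP {1..d})" by simp
    ultimately show "AE l in lborelP {1..d}. (\<Prod>i\<le>d. bessel s (bary d l i)) * indicator {l \<in> space (lborelP {1..d}). \<forall>i\<in>{k..d}. 0 \<le> l i} l = f l"
    proof eventually_elim
      fix l :: "nat \<Rightarrow> real" assume l: "\<forall>i\<in>I. l i \<noteq> 0" "l \<in> space (lborelP {1..d})"
      have "indicator {l \<in> space (lborelP {1..d}). \<forall>i\<in>{k..d}. 0 \<le> l i} l = (\<Prod>i\<in>I. indicator {0<..} (l i) :: ennreal)"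
      proof (cases "\<forall>i\<in>I. 0 \<le> l i")
        case True
        then have "(\<Prod>i\<in>I. indicator {0<..} (l i) :: ennreal) = 1" using l(1) by (intro prod.neutral) force
        then show ?thesis using True l(2) by (simp add: I_def)
      next
        case False
        then obtain i where "i \<in> I" "\<not> 0 \<le> l i" by auto
        then have "(\<Prod>i\<in>I. indicator {0<..} (l i) :: ennreal) = 0" using IJ(2) by (intro prod_zero bexI[of _ i]) auto
        then show ?thesis using False by (simp add: I_def)
      qed
      then show "(\<Prod>i\<le>d. bessel s (bary d l i)) * indicator {l \<in> space (lborelP {1..d}). \<forall>i\<in>{k..d}. 0 \<le> l i} l = f l"
        unfolding f_def cone_integral_integrand by simp
    qed
  qed
  \<comment> \<open>\<open>x\<close> holds the constrained weights and \<open>y\<close> the free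
    ones other than the weight at 0.\<close>
  also have "\<dots> = (\<integral>\<^sup>+x. \<integral>\<^sup>+y. f (merge I J (x, y)) \<partial>lborelP J \<partial>lborelP I)"
    using lborel_prod.product_nn_integral_fold[OF IJ(1-3) f] unfolding IJ(4) .
  also have "\<dots> = (\<integral>\<^sup>+x. ennreal (c * sqrt pi) * ((\<Prod>i\<in>I. bessel s (x i) * indicator {0<..} (x i)) *
     ennreal (exp (- 2 * (\<Sum>i\<in>I. x i)) * poly P (0 + (\<Sum>i\<in>I. x i)))) \<partial>lborelP I)"
  proof (rule nn_integral_cong)
    fix x :: "nat \<Rightarrow> real"
    define S where "S = (\<Sum>i\<in>I. x i)"
    define w where "w = (\<Prod>i\<in>I. bessel s (x i) * indicator {0<..} (x i))"
    have "f (merge I J (x, y)) = w * (bessel s (S + (\<Sum>i\<in>J. y i)) * (\<Prod>i\<in>J. bessel s (y i)))" for y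
    proof -
      have m1: "merge I J (x, y) i = x i" if "i \<in> I" for i using that by (simp add: merge_def)
      have m2: "merge I J (x, y) i = y i" if "i \<in> J" for i using that IJ(1) by (auto simp: merge_def)
      have "(\<Sum>i\<in>I \<union> J. merge I J (x, y) i) = S + (\<Sum>i\<in>J. y i)"
      proof -
        have "(\<Sum>i\<in>I. merge I J (x, y) i) = S" unfolding S_def by (rule sum.cong) (simp_all add: m1)
        moreover have "(\<Sum>i\<in>J. merge I J (x, y) i) = (\<Sum>i\<in>J. y i)" by (rule sum.cong) (simp_all add: m2)
        ultimately show ?thesis unfolding sum.union_disjoint[OF IJ(2,3,1)] by simp
      qed
      moreover have "(\<Prod>i\<in>I \<union> J. bessel s (merge I J (x, y) i)) = (\<Prod>i\<in>I. bessel s (x i)) * (\<Prod>i\<in>J. bessel s (y i))"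
        unfolding prod.union_disjoint[OF IJ(2,3,1)] by (simp add: m1 m2)
      moreover have "(\<Prod>i\<in>I. indicator {0<..} (merge I J (x, y) i) :: ennreal) = (\<Prod>i\<in>I. indicator {0<..} (x i))"
        by (simp add: m1)
      ultimately show ?thesis unfolding f_def IJ(4) w_def prod.distrib by (simp only: mult_ac)
    qed
    then have "(\<integral>\<^sup>+y. f (merge I J (x, y)) \<partial>lborelP J) = w * (\<integral>\<^sup>+y. bessel s (S + (\<Sum>i\<in>J. y i)) * (\<Prod>i\<in>J. bessel s (y i)) \<partial>lborelP J)"
      by (simp only:) (rule nn_integral_cmult, measurable)
    also have "\<dots> = w * (ennreal c * bessel (real (Suc j)) S)"
      unfolding bessel_convolution_PiM[OF IJ(3) s s] j c_def ..
    also have "\<dots> = ennreal (c * sqrt pi) * (w * ennreal (exp (- 2 * S) * poly P (0 + S)))"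
    proof (cases "\<forall>i\<in>I. 0 < x i")
      case True
      then have S: "S \<ge> 0" unfolding S_def by (intro sum_nonneg) auto
      have "ennreal (sqrt pi * poly P S * exp (- 2 * S)) = ennreal (sqrt pi) * ennreal (exp (- 2 * S) * poly P (0 + S))"
        using nnrat_poly_nonneg[OF P(1) S] by (simp add: ennreal_mult'[symmetric] mult_ac)
      moreover have "ennreal (c * sqrt pi) = ennreal c * ennreal (sqrt pi)" using c0 by (rule ennreal_mult')
      ultimately show ?thesis unfolding P(2)[OF S] by (simp only: mult_ac)
    next
      case False
      then obtain i where "i \<in> I" "\<not> 0 < x i" by auto
      then have "w = 0" unfolding w_def using IJ(2) by (intro prod_zero bexI[of _ i]) auto
      then show ?thesis by simp
    qed
    finally show "(\<integral>\<^sup>+y. f (merge I J (x, y)) \<partial>lborelP J) = ennreal (c * sqrt pi) * ((\<Prod>i\<in>I. bessel s (x i) * indicator {0<..} (x i)) *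
     ennreal (exp (- 2 * (\<Sum>i\<in>I. x i)) * poly P (0 + (\<Sum>i\<in>I. x i))))"
      unfolding w_def S_def .
  qed
  also have "\<dots> = ennreal (c * sqrt pi) * ennreal (poly r 0)"
    unfolding r(2)[OF order.refl, symmetric] by (rule nn_integral_cmult) measurable
  also have "\<dots> = ennreal (c * sqrt pi * poly r 0)"
    using c0 by (intro ennreal_mult'[symmetric]) auto
  also have "c * sqrt pi * poly r 0 = pi ^ k * (q ^ k / fact j * poly r 0)"
  proof -
    have kk: "Suc (card J) = k" using k by (simp add: cJ)
    have "Gamma (real (Suc j)) = fact j" using Gamma_fact[of j, where 'a=real] by (simp add: add.commute)
    then have "c * sqrt pi = sqrt pi ^ Suc (card J) * Gamma s ^ Suc (card J) / fact j"
      unfolding c_def j by simp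
    also have "\<dots> = (sqrt pi * sqrt pi) ^ k * (q ^ k / fact j)"
      unfolding kk q(2) power_mult_distrib by (simp only: mult.assoc times_divide_eq_right)
    finally show ?thesis by simp
  qed
  finally have "cone_integral d {l \<in> space (lborelP {1..d}). \<forall>i\<in>{k..d}. 0 \<le> l i} s = ennreal (pi ^ k * (q ^ k / fact j * poly r 0))" .
  moreover have "q ^ k / fact j * poly r 0 \<in> nnrat" using q(1) nnrat_poly_poly[OF r(1), of 0] by auto
  ultimately show ?thesis unfolding s_def by blast
qed

text \<open>The integrand is invariant under l -> -l, which exchanges the two halves. For odd n this
  replaces the whole space by the cone for k = d = n - 1, an even number to which
  \<open>cone_integral_even\<close> applies.\<close>

lemma cone_integral_halfspace:
  assumes d: "d \<ge> 1"
  shows "cone_integral d (space (lborelP {1..d})) s = 2 * cone_integral d {l \<in> space (lborelP {1..d}). \<forall>i\<in>{d..d}. 0 \<le> l i} s"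
proof -
  define F where "F = (\<lambda>l. bessel s (\<Sum>i\<in>{1..d}. l i) * (\<Prod>i\<in>{1..d}. bessel s (l i)))"
  have F: "F \<in> borel_measurable (lborelP {1..d})" unfolding F_def by measurable
  have dd: "d \<in> {1..d}" using d by simp
  have c: "(\<lambda>l. l d) \<in> borel_measurable (lborelP {1..d} :: (nat \<Rightarrow> real) measure)"
    using measurable_component_singleton[OF dd, of "\<lambda>_. lborel :: real measure"] by simp
  have i1: "(\<lambda>l. indicator {0<..} (l d) :: ennreal) \<in> borel_measurable (lborelP {1..d} :: (nat \<Rightarrow> real) measure)"
    and i2: "(\<lambda>l. indicator {..<0} (l d) :: ennreal) \<in> borel_measurable (lborelP {1..d} :: (nat \<Rightarrow> real) measure)"
    by (rule measurable_compose[OF c], simp)+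
  have AE: "AE l in (lborelP {1..d} :: (nat \<Rightarrow> real) measure). l d \<noteq> 0" by (rule AE_lborelP_component[OF _ dd]) simp
  have half: "cone_integral d {l \<in> space (lborelP {1..d}). \<forall>i\<in>{d..d}. 0 \<le> l i} s = (\<integral>\<^sup>+l. F l * indicator {0<..} (l d) \<partial>lborelP {1..d})"
    unfolding cone_integral_def cone_integral_integrand F_def
  proof (rule nn_integral_cong_AE)
    have "AE l in (lborelP {1..d} :: (nat \<Rightarrow> real) measure). l \<in> space (lborelP {1..d})" by simp
    with AE show "AE l in lborelP {1..d}. bessel s (\<Sum>i=1..d. l i) * (\<Prod>i=1..d. bessel s (l i)) * indicator {l \<in> space (lborelP {1..d}). \<forall>i\<in>{d..d}. 0 \<le> l i} l =
        bessel s (\<Sum>i=1..d. l i) * (\<Prod>i=1..d. bessel s (l i)) * indicator {0<..} (l d)"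
      by eventually_elim (auto simp: indicator_def)
  qed
  have "cone_integral d (space (lborelP {1..d})) s = (\<integral>\<^sup>+l. F l * indicator {0<..} (l d) + F l * indicator {..<0} (l d) \<partial>lborelP {1..d})"
    unfolding cone_integral_def cone_integral_integrand F_def
  proof (rule nn_integral_cong_AE)
    have "AE l in (lborelP {1..d} :: (nat \<Rightarrow> real) measure). l \<in> space (lborelP {1..d})" by simp
    with AE show "AE l in lborelP {1..d}. bessel s (\<Sum>i=1..d. l i) * (\<Prod>i=1..d. bessel s (l i)) * indicator (space (lborelP {1..d})) l =
        bessel s (\<Sum>i=1..d. l i) * (\<Prod>i=1..d. bessel s (l i)) * indicator {0<..} (l d) + bessel s (\<Sum>i=1..d. l i) * (\<Prod>i=1..d. bessel s (l i)) * indicator {..<0} (l d)"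
      by eventually_elim (auto simp: indicator_def)
  qed
  also have "\<dots> = (\<integral>\<^sup>+l. F l * indicator {0<..} (l d) \<partial>lborelP {1..d}) + (\<integral>\<^sup>+l. F l * indicator {..<0} (l d) \<partial>lborelP {1..d})"
    by (rule nn_integral_add) (use F i1 i2 in \<open>auto intro!: borel_measurable_times_ennreal\<close>)
  also have "(\<integral>\<^sup>+l. F l * indicator {..<0} (l d) \<partial>lborelP {1..d}) = (\<integral>\<^sup>+l. F l * indicator {0<..} (l d) \<partial>lborelP {1..d})"
  proof -
    have "(\<integral>\<^sup>+l. F l * indicator {..<0} (l d) \<partial>lborelP {1..d}) = ennreal (\<bar>-1\<bar> ^ (DIM(real) * card {1..d})) *
       (\<integral>\<^sup>+l. F (\<lambda>i\<in>{1..d}. 0 + (-1) *\<^sub>R l i) * indicator {..<0} ((\<lambda>i\<in>{1..d}. 0 + (-1) *\<^sub>R l i) d) \<partial>lborelP {1..d})"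
      by (rule nn_integral_lborelP_affine[where y="\<lambda>_. 0"]) (use F i2 in \<open>auto intro!: borel_measurable_times_ennreal\<close>)
    also have "(\<integral>\<^sup>+l. F (\<lambda>i\<in>{1..d}. 0 + (-1) *\<^sub>R l i) * indicator {..<0} ((\<lambda>i\<in>{1..d}. 0 + (-1) *\<^sub>R l i) d) \<partial>lborelP {1..d}) =
        (\<integral>\<^sup>+l. F l * indicator {0<..} (l d) \<partial>lborelP {1..d})"
    proof (rule nn_integral_cong)
      fix l :: "nat \<Rightarrow> real"
      have "F (\<lambda>i\<in>{1..d}. 0 + (-1) *\<^sub>R l i) = F l" unfolding F_def by (simp add: sum_negf)
      then show "F (\<lambda>i\<in>{1..d}. 0 + (-1) *\<^sub>R l i) * indicator {..<0} ((\<lambda>i\<in>{1..d}. 0 + (-1) *\<^sub>R l i) d) = F l * indicator {0<..} (l d)"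
        using dd by (simp add: indicator_def)
    qed
    finally show ?thesis by simp
  qed
  finally show ?thesis unfolding half by (simp add: mult_2)
qed

theorem theorem1p9:
  fixes n k :: nat and \<beta> :: real
  assumes dim: "n = DIM('a::euclidean_space) + 1"
    and k: "k \<in> {1..n}"
    and beta_gt: "\<beta> > (real n - 1) / 2"
    and half_int: "\<exists>m::int. 2 * \<beta> = of_int m"
    and par: "\<exists>m::int. 2 * \<beta> - real n = of_int m \<and> even m"
    and k_even: "even k"
  shows "\<exists>q \<in> \<rat>.
           (if even (n - k) then Jtilde TYPE('a) k \<beta> = q * pi powi (- int (n - k))
            else Jtilde TYPE('a) k \<beta> = q * pi powi (- int (n - k - 1)))"
proof -
  define d where "d = DIM('a)"
  have n: "n = d + 1" using dim by (simp add: d_def)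
  let ?P = "PiM {..<DIM('a) + 1} (\<lambda>_. betap_measure \<beta> :: 'a measure)"
  define ang where "ang = (\<lambda>X :: nat \<Rightarrow> 'a. internal_angle (convex hull (X ` {..<k})) (convex hull (X ` {..<DIM('a) + 1})))"
  \<comment> \<open>The split on integrability also provides the measurability of \<open>ang\<close>
    in the last case.\<close>
  consider "k = n" | "k < n" "\<not> integrable ?P ang" | "k < n" "integrable ?P ang" using k by force
  then show ?thesis
  proof cases
    case 1
    then show ?thesis using n by (intro bexI[of _ 1]) (auto simp: Jtilde_def d_def)
  next
    \<comment> \<open>the Bochner integral of a function that is not integrable is 0\<close>
    case 2
    then have "Jtilde TYPE('a) k \<beta> = 0"
      using n unfolding Jtilde_def ang_def by (simp add: not_integrable_integral_eq d_def)
    then show ?thesis by (intro bexI[of _ 0]) auto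
  next
    case 3
    have k2: "2 \<le> k" using k k_even by (cases "k = 1") auto
    have kd: "k \<le> d" using 3 n by simp
    have \<beta>: "\<beta> > real d / 2" using beta_gt n by simp
    obtain mi :: int where mi: "2 * \<beta> - real n = of_int mi" "even mi" using par by blast
    \<comment> \<open>The bound on \<beta> yields only 2\<beta> - n > -1; integrality improves this
      to nonnegativity, and evenness then gives p.\<close>
    have "real_of_int mi > -1" using mi(1) \<beta> n by simp
    then have "mi \<ge> 0" by simp
    then obtain p where p: "mi = 2 * int p" using mi(2) by (metis evenE nonneg_int_cases zero_le_mult_iff zero_less_numeral not_le)
    have s: "\<beta> - real d / 2 = real p + 1/2" using mi(1) n unfolding p by simp
    have P: "?P = PiM {..d} (\<lambda>_. betap_measure \<beta> :: 'a measure)"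
      by (rule arg_cong[where f="\<lambda>I. PiM I _"]) (auto simp: d_def)
    define A where "A = {l \<in> space (lborelP {1..d} :: (nat \<Rightarrow> real) measure). \<forall>i\<in>{k..d}. 0 \<le> l i}"
    have A: "A \<in> sets (lborelP {1..d})" unfolding A_def by (rule cone_sets) (use k2 in simp)
    have cone: "(\<lambda>i\<in>{1..d}. s * l i) \<in> A \<longleftrightarrow> l \<in> A" if "s > 0" "l \<in> space (lborelP {1..d})" for s l
      using that k2 unfolding A_def by (auto simp: space_PiM zero_le_mult_iff)
    define E where "E = (\<integral>\<^sup>+X. ennreal (ang X) \<partial>?P)"
    have gp: "AE X in ?P. general_position d X"
      unfolding P d_def by (rule AE_betap_general_position[OF \<beta>[unfolded d_def]])
    have angeq: "ennreal (ang X) = inverse (total_mass d X) * gauss_mass d A X" "ang X \<ge> 0"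
      if "general_position d X" for X :: "nat \<Rightarrow> 'a"
    proof -
      have "gauss_mass d A X = cone_mass d k X"
        unfolding gauss_mass_def cone_mass_def A_def by (intro nn_integral_cong) (auto simp: indicator_def)
      then show "ennreal (ang X) = inverse (total_mass d X) * gauss_mass d A X" "ang X \<ge> 0"
        using internal_angle_eq[of X k] that k2 kd unfolding ang_def d_def by auto
    qed
    have int: "(\<integral>X. ang X \<partial>?P) = enn2real E"
      unfolding E_def
    proof (rule integral_eq_nn_integral)
      show "ang \<in> borel_measurable ?P" using 3(2) by (rule borel_measurable_integrable)
      show "AE X in ?P. 0 \<le> ang X" by (rule eventually_mono[OF gp]) (rule angeq)
    qed
    have E: "E = (\<integral>\<^sup>+X. inverse (total_mass d X) * gauss_mass d A X \<partial>(PiM {..d} (\<lambda>_. betap_measure \<beta> :: 'a measure)))"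
      unfolding E_def P[symmetric] by (rule nn_integral_cong_AE, rule eventually_mono[OF gp]) (rule angeq)
    let ?S = "space (lborelP {1..d}) :: (nat \<Rightarrow> real) set"
    have ratio: "E * cone_integral d ?S (real p + 1/2) = cone_integral d A (real p + 1/2)"
      and nz: "cone_integral d ?S (real p + 1/2) \<noteq> 0"
      using expected_cone_probability_ratio[where 'a='a and \<beta>=\<beta> and A=A, folded d_def, OF \<beta> A cone]
      unfolding E s by blast+
    obtain \<rho> where \<rho>: "\<rho> \<in> nnrat" "cone_integral d A (real p + 1/2) = ennreal (pi ^ k * \<rho>)"
      using cone_integral_even[OF k_even k2, of d p] kd unfolding A_def by auto
    \<comment> \<open>The power of pi in the whole-space integral: \<open>cone_integral_even\<close>
      is used with n itself or, for odd n, with n - 1 after the half-space reduction.\<close>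
    define N where "N = (if even n then n else n - 1)"
    have "\<exists>\<sigma>\<in>nnrat. cone_integral d ?S (real p + 1/2) = ennreal (pi ^ N * \<sigma>)"
    proof (cases "even n")
      case True
      \<comment> \<open>Here n = d + 1, so the range of constrained indices is empty.\<close>
      have "{l \<in> space (lborelP {1..d}). \<forall>i\<in>{n..d}. 0 \<le> l i} = ?S" using n by auto
      then show ?thesis using cone_integral_even[OF True, of d p] n k2 kd True by (simp add: N_def)
    next
      case False
      then have "even d" "2 \<le> d" using n k2 kd by auto
      then obtain \<sigma> where "\<sigma> \<in> nnrat" "cone_integral d {l \<in> space (lborelP {1..d}). \<forall>i\<in>{d..d}. 0 \<le> l i} (real p + 1/2) = ennreal (pi ^ d * \<sigma>)"
        using cone_integral_even[of d d p] by auto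
      moreover have "2 * ennreal (pi ^ d * \<sigma>) = ennreal (pi ^ N * (2 * \<sigma>))" for \<sigma>
      proof -
        have N2: "pi ^ N * (2 * \<sigma>) = 2 * (pi ^ d * \<sigma>)" using False n by (simp add: N_def)
        show ?thesis unfolding N2 using ennreal_mult'[of 2 "pi ^ d * \<sigma>"] by simp
      qed
      ultimately show ?thesis using cone_integral_halfspace[of d "real p + 1/2"] \<open>2 \<le> d\<close> by (intro bexI[of _ "2 * \<sigma>"]) auto
    qed
    then obtain \<sigma> where \<sigma>: "\<sigma> \<in> nnrat" "cone_integral d ?S (real p + 1/2) = ennreal (pi ^ N * \<sigma>)" by blast
    have \<sigma>0: "\<sigma> > 0" using nz \<sigma> by (cases "\<sigma> = 0") (auto simp: nnrat_def)
    have "enn2real E * (pi ^ N * \<sigma>) = pi ^ k * \<rho>"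
    proof -
      have "enn2real (E * ennreal (pi ^ N * \<sigma>)) = enn2real (ennreal (pi ^ k * \<rho>))"
        using ratio unfolding \<rho> \<sigma> by simp
      then show ?thesis using \<sigma>0 \<rho>(1) by (simp add: enn2real_mult nnrat_def)
    qed
    then have "enn2real E = (\<rho> / \<sigma>) * (pi ^ k / pi ^ N)" using \<sigma>0 by (simp add: field_simps)
    moreover have "pi ^ k / pi ^ N = pi powi (- int (N - k))"
    proof -
      have "k \<le> N" using kd k_even n by (auto simp: N_def)
      then have "pi ^ N = pi ^ k * pi ^ (N - k)" by (simp flip: power_add)
      then show ?thesis by (simp only: power_int_minus power_int_of_nat) (simp add: divide_inverse)
    qed
    ultimately have "Jtilde TYPE('a) k \<beta> = (real ((DIM('a) + 1) choose k) * (\<rho> / \<sigma>)) * pi powi (- int (N - k))"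
      using 3(1) n int unfolding Jtilde_def ang_def by (simp add: d_def)
    moreover have "real ((DIM('a) + 1) choose k) * (\<rho> / \<sigma>) \<in> \<rat>" using \<rho>(1) \<sigma>(1) by (auto simp: nnrat_def)
    \<comment> \<open>Since k is even, n - k has the parity of n, and the definition of
      \<open>N\<close> yields the exponents of the claim.\<close>
    moreover have "N - k = (if even (n - k) then n - k else n - k - 1)"
      using 3(1) k_even by (auto simp: N_def)
    ultimately show ?thesis by (metis (full_types))
  qed
qed

end
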